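(* Let $p$ be a prime, let $q$ be an odd prime that divides $p-1$, and let $r$ be a divisor of $p-1$ that is coprime to $q$. Then there exists a finite solvable group $G$ with $\mathrm{dl}(G)=4$, Fitting height $3$, and $$\mathrm{cd}(G)=\Big\{1,\ q,\ \Big(\tfrac{p^q-1}{p-1}\Big)_{q'}(p-1)_q\,q\,r,\ p^q\Big(\tfrac{p^q-1}{p-1}\Big)_{q'}(p-1)_q\,q\Big\}.$$
   Context: $\mathrm{cd}(G)$ is the set of degrees of irreducible complex characters of $G$, and $\mathrm{dl}(G)$ is the derived length of $G$. For a positive integer $N$ and a prime $q$, $N_q$ denotes the largest power of $q$ dividing $N$, and $N_{q'}=N/N_q$. *)

theory Defs
  imports "HOL-Algebra.Solvable_Groups" "HOL-Algebra.Coset" "Jordan_Normal_Form.Matrix"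
    "HOL-Computational_Algebra.Primes"
begin

definition derived_length :: "('a, 'b) monoid_scheme \<Rightarrow> nat" where
  "derived_length G = (LEAST n. ((derived G) ^^ n) (carrier G) = {\<one>\<^bsub>G\<^esub>})"

definition commutator_subgroup :: "('a, 'b) monoid_scheme \<Rightarrow> 'a set \<Rightarrow> 'a set \<Rightarrow> 'a set" where
  "commutator_subgroup G A B =
     generate G {x \<otimes>\<^bsub>G\<^esub> y \<otimes>\<^bsub>G\<^esub> inv\<^bsub>G\<^esub> x \<otimes>\<^bsub>G\<^esub> inv\<^bsub>G\<^esub> y | x y. x \<in> A \<and> y \<in> B}"

primrec lower_central :: "('a, 'b) monoid_scheme \<Rightarrow> nat \<Rightarrow> 'a set" where
  "lower_central G 0 = carrier G"
| "lower_central G (Suc k) = commutator_subgroup G (lower_central G k) (carrier G)"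

definition nilpotent_group :: "('a, 'b) monoid_scheme \<Rightarrow> bool" where
  "nilpotent_group G \<longleftrightarrow> group G \<and> (\<exists>k. lower_central G k = {\<one>\<^bsub>G\<^esub>})"

definition fitting_height :: "('a, 'b) monoid_scheme \<Rightarrow> nat" where
  "fitting_height G = (LEAST h. \<exists>N :: nat \<Rightarrow> 'a set.
      N 0 = {\<one>\<^bsub>G\<^esub>} \<and> N h = carrier G \<and>
      (\<forall>i\<le>h. N i \<lhd> G) \<and>
      (\<forall>i<h. N i \<subseteq> N (Suc i) \<and>
               nilpotent_group ((G\<lparr>carrier := N (Suc i)\<rparr>) Mod (N i))))"

definition is_rep :: "('a, 'b) monoid_scheme \<Rightarrow> nat \<Rightarrow> ('a \<Rightarrow> complex mat) \<Rightarrow> bool" where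
  "is_rep G n \<rho> \<longleftrightarrow>
     (\<forall>g\<in>carrier G. \<rho> g \<in> carrier_mat n n) \<and>
     (\<forall>g\<in>carrier G. \<forall>h\<in>carrier G. \<rho> (g \<otimes>\<^bsub>G\<^esub> h) = \<rho> g * \<rho> h) \<and>
     \<rho> \<one>\<^bsub>G\<^esub> = 1\<^sub>m n"

definition invariant_subspace ::
  "('a, 'b) monoid_scheme \<Rightarrow> nat \<Rightarrow> ('a \<Rightarrow> complex mat) \<Rightarrow> complex vec set \<Rightarrow> bool" where
  "invariant_subspace G n \<rho> W \<longleftrightarrow>
     W \<subseteq> carrier_vec n \<and> 0\<^sub>v n \<in> W \<and>
     (\<forall>v\<in>W. \<forall>w\<in>W. v + w \<in> W) \<and>
     (\<forall>c. \<forall>v\<in>W. c \<cdot>\<^sub>v v \<in> W) \<and>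
     (\<forall>g\<in>carrier G. \<forall>w\<in>W. \<rho> g *\<^sub>v w \<in> W)"

definition irreducible_rep :: "('a, 'b) monoid_scheme \<Rightarrow> nat \<Rightarrow> ('a \<Rightarrow> complex mat) \<Rightarrow> bool" where
  "irreducible_rep G n \<rho> \<longleftrightarrow> is_rep G n \<rho> \<and> n > 0 \<and>
     (\<forall>W. invariant_subspace G n \<rho> W \<longrightarrow> W = {0\<^sub>v n} \<or> W = carrier_vec n)"

text \<open>cd(G): degrees of the irreducible complex characters, i.e. the degrees of the
  irreducible complex representations.\<close>
definition char_degrees :: "('a, 'b) monoid_scheme \<Rightarrow> nat set" where
  "char_degrees G = {n. \<exists>\<rho>. irreducible_rep G n \<rho>}"

definition ppart :: "nat \<Rightarrow> nat \<Rightarrow> nat" where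
  "ppart q N = q ^ multiplicity q N"

definition pprime_part :: "nat \<Rightarrow> nat \<Rightarrow> nat" where
  "pprime_part q N = N div ppart q N"

end

theory Submission
  imports Defs "HOL-Library.Function_Algebras" "HOL-Algebra.Multiplicative_Group"
    "HOL-Number_Theory.Residue_Primitive_Roots" "HOL-Computational_Algebra.Polynomial"
begin

text \<open>
  Let \<open>F\<close> be the field with \<open>p^q\<close> elements and write \<open>m = ((p^q - 1)/(p - 1))\<^sub>q\<^sub>'\<close>,
  \<open>Q = (p - 1)\<^sub>q\<close>, \<open>M = m Q\<close>. The group \<open>G\<close> is the semidirect product of the Heisenberg
  group \<open>P\<close> of triples over \<open>F\<close> with a group \<open>H = K \<times> R\<close> of order \<open>M q \<cdot> r\<close>. Here \<open>K\<close>, of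
  order \<open>M q\<close>, consists of semilinear maps \<open>x \<mapsto> c x^(p^i)\<close> acting on both coordinates of
  \<open>P / Z(P)\<close>, and \<open>R\<close>, the roots of unity of order \<open>r\<close>, acts by \<open>s\<close> on the first and by
  \<open>s^(-1)\<close> on the second coordinate, hence trivially on \<open>Z(P)\<close>. The group \<open>H\<close> acts freely on
  the nonzero elements of each coordinate, and exactly \<open>R\<close> fixes elements of \<open>Z(P)\<close>. So the
  characters of \<open>H\<close> have degrees \<open>1\<close> and \<open>q\<close>, the nontrivial linear characters of \<open>P\<close> induce
  irreducibly to degree \<open>|H|\<close>, and the characters nontrivial on \<open>Z(P)\<close> have degree
  \<open>p^q |H : R|\<close>.

  Character theory enters only through one form of Clifford's theorem: if an irreducible
  representation contains a vector on which a subgroup \<open>T\<close> acts by a linear character \<open>\<chi>\<close>, and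
  if \<open>T\<close> contains the stabilizer of the restriction of \<open>\<chi>\<close> to a normal subset \<open>N\<close> of \<open>T\<close>,
  then the degree is \<open>|G : T|\<close>.
\<close>

text \<open>Why the action is free: K consists of the maps x -> c x^(p^i(c)), one for each root of
  unity c of order dividing M q, where i is a surjection of these roots onto the integers modulo q.
  They are closed under composition because p = 1 mod q. If such a map fixes a nonzero x, then c
  x^(p^i - 1) = 1. Since p^q - 1 divides M (p - 1), raising to the power M leaves c^M = 1, so i(c) =
  0 and then c = 1. A product of roots of unity with the group of field automorphisms would not do,
  as the Frobenius map itself fixes the prime field. The divisibility just used holds because q
  divides Q, which is why the q-part of p - 1 enters M. On the centre c becomes c^2, the product of
  the factors on the two coordinates. As M and q are odd, nothing is lost. Oddness of q also makes q
  the exact q-part of (p^q - 1)/(p - 1). Finally m is coprime to p - 1, so inside H the subgroup of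
  order m consists of commutators of its own elements with a generator of K. This keeps H from being
  nilpotent and carries both the derived length and the Fitting height.\<close>

hide_const (open) Polynomial.order

section \<open>Representations on finitely supported functions\<close>

text \<open>Vectors are functions of one type for all degrees, so that the locale
  \<open>vector_space\<close> applies with its \<open>span\<close> and \<open>dim\<close>;
  \<open>fspace n\<close> plays the part of the n-dimensional space inside it.\<close>

definition fscale :: "complex \<Rightarrow> (nat \<Rightarrow> complex) \<Rightarrow> nat \<Rightarrow> complex" where
  "fscale c f = (\<lambda>i. c * f i)"

interpretation fv: vector_space fscale
  by unfold_locales (auto simp: fscale_def fun_eq_iff algebra_simps)

lemma sum_apply: "(\<Sum>x\<in>A. f x) i = (\<Sum>x\<in>A. f x i)"
  by (induction A rule: infinite_finite_induct) auto

definition fspace :: "nat \<Rightarrow> (nat \<Rightarrow> complex) set" where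
  "fspace n = {f. \<forall>i\<ge>n. f i = 0}"

definition fbasis :: "nat \<Rightarrow> nat \<Rightarrow> complex" where
  "fbasis j = (\<lambda>i. if i = j then 1 else 0)"

lemma subspace_fspace: "fv.subspace (fspace n)"
  by (auto simp: fv.subspace_def fspace_def fscale_def)

lemma fbasis_in_fspace [simp]: "j < n \<Longrightarrow> fbasis j \<in> fspace n"
  by (auto simp: fbasis_def fspace_def)

lemma fbasis_neq_0: "fbasis j \<noteq> 0"
  by (auto simp: fbasis_def fun_eq_iff)

lemma fspace_expansion:
  assumes "f \<in> fspace n"
  shows "f = (\<Sum>j<n. fscale (f j) (fbasis j))"
proof
  fix i
  have "(\<Sum>j<n. fscale (f j) (fbasis j)) i = (\<Sum>j<n. if i = j then f j else 0)"
    unfolding sum_apply by (rule sum.cong) (auto simp: fscale_def fbasis_def)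
  also have "\<dots> = f i"
    using assms by (auto simp: fspace_def)
  finally show "f i = (\<Sum>j<n. fscale (f j) (fbasis j)) i" ..
qed

lemma subspace_eq_fspace:
  assumes "fv.subspace U" "U \<subseteq> fspace n" "\<And>j. j < n \<Longrightarrow> fbasis j \<in> U"
  shows "U = fspace n"
proof (intro equalityI assms(2) subsetI)
  fix f assume "f \<in> fspace n"
  then have "f = (\<Sum>j<n. fscale (f j) (fbasis j))" by (rule fspace_expansion)
  also have "\<dots> \<in> U"
    by (intro fv.subspace_sum fv.subspace_scale assms) auto
  finally show "f \<in> U" .
qed

lemma inj_fbasis: "inj fbasis"
  by (auto simp: inj_def fbasis_def fun_eq_iff split: if_splits)

lemma dim_fspace: "fv.dim (fspace n) = n"
proof -
  let ?B = "fbasis ` {..<n}"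
  have "fv.independent ?B"
  proof (rule fv.independent_if_scalars_zero)
    fix f x assume s: "(\<Sum>x\<in>?B. fscale (f x) x) = 0" and "x \<in> ?B"
    then obtain j where j: "x = fbasis j" "j < n" by auto
    have "(\<Sum>x\<in>?B. fscale (f x) x) = (\<Sum>j<n. fscale (f (fbasis j)) (fbasis j))"
      by (subst sum.reindex) (auto intro: inj_on_subset[OF inj_fbasis])
    then have "0 = (\<Sum>i<n. fscale (f (fbasis i)) (fbasis i)) j"
      using s by simp
    also have "\<dots> = (\<Sum>i<n. if j = i then f (fbasis i) else 0)"
      unfolding sum_apply by (rule sum.cong) (auto simp: fscale_def fbasis_def)
    also have "\<dots> = f (fbasis j)" using j by auto
    finally show "f x = 0" using j by simp
  qed auto
  moreover have "fv.span ?B \<subseteq> fspace n"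
    by (rule fv.span_minimal) (auto intro: subspace_fspace)
  then have "fv.span ?B = fspace n"
    by (intro subspace_eq_fspace fv.subspace_span) (auto intro: fv.span_base)
  ultimately have "fv.dim (fspace n) = card ?B"
    by (metis fv.dim_eq_card fv.span_span)
  then show ?thesis
    by (simp add: card_image inj_on_subset[OF inj_fbasis])
qed

text \<open>Applied with \<open>W = 0\<close> this gives linear independence, and applied to an invariant
  subspace it gives irreducibility of monomial representations.\<close>
lemma eigen_components:
  assumes W: "fv.subspace W"
    and add: "\<And>x f g. x \<in> X \<Longrightarrow> \<psi> x (f + g) = \<psi> x f + \<psi> x g"
    and scale: "\<And>x c f. x \<in> X \<Longrightarrow> \<psi> x (fscale c f) = fscale c (\<psi> x f)"
    and inv: "\<And>x f. x \<in> X \<Longrightarrow> f \<in> W \<Longrightarrow> \<psi> x f \<in> W"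
    and "finite J"
    and eig: "\<And>j x. j \<in> J \<Longrightarrow> x \<in> X \<Longrightarrow> \<psi> x (w j) = fscale (l j x) (w j)"
    and sep: "\<And>i j. i \<in> J \<Longrightarrow> j \<in> J \<Longrightarrow> i \<noteq> j \<Longrightarrow> \<exists>x\<in>X. l i x \<noteq> l j x"
    and "(\<Sum>j\<in>J. w j) \<in> W"
  shows "\<forall>j\<in>J. w j \<in> W"
  using assms(5-)
proof (induction J arbitrary: w rule: finite_induct)
  case empty
  then show ?case by simp
next
  case (insert i J)
  have s: "\<psi> x (\<Sum>j\<in>K. u j) = (\<Sum>j\<in>K. \<psi> x (u j))" if "finite K" "x \<in> X" for x u and K :: "'b set"
    using that(1)
  proof (induction K rule: finite_induct)
    case empty
    have "\<psi> x (0 + 0) = \<psi> x 0 + \<psi> x 0" by (rule add[OF that(2)])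
    then have "\<psi> x 0 = 0" by (metis add_cancel_right_left)
    then show ?case by (simp only: sum.empty)
  next
    case (insert y K)
    then show ?case by (simp only: sum.insert[OF insert.hyps(1,2)] add[OF that(2)])
  qed
  have J: "w j \<in> W" if j: "j \<in> J" for j
  proof -
    obtain x where x: "x \<in> X" "l i x \<noteq> l j x"
      using insert.prems(2)[of i j] insert.hyps j by auto
    \<comment> \<open>Subtracting \<open>l i x\<close> times the sum from its image under
      \<open>\<psi> x\<close> kills component \<open>i\<close>, keeps the others eigenvectors for
      the same eigenvalues, and multiplies component \<open>j\<close> by a nonzero number.\<close>
    define w' where "w' k = fscale (l k x - l i x) (w k)" for k
    have "(\<Sum>k\<in>J. w' k) = (\<Sum>k\<in>insert i J. w' k)"
      using insert.hyps by (simp add: w'_def)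
    also have "\<dots> = (\<Sum>k\<in>insert i J. \<psi> x (w k)) - (\<Sum>k\<in>insert i J. fscale (l i x) (w k))"
      unfolding sum_subtractf[symmetric] w'_def
      by (rule sum.cong) (use insert.prems(1) x in \<open>auto simp: fv.scale_left_diff_distrib\<close>)
    also have "\<dots> = \<psi> x (\<Sum>k\<in>insert i J. w k) - fscale (l i x) (\<Sum>k\<in>insert i J. w k)"
      using insert.hyps x by (subst s) (simp_all only: fv.scale_sum_right finite_insert)
    also have "\<dots> \<in> W"
      by (intro fv.subspace_diff fv.subspace_scale W inv x insert.prems)
    finally have "(\<Sum>k\<in>J. w' k) \<in> W" .
    moreover have "\<psi> y (w' k) = fscale (l k y) (w' k)" if "k \<in> J" "y \<in> X" for k y
      using insert.prems(1)[of k y] that by (simp add: w'_def scale mult.commute)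
    ultimately have "w' j \<in> W"
      using insert.IH[of w'] insert.prems(2) j by blast
    then have "fscale (inverse (l j x - l i x)) (w' j) \<in> W"
      by (intro fv.subspace_scale W)
    then show ?thesis using x by (simp add: w'_def)
  qed
  have "w i = (\<Sum>k\<in>insert i J. w k) - (\<Sum>k\<in>J. w k)"
    using insert.hyps by simp
  also have "\<dots> \<in> W"
    by (intro fv.subspace_diff W insert.prems fv.subspace_sum J)
  finally show ?case using J by blast
qed

text \<open>Coset membership has the form in which the entries of an induced representation are
  written, and the numbering by \<open>i < k\<close> lets representatives index rows, columns and
  basis vectors.\<close>

lemma (in group) transversal:
  assumes "finite (carrier G)" "subgroup T G"
  obtains x k where "k * card T = order G" "\<And>i. i < k \<Longrightarrow> x i \<in> carrier G"
    "\<And>g. g \<in> carrier G \<Longrightarrow> \<exists>i<k. g \<otimes> inv (x i) \<in> T"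
    "\<And>i j. i < k \<Longrightarrow> j < k \<Longrightarrow> x i \<otimes> inv (x j) \<in> T \<Longrightarrow> i = (j::nat)"
proof -
  let ?R = "rcosets T"
  have fin: "finite ?R" using assms by (simp add: RCOSETS_def)
  obtain f where f: "bij_betw f {..<card ?R} ?R"
    using ex_bij_betw_nat_finite[OF fin] by (auto simp: atLeast0LessThan)
  define x where "x i = (SOME y. y \<in> f i)" for i
  have T: "T \<subseteq> carrier G" using assms by (simp add: subgroup.subset)
  have fx: "f i = T #> x i \<and> x i \<in> carrier G" if "i < card ?R" for i
  proof -
    have "f i \<in> ?R" using f that by (auto simp: bij_betw_def)
    then obtain a where a: "a \<in> carrier G" "f i = T #> a" by (auto simp: RCOSETS_def)
    then have "\<exists>y. y \<in> f i" using rcos_self[OF a(1) assms(2)] by auto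
    then have "x i \<in> f i" unfolding x_def by (rule someI_ex)
    then show ?thesis
      using a repr_independence[OF _ _ assms(2), of "x i" a] T r_coset_subset_G by blast
  qed
  show ?thesis
  proof (rule that[of "card ?R" x])
    show "card ?R * card T = order G" by (rule lagrange[OF assms(2)])
    show "x i \<in> carrier G" if "i < card ?R" for i using fx that by blast
  next
    fix g assume g: "g \<in> carrier G"
    then have "T #> g \<in> ?R" using T by (simp add: rcosetsI)
    then obtain i where i: "i < card ?R" "f i = T #> g" using f unfolding bij_betw_def by (metis imageE lessThan_iff)
    then have "g \<in> T #> x i" using fx[of i] rcos_self[OF g assms(2)] by auto
    then obtain t where "t \<in> T" "g = t \<otimes> x i" by (auto simp: r_coset_def)
    then have "g \<otimes> inv (x i) = t" using fx[OF i(1)] T by (auto simp: m_assoc)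
    then show "\<exists>i<card ?R. g \<otimes> inv (x i) \<in> T" using \<open>t \<in> T\<close> i by auto
  next
    fix i j assume ij: "i < card ?R" "j < card ?R" "x i \<otimes> inv (x j) \<in> T"
    then have "x i = (x i \<otimes> inv (x j)) \<otimes> x j" using fx by (simp add: m_assoc)
    then have "x i \<in> T #> x j" using ij by (auto simp: r_coset_def)
    then have "T #> x i = T #> x j"
      using repr_independence[OF _ _ assms(2), of "x i" "x j"] fx[OF ij(2)] by auto
    then have "f i = f j" using fx ij by auto
    then show "i = j" using f ij by (auto simp: bij_betw_def inj_on_def)
  qed
qed

text \<open>The j-th power of the k-th root is the k-th power of the j-th root, so the sum is
  geometric with a ratio different from 1.\<close>

lemma sum_roots_of_unity_power:
  fixes N j :: nat
  assumes "0 < j" "j < N"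
  shows "(\<Sum>k<N. cis (2 * pi * real k / real N) ^ j) = 0"
proof -
  let ?z = "\<lambda>k::nat. cis (2 * pi * real k / real N)"
  have N: "N > 0" using assms by simp
  have z: "?z k ^ j = ?z j ^ k" for k
    by (simp add: DeMoivre mult_ac)
  have "?z j \<noteq> ?z 0"
  proof
    assume "?z j = ?z 0"
    then have "j = 0"
      by (rule inj_onD[OF bij_betw_imp_inj_on[OF bij_betw_roots_unity[OF N]]]) (use assms in auto)
    then show False using assms by simp
  qed
  then have "?z j \<noteq> 1" by simp
  moreover have "?z j ^ N = 1"
    using bij_betw_roots_unity[OF N] assms by (auto simp: bij_betw_def)
  ultimately show ?thesis
    unfolding z using geometric_sum[of "?z j" N] by (simp add: atLeast0LessThan)
qed

text \<open>Used contrapositively: representatives of different cosets of a group containing the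
  stabilizer conjugate \<chi> to different characters of \<open>N\<close>. The proof substitutes the
  conjugate of \<open>a\<close> by \<open>inv y\<close>.\<close>

lemma (in group) conj_ratio:
  assumes xy: "x \<in> carrier G" "y \<in> carrier G"
    and N: "N \<subseteq> carrier G" "\<And>g a. g \<in> carrier G \<Longrightarrow> a \<in> N \<Longrightarrow> g \<otimes> a \<otimes> inv g \<in> N"
    and eq: "\<And>a. a \<in> N \<Longrightarrow> \<chi> (x \<otimes> a \<otimes> inv x) = \<chi> (y \<otimes> a \<otimes> inv y)"
    and a: "a \<in> N"
  shows "\<chi> ((x \<otimes> inv y) \<otimes> a \<otimes> inv (x \<otimes> inv y)) = \<chi> a"
proof -
  let ?b = "inv y \<otimes> a \<otimes> inv (inv y)"
  have aG: "a \<in> carrier G" using N a by auto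
  have "\<chi> (x \<otimes> ?b \<otimes> inv x) = \<chi> (y \<otimes> ?b \<otimes> inv y)"
    by (rule eq) (use N(2)[OF inv_closed[OF xy(2)] a] in simp)
  moreover have "y \<otimes> ?b \<otimes> inv y = a"
    using xy aG by (simp add: m_assoc) (simp add: m_assoc[symmetric])
  ultimately show ?thesis
    using xy aG by (simp add: m_assoc inv_mult_group)
qed

text \<open>The product and unit laws are restricted to \<open>fspace n\<close> because an operator
  coming from a matrix discards the values from index \<open>n\<close> on; even the unit matrix acts
  as a projection on all functions.\<close>

locale fun_rep = group G for G (structure) +
  fixes n :: nat and \<phi> :: "'a \<Rightarrow> (nat \<Rightarrow> complex) \<Rightarrow> nat \<Rightarrow> complex"
  assumes finite_G: "finite (carrier G)"
    and add: "g \<in> carrier G \<Longrightarrow> \<phi> g (f + f') = \<phi> g f + \<phi> g f'"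
    and scale: "g \<in> carrier G \<Longrightarrow> \<phi> g (fscale c f) = fscale c (\<phi> g f)"
    and range: "g \<in> carrier G \<Longrightarrow> f \<in> fspace n \<Longrightarrow> \<phi> g f \<in> fspace n"
    and mult: "g \<in> carrier G \<Longrightarrow> h \<in> carrier G \<Longrightarrow> f \<in> fspace n \<Longrightarrow> \<phi> (g \<otimes> h) f = \<phi> g (\<phi> h f)"
    and one: "f \<in> fspace n \<Longrightarrow> \<phi> \<one> f = f"
begin

lemma zero: "g \<in> carrier G \<Longrightarrow> \<phi> g 0 = 0"
  using add[of g 0 0] by (metis add_cancel_right_left)

lemma sum:
  assumes "g \<in> carrier G" "finite A"
  shows "\<phi> g (\<Sum>j\<in>A. f j) = (\<Sum>j\<in>A. \<phi> g (f j))"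
  using assms(2)
proof (induction A rule: finite_induct)
  case (insert x F)
  then show ?case
    using assms(1) by (simp only: sum.insert[OF insert.hyps(1,2)] add)
qed (use assms(1) in \<open>simp only: sum.empty zero\<close>)

lemma inv_cancel: "g \<in> carrier G \<Longrightarrow> f \<in> fspace n \<Longrightarrow> \<phi> (inv g) (\<phi> g f) = f"
  by (simp add: mult[symmetric] one)

lemma neq_0: "g \<in> carrier G \<Longrightarrow> f \<in> fspace n \<Longrightarrow> f \<noteq> 0 \<Longrightarrow> \<phi> g f \<noteq> 0"
  using inv_cancel[of g f] zero[of "inv g"] by auto

definition irreducible :: bool where
  "irreducible \<longleftrightarrow> (\<forall>U. fv.subspace U \<and> U \<subseteq> fspace n \<and> (\<forall>g\<in>carrier G. \<forall>f\<in>U. \<phi> g f \<in> U)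
     \<longrightarrow> U = {0} \<or> U = fspace n)"

lemma irreducibleD:
  assumes irreducible "fv.subspace U" "U \<subseteq> fspace n"
    "\<And>g f. g \<in> carrier G \<Longrightarrow> f \<in> U \<Longrightarrow> \<phi> g f \<in> U" "u \<in> U" "u \<noteq> 0"
  shows "U = fspace n"
  using assms unfolding irreducible_def by (metis singletonD)

text \<open>Averaging over the cyclic group generated by \<open>s\<close> against all its characters.\<close>
lemma eigenvector:
  assumes s: "s \<in> carrier G" and U: "fv.subspace U" "U \<subseteq> fspace n"
    and inv: "\<And>f. f \<in> U \<Longrightarrow> \<phi> s f \<in> U" and u: "u \<in> U" "u \<noteq> 0"
  obtains v c where "v \<in> U" "v \<noteq> 0" "\<phi> s v = fscale c v"
proof -
  \<comment> \<open>Any exponent that kills \<open>s\<close> serves for the averaging; the order of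
    the group is one.\<close>
  define N where "N = order G"
  have N: "N > 0" using finite_G by (simp add: N_def order_gt_0_iff_finite)
  have sN: "s [^] N = \<one>" using s unfolding N_def by (rule pow_order_eq_1)
  define z where "z k = cis (2 * pi * real k / real N)" for k :: nat
  have zN: "z k ^ N = 1" for k
    using N by (simp add: z_def DeMoivre)
  define g where "g k j = fscale (z k ^ j) (\<phi> (s [^] j) u)" for k j :: nat
  define f where "f k = (\<Sum>j<N. g k j)" for k
  have pow: "\<phi> (s [^] j) u \<in> U" for j :: nat
  proof (induction j)
    case (Suc j)
    have "s [^] Suc j = s \<otimes> s [^] j" using s by (metis nat_pow_Suc2)
    then have "\<phi> (s [^] Suc j) u = \<phi> s (\<phi> (s [^] j) u)"
      using s u U by (simp add: mult subset_iff del: nat_pow_Suc)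
    then show ?case using inv Suc by simp
  qed (use u U one in \<open>simp add: subset_iff\<close>)
  have fU: "f k \<in> U" for k
    unfolding f_def g_def by (intro fv.subspace_sum fv.subspace_scale U pow)
  have gN: "g k N = g k 0" for k by (simp add: g_def zN sN)
  have "fscale (z k) (\<phi> s (f k)) = f k" for k
  proof -
    have "fscale (z k) (\<phi> s (g k j)) = g k (Suc j)" for j
    proof -
      have "s [^] Suc j = s \<otimes> s [^] j" using s by (metis nat_pow_Suc2)
      then have "\<phi> (s [^] Suc j) u = \<phi> s (\<phi> (s [^] j) u)"
        using s u U by (simp add: mult subset_iff del: nat_pow_Suc)
      then show ?thesis using s by (simp add: g_def scale del: nat_pow_Suc)
    qed
    then have "fscale (z k) (\<phi> s (f k)) = (\<Sum>j<N. g k (Suc j))"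
      using s by (simp add: f_def sum fv.scale_sum_right)
    also have "\<dots> = f k"
    proof -
      have "g k 0 + (\<Sum>j<N. g k (Suc j)) = (\<Sum>j<Suc N. g k j)"
        by (rule sum.lessThan_Suc_shift[symmetric])
      also have "\<dots> = (\<Sum>j<N. g k j) + g k 0"
        unfolding sum.lessThan_Suc gN ..
      finally have "g k 0 + (\<Sum>j<N. g k (Suc j)) = g k 0 + (\<Sum>j<N. g k j)"
        by (simp only: add.commute)
      then show ?thesis unfolding f_def by (rule add_left_imp_eq)
    qed
    finally show ?thesis .
  qed
  then have "fscale (inverse (z k)) (fscale (z k) (\<phi> s (f k))) = fscale (inverse (z k)) (f k)" for k
    by (rule arg_cong)
  moreover have "inverse (z k) * z k = 1" for k
    unfolding z_def by (intro left_inverse cis_neq_zero)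
  ultimately have eig: "\<phi> s (f k) = fscale (inverse (z k)) (f k)" for k
    by (simp only: fv.scale_scale fv.scale_one)
  \<comment> \<open>By orthogonality only the term j = 0 survives: the candidates \<open>f k\<close>
    add up to \<open>N\<close> times \<open>u\<close> and cannot all vanish.\<close>
  have "(\<Sum>k<N. f k) = (\<Sum>j<N. \<Sum>k<N. g k j)"
    unfolding f_def by (rule sum.swap)
  also have "\<dots> = (\<Sum>j<N. fscale (\<Sum>k<N. z k ^ j) (\<phi> (s [^] j) u))"
    unfolding g_def by (simp only: fv.scale_sum_left)
  also have "\<dots> = (\<Sum>j<N. if j = 0 then fscale (of_nat N) u else 0)"
  proof (rule sum.cong[OF refl])
    fix j assume j: "j \<in> {..<N}"
    show "fscale (\<Sum>k<N. z k ^ j) (\<phi> (s [^] j) u) = (if j = 0 then fscale (of_nat N) u else 0)"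
    proof (cases "j = 0")
      case False
      then have "(\<Sum>k<N. z k ^ j) = 0"
        using j unfolding z_def by (intro sum_roots_of_unity_power) auto
      then show ?thesis using False by (simp only: fv.scale_zero_left if_False)
    qed (use u U one in \<open>simp add: subset_iff\<close>)
  qed
  also have "\<dots> = fscale (of_nat N) u" using N by (simp only: sum.delta finite_lessThan lessThan_iff if_True)
  finally have "(\<Sum>k<N. f k) = fscale (of_nat N) u" .
  moreover have "fscale (of_nat N) u \<noteq> 0" using u N by simp
  ultimately have "(\<Sum>k<N. f k) \<noteq> 0" by (simp only: not_False_eq_True)
  then obtain k where "f k \<noteq> 0" by (rule sum.not_neutral_contains_not_neutral)
  then show ?thesis by (rule that[OF fU _ eig])
qed

text \<open>The common eigenspace of the operators treated so far is invariant under the next one,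
  which therefore has an eigenvector inside it. Commutation is asked of the operators on
  \<open>U\<close> and not of the group elements, so that groups abelian modulo the kernel are
  covered.\<close>

lemma common_eigenvector:
  assumes U: "fv.subspace U" "U \<subseteq> fspace n" and u: "u \<in> U" "u \<noteq> 0"
    and S: "S \<subseteq> carrier G" and inv: "\<And>s f. s \<in> S \<Longrightarrow> f \<in> U \<Longrightarrow> \<phi> s f \<in> U"
    and comm: "\<And>s t f. s \<in> S \<Longrightarrow> t \<in> S \<Longrightarrow> f \<in> U \<Longrightarrow> \<phi> s (\<phi> t f) = \<phi> t (\<phi> s f)"
  obtains v \<chi> where "v \<in> U" "v \<noteq> 0" "\<And>s. s \<in> S \<Longrightarrow> \<phi> s v = fscale (\<chi> s) v"
proof -
  have "finite S" using S finite_G finite_subset by blast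
  then have "\<exists>v \<chi>. v \<in> U \<and> v \<noteq> 0 \<and> (\<forall>s\<in>S. \<phi> s v = fscale (\<chi> s) v)"
    using S inv comm
  proof (induction S rule: finite_induct)
    case empty
    show ?case
      by (rule exI[of _ u], rule exI[of _ "\<lambda>_. 0"], rule conjI[OF u(1) conjI[OF u(2)]])
        (rule ballI, erule emptyE)
  next
    case (insert t S)
    have "\<exists>v \<chi>. v \<in> U \<and> v \<noteq> 0 \<and> (\<forall>s\<in>S. \<phi> s v = fscale (\<chi> s) v)"
    proof (rule insert.IH)
      show "S \<subseteq> carrier G" using insert.prems(1) by simp
      show "\<phi> s f \<in> U" if "s \<in> S" "f \<in> U" for s f
        by (rule insert.prems(2)) (simp_all add: that)
      show "\<phi> s (\<phi> t f) = \<phi> t (\<phi> s f)" if "s \<in> S" "t \<in> S" "f \<in> U" for s t f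
        by (rule insert.prems(3)) (simp_all add: that)
    qed
    then obtain v where "\<exists>\<chi>. v \<in> U \<and> v \<noteq> 0 \<and> (\<forall>s\<in>S. \<phi> s v = fscale (\<chi> s) v)" by (rule exE)
    then obtain \<chi> where "v \<in> U \<and> v \<noteq> 0 \<and> (\<forall>s\<in>S. \<phi> s v = fscale (\<chi> s) v)" by (rule exE)
    then have v: "v \<in> U" "v \<noteq> 0" "\<forall>s\<in>S. \<phi> s v = fscale (\<chi> s) v" by simp_all
    let ?E = "{f \<in> U. \<forall>s\<in>S. \<phi> s f = fscale (\<chi> s) f}"
    have t: "t \<in> carrier G" and SG: "S \<subseteq> carrier G" using insert.prems by auto
    have E: "fv.subspace ?E"
      unfolding fv.subspace_def
    proof (intro conjI ballI allI)
      show "0 \<in> ?E" using fv.subspace_0[OF U(1)] SG by (simp add: zero subset_iff)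
      show "f + g \<in> ?E" if "f \<in> ?E" "g \<in> ?E" for f g
        using that U(1) SG by (simp add: subset_iff add fv.subspace_add fv.scale_right_distrib)
      show "fscale c f \<in> ?E" if "f \<in> ?E" for f c
        using that U(1) SG by (simp add: subset_iff scale fv.subspace_scale mult.commute)
    qed
    have inv: "\<phi> t f \<in> ?E" if "f \<in> ?E" for f
    proof -
      have "\<phi> s (\<phi> t f) = fscale (\<chi> s) (\<phi> t f)" if "s \<in> S" for s
      proof -
        have f: "f \<in> U" "\<phi> s f = fscale (\<chi> s) f" using that \<open>f \<in> ?E\<close> by simp_all
        have "\<phi> s (\<phi> t f) = \<phi> t (\<phi> s f)" by (rule insert.prems(3)) (simp_all add: that f(1))
        also have "\<dots> = fscale (\<chi> s) (\<phi> t f)" unfolding f(2) by (rule scale[OF t])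
        finally show ?thesis .
      qed
      moreover have "\<phi> t f \<in> U" by (rule insert.prems(2)) (use that in simp_all)
      ultimately show ?thesis by simp
    qed
    have EU: "?E \<subseteq> fspace n" using U(2) by (rule order_trans[rotated]) (rule Collect_restrict)
    have "v \<in> ?E" using v by simp
    obtain w c where w: "w \<in> ?E" "w \<noteq> 0" "\<phi> t w = fscale c w"
      by (rule eigenvector[OF t E EU inv \<open>v \<in> ?E\<close> v(2)])
    have "\<phi> s w = fscale ((\<chi>(t := c)) s) w" if "s \<in> insert t S" for s
      using that w insert.hyps by (cases "s = t") simp_all
    moreover have "w \<in> U" using w by simp
    ultimately show ?case using w(2) by (intro exI[of _ w] exI[of _ "\<chi>(t := c)"] conjI ballI)
  qed
  then obtain v where "\<exists>\<chi>. v \<in> U \<and> v \<noteq> 0 \<and> (\<forall>s\<in>S. \<phi> s v = fscale (\<chi> s) v)" by (rule exE)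
  then obtain \<chi> where v: "v \<in> U \<and> v \<noteq> 0 \<and> (\<forall>s\<in>S. \<phi> s v = fscale (\<chi> s) v)" by (rule exE)
  show ?thesis by (rule that[of v \<chi>]) (use v in simp_all)
qed

text \<open>The translates of \<open>v\<close> along the cosets of \<open>T\<close> span an invariant subspace, and they are
  independent because \<open>N\<close> acts on them by pairwise distinct characters.\<close>
lemma irreducible_degree:
  assumes irr: irreducible and T: "subgroup T G"
    and v: "v \<in> fspace n" "v \<noteq> 0" "\<And>t. t \<in> T \<Longrightarrow> \<phi> t v = fscale (\<chi> t) v"
    and N: "N \<subseteq> T" "\<And>g x. g \<in> carrier G \<Longrightarrow> x \<in> N \<Longrightarrow> g \<otimes> x \<otimes> inv g \<in> N"
    and stab: "\<And>g. g \<in> carrier G \<Longrightarrow> (\<And>x. x \<in> N \<Longrightarrow> \<chi> (g \<otimes> x \<otimes> inv g) = \<chi> x) \<Longrightarrow> g \<in> T"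
  shows "n * card T = order G"
proof -
  obtain x k where k: "k * card T = order G" and x: "\<And>i. i < k \<Longrightarrow> x i \<in> carrier G"
    and ex: "\<And>g. g \<in> carrier G \<Longrightarrow> \<exists>i<k. g \<otimes> inv (x i) \<in> T"
    and un: "\<And>i j. i < k \<Longrightarrow> j < k \<Longrightarrow> x i \<otimes> inv (x j) \<in> T \<Longrightarrow> i = (j::nat)"
    using transversal[OF finite_G T] by metis
  have TG: "T \<subseteq> carrier G" using T by (rule subgroup.subset)
  \<comment> \<open>The \<open>x j\<close> represent cosets T x, so their inverses represent the
    cosets x T that index the translates of the line through \<open>v\<close>.\<close>
  define w where "w j = \<phi> (inv (x j)) v" for j
  have w: "w j \<in> fspace n" "w j \<noteq> 0" if "j < k" for j
    using that x v by (auto simp: w_def range neq_0)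
  let ?W = "fv.span (w ` {..<k})"
  have W: "?W \<subseteq> fspace n"
    by (rule fv.span_minimal) (use w subspace_fspace in auto)
  have gw: "\<phi> g (w j) \<in> ?W" if g: "g \<in> carrier G" and j: "j < k" for g j
  proof -
    obtain i where i: "i < k" "(x j \<otimes> inv g) \<otimes> inv (x i) \<in> T"
      using ex[of "x j \<otimes> inv g"] g j x by auto
    let ?t = "x i \<otimes> g \<otimes> inv (x j)"
    have "inv ((x j \<otimes> inv g) \<otimes> inv (x i)) \<in> T" using i T by (simp add: subgroup.m_inv_closed)
    then have t: "?t \<in> T" using g x j i by (simp add: inv_mult_group m_assoc)
    have "g \<otimes> inv (x j) = inv (x i) \<otimes> ?t" using g x j i by (simp add: m_assoc[symmetric])
    then have "\<phi> g (w j) = \<phi> (inv (x i)) (\<phi> ?t v)"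
      unfolding w_def using mult[symmetric] g x i j v by simp
    also have "\<dots> = fscale (\<chi> ?t) (w i)"
      using v(3)[OF t] x i by (simp add: scale w_def)
    also have "\<dots> \<in> ?W" using i by (intro fv.span_scale fv.span_base) auto
    finally show ?thesis .
  qed
  have inv: "\<phi> g f \<in> ?W" if g: "g \<in> carrier G" and "f \<in> ?W" for g f
  proof -
    have "?W \<subseteq> {f. \<phi> g f \<in> ?W}"
      by (rule fv.span_minimal)
        (use gw g in \<open>auto simp: fv.subspace_def add scale zero fv.span_zero intro: fv.span_add fv.span_scale\<close>)
    then show ?thesis using that by auto
  qed
  have "k > 0" using k finite_G by (metis gr0I mult_0 order_gt_0_iff_finite less_not_refl)
  then have "?W = fspace n"
    by (intro irreducibleD[OF irr _ W inv, of "w 0"] w) (auto intro: fv.span_base)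
  have key: "\<forall>j\<in>{..<k}. fscale (c j) (w j) = 0" if "(\<Sum>j<k. fscale (c j) (w j)) = 0" for c
  proof -
    have "\<forall>j\<in>{..<k}. fscale (c j) (w j) \<in> {0}"
    proof (rule eigen_components[where X = N and \<psi> = \<phi> and l = "\<lambda>j y. \<chi> (x j \<otimes> y \<otimes> inv (x j))"])
      show "fv.subspace {0}" by (auto simp: fv.subspace_def)
      fix y j assume j: "j \<in> {..<k}" and y: "y \<in> N"
      then have yG: "y \<in> carrier G" "x j \<in> carrier G" using N TG x by auto
      let ?y = "x j \<otimes> y \<otimes> inv (x j)"
      have "y \<otimes> inv (x j) = inv (x j) \<otimes> ?y" using yG by (simp add: m_assoc[symmetric])
      then have "\<phi> y (w j) = \<phi> (inv (x j)) (\<phi> ?y v)"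
        unfolding w_def using mult[symmetric] yG v by simp
      also have "\<dots> = fscale (\<chi> ?y) (w j)"
        using v(3)[of ?y] N yG y by (simp add: scale w_def subset_iff)
      finally have "\<phi> y (w j) = fscale (\<chi> ?y) (w j)" .
      then show "\<phi> y (fscale (c j) (w j)) = fscale (\<chi> ?y) (fscale (c j) (w j))"
        using yG by (simp add: scale mult.commute)
    next
      fix i j assume ij: "i \<in> {..<k}" "j \<in> {..<k}" "i \<noteq> j"
      then have G: "x i \<in> carrier G" "x j \<in> carrier G" using x by auto
      show "\<exists>y\<in>N. \<chi> (x i \<otimes> y \<otimes> inv (x i)) \<noteq> \<chi> (x j \<otimes> y \<otimes> inv (x j))"
      proof (rule ccontr)
        assume "\<not> ?thesis"
        then have eq: "\<chi> (x i \<otimes> y \<otimes> inv (x i)) = \<chi> (x j \<otimes> y \<otimes> inv (x j))" if "y \<in> N" for y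
          using that by blast
        have "x i \<otimes> inv (x j) \<in> T"
        proof (rule stab)
          show "x i \<otimes> inv (x j) \<in> carrier G" using G by simp
          show "\<chi> (x i \<otimes> inv (x j) \<otimes> y \<otimes> inv (x i \<otimes> inv (x j))) = \<chi> y" if "y \<in> N" for y
            by (rule conj_ratio[OF G _ N(2) eq that]) (use N TG in auto)
        qed
        then show False using un ij by auto
      qed
    qed (use that N TG in \<open>auto simp: add scale zero\<close>)
    then show ?thesis by blast
  qed
  have inj: "inj_on w {..<k}"
  proof (rule inj_onI, rule ccontr)
    fix i j assume ij: "i \<in> {..<k}" "j \<in> {..<k}" "w i = w j" "i \<noteq> j"
    let ?c = "\<lambda>l. (if l = i then 1 else if l = j then - 1 else 0) :: complex"
    have "(\<Sum>l<k. fscale (?c l) (w l)) = (\<Sum>l\<in>{i,j}. fscale (?c l) (w l))"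
      using ij by (intro sum.mono_neutral_right) auto
    also have "\<dots> = 0" using ij by simp
    finally have "(\<Sum>l<k. fscale (?c l) (w l)) = 0" .
    from bspec[OF key[OF this] ij(1)] have "w i = 0" by simp
    then show False using ij(1) w by simp
  qed
  have "fv.independent (w ` {..<k})"
  proof (rule fv.independent_if_scalars_zero)
    fix f u assume "(\<Sum>x\<in>w ` {..<k}. fscale (f x) x) = 0" "u \<in> w ` {..<k}"
    then show "f u = 0"
      using key[of "\<lambda>j. f (w j)"] w by (subst (asm) sum.reindex[OF inj]) auto
  qed auto
  then have "fv.dim (fspace n) = card (w ` {..<k})"
    using \<open>?W = fspace n\<close> by (metis fv.dim_eq_card fv.span_span)
  then have "n = k" by (simp add: dim_fspace card_image[OF inj])
  then show ?thesis using k by simp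
qed

end

section \<open>Matrix representations as operators on functions\<close>

definition mat_fun :: "complex mat \<Rightarrow> (nat \<Rightarrow> complex) \<Rightarrow> nat \<Rightarrow> complex" where
  "mat_fun M f = (\<lambda>i. if i < dim_row M then \<Sum>j<dim_col M. M $$ (i,j) * f j else 0)"

lemma vec_mat_fun:
  "M \<in> carrier_mat n n \<Longrightarrow> vec n (mat_fun M f) = M *\<^sub>v vec n f"
  by (rule eq_vecI) (simp_all add: mat_fun_def scalar_prod_def atLeast0LessThan)

lemma mat_fun_in_fspace: "M \<in> carrier_mat n n \<Longrightarrow> mat_fun M f \<in> fspace n"
  by (auto simp: mat_fun_def fspace_def)

lemma vec_inject_fspace: "f \<in> fspace n \<Longrightarrow> g \<in> fspace n \<Longrightarrow> vec n f = vec n g \<Longrightarrow> f = g"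
proof
  fix i assume a: "f \<in> fspace n" "g \<in> fspace n" "vec n f = vec n g"
  show "f i = g i"
  proof (cases "i < n")
    case True
    then show ?thesis using arg_cong[OF a(3), of "\<lambda>v. v $ i"] by simp
  next
    case False
    then show ?thesis using a by (simp add: fspace_def)
  qed
qed

lemma mat_fun_fbasis:
  assumes "M \<in> carrier_mat n n" "j < n" "i < n" "\<And>l. l < n \<Longrightarrow> l \<noteq> i \<Longrightarrow> M $$ (l, j) = 0"
  shows "mat_fun M (fbasis j) = fscale (M $$ (i, j)) (fbasis i)"
proof
  fix l
  have "(\<Sum>k<n. M $$ (l, k) * fbasis j k) = (\<Sum>k<n. if k = j then M $$ (l, k) else 0)"
    by (rule sum.cong) (auto simp: fbasis_def)
  then show "mat_fun M (fbasis j) l = fscale (M $$ (i, j)) (fbasis i) l"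
    using assms by (auto simp: mat_fun_def fscale_def fbasis_def)
qed

lemma fun_rep_of_is_rep:
  assumes "group G" "finite (carrier G)" "is_rep G n \<rho>"
  shows "fun_rep G n (\<lambda>g. mat_fun (\<rho> g))"
proof -
  interpret group G by fact
  have M: "\<rho> g \<in> carrier_mat n n" if "g \<in> carrier G" for g
    using assms(3) that by (auto simp: is_rep_def)
  show ?thesis
  proof
    show "finite (carrier G)" by fact
    fix g f f' c assume g: "g \<in> carrier G"
    show "mat_fun (\<rho> g) (f + f') = mat_fun (\<rho> g) f + mat_fun (\<rho> g) f'"
      by (rule ext) (simp add: mat_fun_def distrib_left sum.distrib)
    show "mat_fun (\<rho> g) (fscale c f) = fscale c (mat_fun (\<rho> g) f)"
      by (rule ext) (simp add: mat_fun_def fscale_def sum_distrib_left mult_ac)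
    show "mat_fun (\<rho> g) f \<in> fspace n" using mat_fun_in_fspace M g .
  next
    fix g h f assume gh: "g \<in> carrier G" "h \<in> carrier G"
    have "\<rho> (g \<otimes>\<^bsub>G\<^esub> h) = \<rho> g * \<rho> h" using gh assms(3) by (auto simp: is_rep_def)
    then have "vec n (mat_fun (\<rho> (g \<otimes>\<^bsub>G\<^esub> h)) f) = vec n (mat_fun (\<rho> g) (mat_fun (\<rho> h) f))"
      using gh M[of g] M[of h] M[of "g \<otimes>\<^bsub>G\<^esub> h"]
      by (simp add: vec_mat_fun assoc_mult_mat_vec[of _ n n _ n])
    then show "mat_fun (\<rho> (g \<otimes>\<^bsub>G\<^esub> h)) f = mat_fun (\<rho> g) (mat_fun (\<rho> h) f)"
      using gh by (intro vec_inject_fspace[of _ n] mat_fun_in_fspace M) auto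
  next
    fix f assume f: "f \<in> fspace n"
    have "\<rho> \<one>\<^bsub>G\<^esub> = 1\<^sub>m n" using assms(3) by (auto simp: is_rep_def)
    then have "vec n (mat_fun (\<rho> \<one>\<^bsub>G\<^esub>) f) = vec n f"
      using M[of "\<one>\<^bsub>G\<^esub>"] by (simp add: vec_mat_fun)
    then show "mat_fun (\<rho> \<one>\<^bsub>G\<^esub>) f = f"
      using f by (intro vec_inject_fspace[of _ n] mat_fun_in_fspace M) auto
  qed
qed

lemma irreducible_rep_iff:
  assumes "group G" "finite (carrier G)" "is_rep G n \<rho>"
  shows "irreducible_rep G n \<rho> \<longleftrightarrow> n > 0 \<and> fun_rep.irreducible G n (\<lambda>g. mat_fun (\<rho> g))"
proof -
  interpret fun_rep G n "\<lambda>g. mat_fun (\<rho> g)" by (rule fun_rep_of_is_rep[OF assms])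
  have M: "\<rho> g \<in> carrier_mat n n" if "g \<in> carrier G" for g
    using assms(3) that by (auto simp: is_rep_def)
  have v_add: "vec n (f + f') = vec n f + vec n f'" for f f' :: "nat \<Rightarrow> complex"
    by (intro eq_vecI) auto
  have v_scale: "vec n (fscale c f) = c \<cdot>\<^sub>v vec n f" for c f
    by (intro eq_vecI) (auto simp: fscale_def)
  have v_0: "vec n 0 = 0\<^sub>v n"
    by (intro eq_vecI) auto
  have surj: "\<exists>f\<in>fspace n. v = vec n f" if "v \<in> carrier_vec n" for v :: "complex vec"
    by (rule bexI[of _ "\<lambda>i. if i < n then v $ i else 0"])
      (use that in \<open>auto simp: fspace_def intro: eq_vecI\<close>)
  have "(\<forall>W. invariant_subspace G n \<rho> W \<longrightarrow> W = {0\<^sub>v n} \<or> W = carrier_vec n) \<longleftrightarrow> irreducible"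
  proof
    assume W: "\<forall>W. invariant_subspace G n \<rho> W \<longrightarrow> W = {0\<^sub>v n} \<or> W = carrier_vec n"
    show irreducible
      unfolding irreducible_def
    proof (intro allI impI, elim conjE)
      fix U assume U: "fv.subspace U" "U \<subseteq> fspace n" "\<forall>g\<in>carrier G. \<forall>f\<in>U. mat_fun (\<rho> g) f \<in> U"
      have "invariant_subspace G n \<rho> (vec n ` U)"
        unfolding invariant_subspace_def
      proof (intro conjI ballI allI)
        show "0\<^sub>v n \<in> vec n ` U" using imageI[OF fv.subspace_0[OF U(1)], of "vec n"] by (simp only: v_0)
        show "v + w \<in> vec n ` U" if "v \<in> vec n ` U" "w \<in> vec n ` U" for v w
          using that U by (auto simp: v_add[symmetric] intro!: imageI fv.subspace_add)
        show "c \<cdot>\<^sub>v v \<in> vec n ` U" if "v \<in> vec n ` U" for v c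
          using that U by (auto simp: v_scale[symmetric] intro!: imageI fv.subspace_scale)
        show "\<rho> g *\<^sub>v w \<in> vec n ` U" if "g \<in> carrier G" "w \<in> vec n ` U" for g w
          using that U M by (auto simp: vec_mat_fun[symmetric])
      qed auto
      then consider "vec n ` U = {0\<^sub>v n}" | "vec n ` U = carrier_vec n" using W by blast
      then show "U = {0} \<or> U = fspace n"
      proof cases
        case 1
        have "f = 0" if "f \<in> U" for f
        proof (rule vec_inject_fspace)
          show "vec n f = vec n 0" using imageI[OF that, of "vec n"] 1 by (simp only: singleton_iff v_0)
          show "f \<in> fspace n" using U(2) that by blast
          show "0 \<in> fspace n" by (simp add: fspace_def)
        qed
        then have "U \<subseteq> {0}" by blast
        then show ?thesis using U(1) fv.subspace_0 by blast
      next
        case 2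
        have "f \<in> U" if f: "f \<in> fspace n" for f
        proof -
          have "vec n f \<in> vec n ` U" unfolding 2 by simp
          then obtain g where "g \<in> U" "vec n f = vec n g" by auto
          then show ?thesis using vec_inject_fspace[of f n g] f U(2) by auto
        qed
        then show ?thesis using U(2) by blast
      qed
    qed
  next
    assume irr: irreducible
    show "\<forall>W. invariant_subspace G n \<rho> W \<longrightarrow> W = {0\<^sub>v n} \<or> W = carrier_vec n"
    proof (intro allI impI)
      fix W assume W: "invariant_subspace G n \<rho> W"
      note W = W[unfolded invariant_subspace_def]
      define U where "U = {f \<in> fspace n. vec n f \<in> W}"
      have WU: "W = vec n ` U"
      proof (intro equalityI subsetI)
        fix v assume "v \<in> W"
        moreover then obtain f where "f \<in> fspace n" "v = vec n f" using W surj by blast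
        ultimately show "v \<in> vec n ` U" by (auto simp: U_def)
      qed (auto simp: U_def)
      have "fv.subspace U"
        using W subspace_fspace
        by (auto simp: fv.subspace_def U_def v_0 v_add v_scale)
      moreover have "mat_fun (\<rho> g) f \<in> U" if "g \<in> carrier G" "f \<in> U" for g f
        using that W M by (auto simp: U_def vec_mat_fun mat_fun_in_fspace)
      moreover have "U \<subseteq> fspace n" by (auto simp: U_def)
      ultimately have "U = {0} \<or> U = fspace n"
        using irr unfolding irreducible_def by blast
      then show "W = {0\<^sub>v n} \<or> W = carrier_vec n"
      proof
        assume "U = {0}"
        then show ?thesis unfolding WU by (simp only: image_insert image_empty v_0 simp_thms)
      next
        assume "U = fspace n"
        then show ?thesis unfolding WU using surj by auto
      qed
    qed
  qed
  then show ?thesis using assms(3) by (auto simp: irreducible_rep_def)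
qed

lemma irreducible_rep_is_rep: "irreducible_rep G n \<rho> \<Longrightarrow> is_rep G n \<rho>"
  by (simp add: irreducible_rep_def)

text \<open>The monomial representation induced from the linear character \<open>\<chi>\<close> of \<open>T\<close>.\<close>
lemma (in group) induced_char_degree:
  assumes fin: "finite (carrier G)" and T: "subgroup T G"
    and \<chi>: "\<And>s t. s \<in> T \<Longrightarrow> t \<in> T \<Longrightarrow> \<chi> (s \<otimes> t) = \<chi> s * \<chi> t" "\<chi> \<one> = (1::complex)"
    and N: "N \<subseteq> T" "\<And>g x. g \<in> carrier G \<Longrightarrow> x \<in> N \<Longrightarrow> g \<otimes> x \<otimes> inv g \<in> N"
    and stab: "\<And>g. g \<in> carrier G \<Longrightarrow> (\<And>x. x \<in> N \<Longrightarrow> \<chi> (g \<otimes> x \<otimes> inv g) = \<chi> x) \<Longrightarrow> g \<in> T"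
    and n: "n * card T = order G"
  shows "n \<in> char_degrees G"
proof -
  obtain x k where k: "k * card T = order G" and x: "\<And>i. i < k \<Longrightarrow> x i \<in> carrier G"
    and ex: "\<And>g. g \<in> carrier G \<Longrightarrow> \<exists>i<k. g \<otimes> inv (x i) \<in> T"
    and un: "\<And>i j. i < k \<Longrightarrow> j < k \<Longrightarrow> x i \<otimes> inv (x j) \<in> T \<Longrightarrow> i = (j::nat)"
    using transversal[OF fin T] by metis
  have TG: "T \<subseteq> carrier G" using T by (rule subgroup.subset)
  have card: "order G > 0" using fin by (simp add: order_gt_0_iff_finite)
  then have nk: "n = k" "k > 0" using k n by (metis mult_cancel2 mult_0_right less_not_refl, metis k card gr0I mult_0 less_not_refl)
  \<comment> \<open>With \<chi> extended by zero, each row of the matrix \<open>\<rho> g\<close>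
    below has exactly one nonzero entry, in the column of the coset of
    \<open>x i \<otimes> g\<close>.\<close>
  define \<chi>' where "\<chi>' y = (if y \<in> T then \<chi> y else 0)" for y
  have \<chi>'_mult: "\<chi>' (s \<otimes> t) = \<chi> s * \<chi>' t" if "s \<in> T" "t \<in> carrier G" for s t
  proof (cases "t \<in> T")
    case True
    then show ?thesis using that T by (simp add: \<chi>'_def \<chi> subgroup.m_closed)
  next
    case False
    have "s \<otimes> t \<notin> T"
    proof
      assume "s \<otimes> t \<in> T"
      then have "inv s \<otimes> (s \<otimes> t) \<in> T"
        using that T by (simp add: subgroup.m_closed subgroup.m_inv_closed)
      then show False using False that TG by (simp add: m_assoc[symmetric] subset_iff)
    qed
    then show ?thesis using False by (simp add: \<chi>'_def)
  qed
  define \<rho> where "\<rho> g = mat k k (\<lambda>(i, j). \<chi>' (x i \<otimes> g \<otimes> inv (x j)))" for g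
  have dim: "\<rho> g \<in> carrier_mat k k" for g by (simp add: \<rho>_def)
  have rep: "is_rep G k \<rho>"
    unfolding is_rep_def
  proof (intro conjI ballI dim)
    fix g h assume g: "g \<in> carrier G" and h: "h \<in> carrier G"
    show "\<rho> (g \<otimes> h) = \<rho> g * \<rho> h"
    proof (rule eq_matI)
      fix i l assume "i < dim_row (\<rho> g * \<rho> h)" "l < dim_col (\<rho> g * \<rho> h)"
      then have il: "i < k" "l < k" by (auto simp: \<rho>_def)
      obtain j where j: "j < k" "(x i \<otimes> g) \<otimes> inv (x j) \<in> T" using ex[of "x i \<otimes> g"] il g x by auto
      have uniq: "j' = j" if "j' < k" "(x i \<otimes> g) \<otimes> inv (x j') \<in> T" for j'
      proof -
        have "inv ((x i \<otimes> g) \<otimes> inv (x j')) \<otimes> ((x i \<otimes> g) \<otimes> inv (x j)) \<in> T"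
          using that j T by (simp add: subgroup.m_closed subgroup.m_inv_closed)
        moreover have "inv ((x i \<otimes> g) \<otimes> inv (x j')) \<otimes> ((x i \<otimes> g) \<otimes> inv (x j)) = x j' \<otimes> inv (x j)"
          using x that il j g by (simp add: inv_mult_group m_assoc) (simp add: m_assoc[symmetric])
        ultimately have "x j' \<otimes> inv (x j) \<in> T" by (simp only:)
        then show ?thesis by (rule un[OF that(1) j(1)])
      qed
      have "(\<rho> g * \<rho> h) $$ (i, l) = (\<Sum>j'<k. \<chi>' (x i \<otimes> g \<otimes> inv (x j')) * \<chi>' (x j' \<otimes> h \<otimes> inv (x l)))"
        using il by (simp add: \<rho>_def scalar_prod_def atLeast0LessThan)
      also have "\<dots> = (\<Sum>j'\<in>{j}. \<chi>' (x i \<otimes> g \<otimes> inv (x j')) * \<chi>' (x j' \<otimes> h \<otimes> inv (x l)))"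
      proof (rule sum.mono_neutral_right)
        show "\<forall>j'\<in>{..<k} - {j}. \<chi>' (x i \<otimes> g \<otimes> inv (x j')) * \<chi>' (x j' \<otimes> h \<otimes> inv (x l)) = 0"
        proof
          fix j' assume "j' \<in> {..<k} - {j}"
          then have "x i \<otimes> g \<otimes> inv (x j') \<notin> T" using uniq[of j'] by blast
          then show "\<chi>' (x i \<otimes> g \<otimes> inv (x j')) * \<chi>' (x j' \<otimes> h \<otimes> inv (x l)) = 0"
            by (simp only: \<chi>'_def if_False mult_zero_left)
        qed
      qed (use j in simp_all)
      also have "\<dots> = \<chi>' ((x i \<otimes> g \<otimes> inv (x j)) \<otimes> (x j \<otimes> h \<otimes> inv (x l)))"
        using j il x h by (subst \<chi>'_mult) (auto simp: \<chi>'_def)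
      also have "(x i \<otimes> g \<otimes> inv (x j)) \<otimes> (x j \<otimes> h \<otimes> inv (x l)) = x i \<otimes> (g \<otimes> h) \<otimes> inv (x l)"
        using j il x g h by (simp add: m_assoc) (simp add: m_assoc[symmetric])
      finally show "\<rho> (g \<otimes> h) $$ (i, l) = (\<rho> g * \<rho> h) $$ (i, l)"
        using il by (simp add: \<rho>_def)
    qed (auto simp: \<rho>_def)
  next
    show "\<rho> \<one> = 1\<^sub>m k"
      using un x T \<chi> by (intro eq_matI) (auto simp: \<rho>_def \<chi>'_def subgroup.one_closed)
  qed
  interpret fun_rep G k "\<lambda>g. mat_fun (\<rho> g)"
    by (rule fun_rep_of_is_rep[OF is_group fin rep])
  \<comment> \<open>On \<open>N\<close> the matrices are diagonal with the conjugates of \<chi> as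
    entries, so that \<open>eigen_components\<close> splits an invariant subspace along the
    basis.\<close>
  have eig: "mat_fun (\<rho> y) (fbasis j) = fscale (\<chi> (x j \<otimes> y \<otimes> inv (x j))) (fbasis j)"
    if y: "y \<in> N" and j: "j < k" for y j
  proof -
    have yG: "y \<in> carrier G" using y N TG by auto
    have c: "x j \<otimes> y \<otimes> inv (x j) \<in> T" using N y x j by blast
    have "\<rho> y $$ (i, j) = 0" if "i < k" "i \<noteq> j" for i
    proof -
      have "x i \<otimes> y \<otimes> inv (x j) \<notin> T"
      proof
        assume "x i \<otimes> y \<otimes> inv (x j) \<in> T"
        then have "(x i \<otimes> y \<otimes> inv (x j)) \<otimes> inv (x j \<otimes> y \<otimes> inv (x j)) \<in> T"
          using c T by (simp add: subgroup.m_closed subgroup.m_inv_closed)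
        moreover have "(x i \<otimes> y \<otimes> inv (x j)) \<otimes> inv (x j \<otimes> y \<otimes> inv (x j)) = x i \<otimes> inv (x j)"
          using x that j yG by (simp add: inv_mult_group m_assoc) (simp add: m_assoc[symmetric])
        ultimately have "x i \<otimes> inv (x j) \<in> T" by (simp only:)
        then have "i = j" by (rule un[OF that(1) j])
        then show False using that by simp
      qed
      then show ?thesis using that j by (simp add: \<rho>_def \<chi>'_def)
    qed
    then show ?thesis
      using mat_fun_fbasis[OF dim j j, of y] c j by (simp add: \<rho>_def \<chi>'_def)
  qed
  have irreducible
    unfolding irreducible_def
  proof (intro allI impI, elim conjE)
    fix U assume U: "fv.subspace U" "U \<subseteq> fspace k" and inv: "\<forall>g\<in>carrier G. \<forall>f\<in>U. mat_fun (\<rho> g) f \<in> U"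
    show "U = {0} \<or> U = fspace k"
    proof (cases "U \<subseteq> {0}")
      case True
      then show ?thesis using U(1) fv.subspace_0 by blast
    next
      case False
      then obtain u where u: "u \<in> U" "u \<noteq> 0" by auto
      then have exp: "u = (\<Sum>j<k. fscale (u j) (fbasis j))" using U fspace_expansion by blast
      have comp: "\<forall>j\<in>{..<k}. fscale (u j) (fbasis j) \<in> U"
      proof (rule eigen_components[where X = N and \<psi> = "\<lambda>g. mat_fun (\<rho> g)" and l = "\<lambda>j y. \<chi> (x j \<otimes> y \<otimes> inv (x j))"])
        fix y j assume "j \<in> {..<k}" "y \<in> N"
        then show "mat_fun (\<rho> y) (fscale (u j) (fbasis j)) =
            fscale (\<chi> (x j \<otimes> y \<otimes> inv (x j))) (fscale (u j) (fbasis j))"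
          using N TG by (auto simp: scale eig mult.commute)
      next
        fix i j assume ij: "i \<in> {..<k}" "j \<in> {..<k}" "i \<noteq> j"
        then have G: "x i \<in> carrier G" "x j \<in> carrier G" using x by auto
        show "\<exists>y\<in>N. \<chi> (x i \<otimes> y \<otimes> inv (x i)) \<noteq> \<chi> (x j \<otimes> y \<otimes> inv (x j))"
        proof (rule ccontr)
          assume "\<not> ?thesis"
          then have eq: "\<chi> (x i \<otimes> y \<otimes> inv (x i)) = \<chi> (x j \<otimes> y \<otimes> inv (x j))" if "y \<in> N" for y
            using that by blast
          have "x i \<otimes> inv (x j) \<in> T"
          proof (rule stab)
            show "x i \<otimes> inv (x j) \<in> carrier G" using G by simp
            show "\<chi> (x i \<otimes> inv (x j) \<otimes> y \<otimes> inv (x i \<otimes> inv (x j))) = \<chi> y" if "y \<in> N" for y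
              by (rule conj_ratio[OF G _ N(2) eq that]) (use N TG in auto)
          qed
          then show False using un ij by auto
        qed
      qed (use U inv u exp N TG in \<open>auto simp: add scale\<close>)
      obtain j where j: "j < k" "u j \<noteq> 0"
        using u exp by (metis (no_types, lifting) fv.scale_zero_left lessThan_iff sum.neutral)
      have "fscale (u j) (fbasis j) \<in> U" by (rule bspec[OF comp]) (use j in simp)
      then have "fscale (inverse (u j)) (fscale (u j) (fbasis j)) \<in> U"
        by (rule fv.subspace_scale[OF U(1)])
      then have bj: "fbasis j \<in> U" using j by simp
      have "fbasis i \<in> U" if i: "i < k" for i
      proof -
        \<comment> \<open>This element carries the basis vector \<open>j\<close> to the basis vector
          \<open>i\<close>, with coefficient \<open>\<chi> \<one>\<close>.\<close>
        let ?g = "inv (x i) \<otimes> x j"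
        have e: "x l \<otimes> ?g \<otimes> inv (x j) = x l \<otimes> inv (x i)" if "l < k" for l
          using x i j that by (simp add: m_assoc)
        have "mat_fun (\<rho> ?g) (fbasis j) = fscale (\<rho> ?g $$ (i, j)) (fbasis i)"
          by (rule mat_fun_fbasis[OF dim j(1) i]) (use i j un in \<open>auto simp: \<rho>_def \<chi>'_def e\<close>)
        also have "\<dots> = fbasis i" using i j x T \<chi> by (simp add: \<rho>_def \<chi>'_def e subgroup.one_closed)
        finally show ?thesis using inv bj x i j by (metis m_closed inv_closed)
      qed
      then show ?thesis using subspace_eq_fspace[OF U] by blast
    qed
  qed
  then have "irreducible_rep G k \<rho>"
    using irreducible_rep_iff[OF is_group fin rep] nk by blast
  then show ?thesis using nk by (auto simp: char_degrees_def)
qed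

section \<open>The semidirect product of a Heisenberg group\<close>

locale lin_action = group H for H :: "'h monoid" (structure) +
  fixes F :: "'k::comm_ring_1 set" and act :: "'h \<Rightarrow> 'k \<Rightarrow> 'k"
  assumes closed [simp]: "h \<in> carrier H \<Longrightarrow> x \<in> F \<Longrightarrow> act h x \<in> F"
    and act_add: "h \<in> carrier H \<Longrightarrow> x \<in> F \<Longrightarrow> y \<in> F \<Longrightarrow> act h (x + y) = act h x + act h y"
    and act_mult: "h \<in> carrier H \<Longrightarrow> k \<in> carrier H \<Longrightarrow> x \<in> F \<Longrightarrow> act (h \<otimes> k) x = act h (act k x)"
    and act_one [simp]: "x \<in> F \<Longrightarrow> act \<one> x = x"
    and zero_F: "0 \<in> F" and minus_F: "x \<in> F \<Longrightarrow> - x \<in> F"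
begin

lemma act_0 [simp]: "h \<in> carrier H \<Longrightarrow> act h 0 = 0"
  using act_add[of h 0 0] zero_F by simp

lemma act_uminus: "h \<in> carrier H \<Longrightarrow> x \<in> F \<Longrightarrow> act h (- x) = - act h x"
  using act_add[of h x "- x"] by (simp add: minus_F add_eq_0_iff)

text \<open>The displacement map is additive with the fixed points as kernel, hence injective, hence
  surjective by finiteness. This turns freeness into its two uses: invariant additive characters are
  trivial, and commutators with \<open>h\<close> fill a coordinate.\<close>

lemma displacement_surj:
  assumes fin: "finite F" and add: "\<And>x y. x \<in> F \<Longrightarrow> y \<in> F \<Longrightarrow> x + y \<in> F"
    and h: "h \<in> carrier H" and free: "\<And>x. x \<in> F \<Longrightarrow> act h x = x \<Longrightarrow> x = 0" and y: "y \<in> F"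
  obtains x where "x \<in> F" "act h x - x = y"
proof -
  let ?f = "\<lambda>x. act h x - x"
  have "inj_on ?f F"
  proof (rule inj_onI)
    fix x y assume xy: "x \<in> F" "y \<in> F" "?f x = ?f y"
    have "act h (x + - y) = x + - y"
      unfolding act_add[OF h xy(1) minus_F[OF xy(2)]] act_uminus[OF h xy(2)]
      using xy(3) by (simp add: algebra_simps)
    then have "x + - y = 0" using xy add minus_F free by blast
    then show "x = y" by simp
  qed
  moreover have "?f ` F \<subseteq> F"
    using h add[OF closed minus_F] by auto
  ultimately have "?f ` F = F" using fin by (simp add: endo_inj_surj)
  then show ?thesis using y that by (metis (no_types, lifting) imageE)
qed

end

text \<open>\<open>e\<close> is the identity of the field \<open>F\<close>, which may differ from
  the unit of the ambient type. The actions \<alpha> and \<beta> belong to the two coordinates and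
  \<gamma> to the centre; \<open>\<alpha>_\<beta>\<close> is the compatibility with the product that
  defines the Heisenberg group.\<close>

locale heis_ext = H: group H
  for H :: "'h monoid" (structure) +
  fixes F :: "'k::comm_ring_1 set" and e :: 'k and \<alpha> \<beta> \<gamma> :: "'h \<Rightarrow> 'k \<Rightarrow> 'k"
    and \<nu> :: "'k \<times> 'k \<times> 'k \<times> 'h \<Rightarrow> nat"
  assumes finite_F: "finite F" and finite_H: "finite (carrier H)"
    and F_0 [simp]: "0 \<in> F" and F_minus [simp]: "x \<in> F \<Longrightarrow> - x \<in> F"
    and F_add [simp]: "x \<in> F \<Longrightarrow> y \<in> F \<Longrightarrow> x + y \<in> F"
    and F_mult [simp]: "x \<in> F \<Longrightarrow> y \<in> F \<Longrightarrow> x * y \<in> F"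
    and F_e [simp]: "e \<in> F" and e_mult [simp]: "x \<in> F \<Longrightarrow> e * x = x" and e_neq_0: "e \<noteq> 0"
    and F_inverse: "x \<in> F \<Longrightarrow> x \<noteq> 0 \<Longrightarrow> \<exists>y\<in>F. x * y = e"
    and lin_\<alpha>: "lin_action H F \<alpha>" and lin_\<beta>: "lin_action H F \<beta>" and lin_\<gamma>: "lin_action H F \<gamma>"
    and \<alpha>_\<beta>: "h \<in> carrier H \<Longrightarrow> x \<in> F \<Longrightarrow> y \<in> F \<Longrightarrow> \<alpha> h x * \<beta> h y = \<gamma> h (x * y)"
    and \<alpha>_free: "h \<in> carrier H \<Longrightarrow> x \<in> F \<Longrightarrow> \<alpha> h x = x \<Longrightarrow> x \<noteq> 0 \<Longrightarrow> h = \<one>"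
    and \<beta>_free: "h \<in> carrier H \<Longrightarrow> x \<in> F \<Longrightarrow> \<beta> h x = x \<Longrightarrow> x \<noteq> 0 \<Longrightarrow> h = \<one>"
    and inj_\<nu>: "inj_on \<nu> (F \<times> F \<times> F \<times> carrier H)"
begin

sublocale \<alpha>: lin_action H F \<alpha> by (rule lin_\<alpha>)
sublocale \<beta>: lin_action H F \<beta> by (rule lin_\<beta>)
sublocale \<gamma>: lin_action H F \<gamma> by (rule lin_\<gamma>)

lemma F_diff [simp]: "x \<in> F \<Longrightarrow> y \<in> F \<Longrightarrow> x - y \<in> F"
  using F_add[OF _ F_minus, of x y] by simp

text \<open>\<open>mk a b z h\<close> stands for the product of the Heisenberg element with coordinates \<open>(a, b, z)\<close>,
  \<open>z\<close> central, and of \<open>h\<close>; the injection \<open>\<nu>\<close> makes the elements of \<open>G\<close> natural numbers.\<close>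
definition mk :: "'k \<Rightarrow> 'k \<Rightarrow> 'k \<Rightarrow> 'h \<Rightarrow> nat" where
  "mk a b z h = \<nu> (a, b, z, h)"

abbreviation "D \<equiv> F \<times> F \<times> F \<times> carrier H"

text \<open>For \<open>h = \<one>\<close> this is multiplication of upper unitriangular 3 by 3
  matrices with \<open>a\<close> and \<open>b\<close> next to the diagonal and \<open>z\<close> in
  the corner.\<close>

definition G :: "nat monoid" where
  "G = \<lparr>carrier = \<nu> ` D,
    monoid.mult = (\<lambda>x y. case inv_into D \<nu> x of (a, b, z, h) \<Rightarrow> case inv_into D \<nu> y of (a', b', z', h') \<Rightarrow>
      mk (a + \<alpha> h a') (b + \<beta> h b') (z + \<gamma> h z' + a * \<beta> h b') (h \<otimes> h')),
    one = mk 0 0 0 \<one>\<rparr>"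

abbreviation G_mult (infixl "\<cdot>" 70) where "x \<cdot> y \<equiv> x \<otimes>\<^bsub>G\<^esub> y"
abbreviation G_inv ("inv\<^sub>G _" [81] 80) where "inv\<^sub>G x \<equiv> inv\<^bsub>G\<^esub> x"

lemma mk_inject [simp]:
  "a \<in> F \<Longrightarrow> b \<in> F \<Longrightarrow> z \<in> F \<Longrightarrow> h \<in> carrier H \<Longrightarrow> a' \<in> F \<Longrightarrow> b' \<in> F \<Longrightarrow> z' \<in> F \<Longrightarrow> h' \<in> carrier H \<Longrightarrow>
    mk a b z h = mk a' b' z' h' \<longleftrightarrow> a = a' \<and> b = b' \<and> z = z' \<and> h = h'"
  using inj_on_eq_iff[OF inj_\<nu>, of "(a,b,z,h)" "(a',b',z',h')"] by (simp add: mk_def)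

lemma mk_in_G [simp]:
  "a \<in> F \<Longrightarrow> b \<in> F \<Longrightarrow> z \<in> F \<Longrightarrow> h \<in> carrier H \<Longrightarrow> mk a b z h \<in> carrier G"
  by (auto simp: G_def mk_def)

lemma carrier_G_cases:
  assumes "x \<in> carrier G"
  obtains a b z h where "a \<in> F" "b \<in> F" "z \<in> F" "h \<in> carrier H" "x = mk a b z h"
  using assms by (auto simp: G_def mk_def)

lemma mk_mult [simp]:
  "a \<in> F \<Longrightarrow> b \<in> F \<Longrightarrow> z \<in> F \<Longrightarrow> h \<in> carrier H \<Longrightarrow> a' \<in> F \<Longrightarrow> b' \<in> F \<Longrightarrow> z' \<in> F \<Longrightarrow> h' \<in> carrier H \<Longrightarrow>
    mk a b z h \<cdot> mk a' b' z' h' =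
      mk (a + \<alpha> h a') (b + \<beta> h b') (z + \<gamma> h z' + a * \<beta> h b') (h \<otimes> h')"
  by (simp add: G_def) (simp add: mk_def inv_into_f_f[OF inj_\<nu>])

lemma one_G: "\<one>\<^bsub>G\<^esub> = mk 0 0 0 \<one>"
  by (simp add: G_def)

lemma finite_G: "finite (carrier G)"
  using finite_F finite_H by (simp add: G_def)

lemma group_G: "group G"
proof (rule groupI)
  fix x y assume "x \<in> carrier G" "y \<in> carrier G"
  then show "x \<cdot> y \<in> carrier G"
    by (elim carrier_G_cases) simp
next
  fix x y z assume "x \<in> carrier G" "y \<in> carrier G" "z \<in> carrier G"
  then show "x \<cdot> y \<cdot> z = x \<cdot> (y \<cdot> z)"
    by (elim carrier_G_cases)
      (simp add: H.m_assoc \<alpha>.act_add \<beta>.act_add \<gamma>.act_add \<alpha>.act_mult \<beta>.act_mult \<gamma>.act_mult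
        \<alpha>_\<beta>[symmetric] algebra_simps)
next
  fix x assume "x \<in> carrier G"
  then obtain a b z h where x: "a \<in> F" "b \<in> F" "z \<in> F" "h \<in> carrier H" "x = mk a b z h"
    by (rule carrier_G_cases)
  let ?h = "inv h"
  have "mk (\<alpha> ?h (- a)) (\<beta> ?h (- b)) (\<gamma> ?h (a * b - z)) ?h \<cdot> x = \<one>\<^bsub>G\<^esub>"
    using x \<gamma>.act_add[of ?h "a * b - z" "z - a * b"]
    by (simp add: one_G \<alpha>.act_add[symmetric] \<beta>.act_add[symmetric] \<gamma>.act_add[symmetric] \<alpha>_\<beta>)
  then show "\<exists>y\<in>carrier G. y \<cdot> x = \<one>\<^bsub>G\<^esub>"
    using x by (intro bexI[of _ "mk (\<alpha> ?h (- a)) (\<beta> ?h (- b)) (\<gamma> ?h (a * b - z)) ?h"]) auto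
next
  fix x assume "x \<in> carrier G"
  then show "\<one>\<^bsub>G\<^esub> \<cdot> x = x"
    by (elim carrier_G_cases) (simp add: one_G)
qed (simp add: one_G)

sublocale G: group G by (rule group_G)

lemma conj_eqI:
  assumes "g \<in> carrier G" "x \<in> carrier G" "y \<in> carrier G" "g \<cdot> x = y \<cdot> g"
  shows "g \<cdot> x \<cdot> inv\<^sub>G g = y"
  using assms by (simp add: G.m_assoc)

lemma conj_P:
  assumes "a \<in> F" "b \<in> F" "z \<in> F" "h \<in> carrier H" "a' \<in> F" "b' \<in> F" "z' \<in> F"
  shows "mk a b z h \<cdot> mk a' b' z' \<one> \<cdot> inv\<^sub>G (mk a b z h) =
    mk (\<alpha> h a') (\<beta> h b') (\<gamma> h z' + a * \<beta> h b' - \<alpha> h a' * b) \<one>"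
  by (rule conj_eqI) (use assms in \<open>simp_all add: algebra_simps\<close>)

definition over :: "'h set \<Rightarrow> nat set" where
  "over S = {mk a b z h | a b z h. a \<in> F \<and> b \<in> F \<and> z \<in> F \<and> h \<in> S}"

text \<open>\<open>above {\<one>}\<close> is an abelian subgroup of the Heisenberg group, normal in
  \<open>G\<close> because \<open>H\<close> preserves the two coordinates separately. Characters
  nontrivial on the centre are induced from \<open>above R\<close>.\<close>

definition above :: "'h set \<Rightarrow> nat set" where
  "above S = {mk 0 b z h | b z h. b \<in> F \<and> z \<in> F \<and> h \<in> S}"

lemma mk_in_over [simp]:
  "S \<subseteq> carrier H \<Longrightarrow> a \<in> F \<Longrightarrow> b \<in> F \<Longrightarrow> z \<in> F \<Longrightarrow> h \<in> carrier H \<Longrightarrow> mk a b z h \<in> over S \<longleftrightarrow> h \<in> S"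
  by (auto simp: over_def)

lemma mk_in_above [simp]:
  "S \<subseteq> carrier H \<Longrightarrow> a \<in> F \<Longrightarrow> b \<in> F \<Longrightarrow> z \<in> F \<Longrightarrow> h \<in> carrier H \<Longrightarrow> mk a b z h \<in> above S \<longleftrightarrow> a = 0 \<and> h \<in> S"
  by (auto simp: above_def)

lemma over_cases:
  assumes "x \<in> over S"
  obtains a b z h where "a \<in> F" "b \<in> F" "z \<in> F" "h \<in> S" "x = mk a b z h"
  using assms by (auto simp: over_def)

lemma above_cases:
  assumes "x \<in> above S"
  obtains b z h where "b \<in> F" "z \<in> F" "h \<in> S" "x = mk 0 b z h"
  using assms by (auto simp: above_def)

lemma inv_mk:
  assumes "a \<in> F" "b \<in> F" "z \<in> F" "h \<in> carrier H"
  shows "inv\<^sub>G (mk a b z h) =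
    mk (\<alpha> (inv h) (- a)) (\<beta> (inv h) (- b)) (\<gamma> (inv h) (a * b - z)) (inv h)"
proof (rule G.inv_equality)
  let ?h = "inv h"
  show "mk (\<alpha> ?h (- a)) (\<beta> ?h (- b)) (\<gamma> ?h (a * b - z)) ?h \<cdot> mk a b z h = \<one>\<^bsub>G\<^esub>"
    using assms \<gamma>.act_add[of ?h "a * b - z" "z - a * b"]
    by (simp add: one_G \<alpha>.act_add[symmetric] \<beta>.act_add[symmetric] \<gamma>.act_add[symmetric] \<alpha>_\<beta>)
qed (use assms in auto)

lemma over_carrier: "over (carrier H) = carrier G"
  by (auto simp: over_def elim!: carrier_G_cases)

lemma over_subgroup:
  assumes "subgroup S H"
  shows "subgroup (over S) G"
proof -
  have S: "S \<subseteq> carrier H" using assms by (rule subgroup.subset)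
  show ?thesis
  proof (rule G.subgroupI)
    show "over S \<subseteq> carrier G" using S by (auto elim!: over_cases)
    show "over S \<noteq> {}" using mk_in_over[OF S, of 0 0 0 "\<one>"] subgroup.one_closed[OF assms] by auto
    show "inv\<^sub>G x \<in> over S" if "x \<in> over S" for x
      using that by (rule over_cases) (use S assms in \<open>simp add: inv_mk subset_iff subgroup.m_inv_closed\<close>)
    show "x \<cdot> y \<in> over S" if "x \<in> over S" "y \<in> over S" for x y
      using that by (elim over_cases) (use S assms in \<open>simp add: subset_iff subgroup.m_closed\<close>)
  qed
qed

lemma above_subgroup:
  assumes "subgroup S H"
  shows "subgroup (above S) G"
proof -
  have S: "S \<subseteq> carrier H" using assms by (rule subgroup.subset)
  show ?thesis
  proof (rule G.subgroupI)
    show "above S \<subseteq> carrier G" using S by (auto elim!: above_cases)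
    show "above S \<noteq> {}" using mk_in_above[OF S, of 0 0 0 "\<one>"] subgroup.one_closed[OF assms] by auto
    show "inv\<^sub>G x \<in> above S" if "x \<in> above S" for x
      using that by (rule above_cases) (use S assms in \<open>simp add: inv_mk subset_iff subgroup.m_inv_closed\<close>)
    show "x \<cdot> y \<in> above S" if "x \<in> above S" "y \<in> above S" for x y
      using that by (elim above_cases) (use S assms in \<open>simp add: subset_iff subgroup.m_closed\<close>)
  qed
qed

lemma over_conj:
  assumes S: "S \<subseteq> carrier H" "\<And>g h. g \<in> carrier H \<Longrightarrow> h \<in> S \<Longrightarrow> g \<otimes> h \<otimes> inv g \<in> S"
    and "g \<in> carrier G" "x \<in> over S"
  shows "g \<cdot> x \<cdot> inv\<^sub>G g \<in> over S"
  using assms(3,4)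
  by (elim over_cases carrier_G_cases) (use S in \<open>simp add: inv_mk subset_iff\<close>)

lemma over_normal: "S \<lhd> H \<Longrightarrow> over S \<lhd> G"
  by (intro G.normal_invI over_subgroup over_conj)
    (auto simp: normal_imp_subgroup normal.inv_op_closed2 dest: normal_imp_subgroup subgroup.mem_carrier)

lemma card_over:
  assumes "S \<subseteq> carrier H" shows "card (over S) = card F ^ 3 * card S"
proof -
  have "over S = \<nu> ` (F \<times> F \<times> F \<times> S)" by (force simp: over_def mk_def)
  moreover have "inj_on \<nu> (F \<times> F \<times> F \<times> S)" using inj_\<nu> by (rule inj_on_subset) (use assms in auto)
  ultimately show ?thesis by (simp add: card_image card_cartesian_product power3_eq_cube)
qed

lemma card_above:
  assumes "S \<subseteq> carrier H" shows "card (above S) = card F ^ 2 * card S"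
proof -
  have "above S = \<nu> ` ({0} \<times> F \<times> F \<times> S)" by (force simp: above_def mk_def)
  moreover have "inj_on \<nu> ({0} \<times> F \<times> F \<times> S)" using inj_\<nu> by (rule inj_on_subset) (use assms in auto)
  ultimately show ?thesis by (simp add: card_image card_cartesian_product power2_eq_square)
qed

lemma order_G: "order G = card F ^ 3 * order H"
  using card_over[of "carrier H"] by (simp add: Coset.order_def over_carrier)

lemma \<alpha>_surj:
  assumes "h \<in> carrier H" "h \<noteq> \<one>" "y \<in> F"
  obtains x where "x \<in> F" "\<alpha> h x - x = y"
  using \<alpha>.displacement_surj[OF finite_F F_add assms(1) _ assms(3)] \<alpha>_free[OF assms(1)] assms(2) by metis

lemma \<beta>_surj:
  assumes "h \<in> carrier H" "h \<noteq> \<one>" "y \<in> F"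
  obtains x where "x \<in> F" "\<beta> h x - x = y"
  using \<beta>.displacement_surj[OF finite_F F_add assms(1) _ assms(3)] \<beta>_free[OF assms(1)] assms(2) by metis

abbreviation "P \<equiv> over {\<one>}"
abbreviation "A \<equiv> above {\<one>}"

lemma P_subgroup: "subgroup P G"
  by (intro over_subgroup H.triv_subgroup)

lemma A_conj: "g \<in> carrier G \<Longrightarrow> x \<in> A \<Longrightarrow> g \<cdot> x \<cdot> inv\<^sub>G g \<in> A"
  by (elim above_cases carrier_G_cases) (simp add: conj_P del: mk_mult)

lemma P_conj: "g \<in> carrier G \<Longrightarrow> x \<in> P \<Longrightarrow> g \<cdot> x \<cdot> inv\<^sub>G g \<in> P"
  by (rule over_conj) auto

end

section \<open>Irreducible representations of the semidirect product\<close>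

context fun_rep
begin

definition eigsp :: "'a set \<Rightarrow> ('a \<Rightarrow> complex) \<Rightarrow> (nat \<Rightarrow> complex) set" where
  "eigsp N \<chi> = {f \<in> fspace n. \<forall>x\<in>N. \<phi> x f = fscale (\<chi> x) f}"

lemma eigspD: "f \<in> eigsp N \<chi> \<Longrightarrow> f \<in> fspace n" "f \<in> eigsp N \<chi> \<Longrightarrow> x \<in> N \<Longrightarrow> \<phi> x f = fscale (\<chi> x) f"
  by (simp_all add: eigsp_def)

lemma eigsp_subset: "eigsp N \<chi> \<subseteq> fspace n"
  unfolding eigsp_def by (rule Collect_restrict)

lemma eigsp_subspace:
  assumes "N \<subseteq> carrier G"
  shows "fv.subspace (eigsp N \<chi>)"
  unfolding fv.subspace_def
proof (intro conjI ballI allI)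
  show "0 \<in> eigsp N \<chi>"
    using assms fv.subspace_0[OF subspace_fspace] by (simp add: eigsp_def zero subset_iff)
  show "f + g \<in> eigsp N \<chi>" if "f \<in> eigsp N \<chi>" "g \<in> eigsp N \<chi>" for f g
    using that assms fv.subspace_add[OF subspace_fspace]
    by (simp add: eigsp_def subset_iff add fv.scale_right_distrib)
  show "fscale c f \<in> eigsp N \<chi>" if "f \<in> eigsp N \<chi>" for f c
    using that assms fv.subspace_scale[OF subspace_fspace]
    by (simp add: eigsp_def subset_iff scale mult.commute)
qed

text \<open>A group element maps an eigenspace of \<open>N\<close> to that of a conjugate character,
  and so to itself if it fixes the character.\<close>

lemma eigsp_invariant:
  assumes N: "N \<subseteq> carrier G" and g: "g \<in> carrier G" and f: "f \<in> eigsp N \<chi>"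
    and conj: "\<And>x. x \<in> N \<Longrightarrow> inv g \<otimes> x \<otimes> inv (inv g) \<in> N"
    and \<chi>: "\<And>x. x \<in> N \<Longrightarrow> \<chi> (inv g \<otimes> x \<otimes> inv (inv g)) = \<chi> x"
  shows "\<phi> g f \<in> eigsp N \<chi>"
proof -
  have fn: "f \<in> fspace n" using f by (rule eigspD)
  have "\<phi> x (\<phi> g f) = fscale (\<chi> x) (\<phi> g f)" if x: "x \<in> N" for x
  proof -
    let ?y = "inv g \<otimes> x \<otimes> inv (inv g)"
    have xG: "x \<in> carrier G" using N x by blast
    have "x \<otimes> g = g \<otimes> ?y" using xG g by (simp add: m_assoc[symmetric])
    then have "\<phi> x (\<phi> g f) = \<phi> g (\<phi> ?y f)"
      using xG g fn by (simp add: mult[symmetric] del: inv_inv)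
    also have "\<phi> ?y f = fscale (\<chi> x) f"
      using eigspD(2)[OF f conj[OF x]] unfolding \<chi>[OF x] .
    also have "\<phi> g (fscale (\<chi> x) f) = fscale (\<chi> x) (\<phi> g f)" by (rule scale[OF g])
    finally show ?thesis .
  qed
  then show ?thesis using range[OF g fn] by (simp add: eigsp_def)
qed

text \<open>Applied to the trivial character, this gives an alternative for a normal subset: it acts
  trivially, or it fixes no nonzero vector.\<close>

lemma eigsp_full:
  assumes irreducible "N \<subseteq> carrier G" "f \<in> eigsp N \<chi>" "f \<noteq> 0"
    and "\<And>g x. g \<in> carrier G \<Longrightarrow> x \<in> N \<Longrightarrow> g \<otimes> x \<otimes> inv g \<in> N"
    and "\<And>g x. g \<in> carrier G \<Longrightarrow> x \<in> N \<Longrightarrow> \<chi> (g \<otimes> x \<otimes> inv g) = \<chi> x"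
  shows "eigsp N \<chi> = fspace n"
proof (rule irreducibleD[OF assms(1) eigsp_subspace[OF assms(2)] eigsp_subset _ assms(3,4)])
  fix g f assume g: "g \<in> carrier G" and f: "f \<in> eigsp N \<chi>"
  show "\<phi> g f \<in> eigsp N \<chi>"
    by (rule eigsp_invariant[OF assms(2) g f]) (rule assms(5,6)[OF inv_closed[OF g]], assumption)+
qed

lemma eigenvalue_mult:
  assumes "x \<in> carrier G" "y \<in> carrier G" "v \<in> fspace n" "v \<noteq> 0"
    "\<phi> x v = fscale a v" "\<phi> y v = fscale b v" "\<phi> (x \<otimes> y) v = fscale c v"
  shows "c = a * b"
proof -
  have "fscale c v = \<phi> x (\<phi> y v)" using assms(7) mult[OF assms(1-3)] by (simp only:)
  also have "\<dots> = fscale (a * b) v" using assms by (simp add: scale mult.commute)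
  finally show ?thesis using assms(4) by simp
qed

lemma eigenvalue_one:
  assumes "v \<in> fspace n" "v \<noteq> 0" "\<phi> \<one> v = fscale c v"
  shows "c = 1"
proof -
  have "fscale c v = fscale 1 v" using assms(3) one[OF assms(1)] by simp
  then show ?thesis using assms(2) by (simp only: fv.scale_cancel_right) simp
qed

end

text \<open>\<open>R\<close> is the kernel of the action on the centre. \<open>B\<close> is an
  abelian normal subgroup of index \<open>q\<close>, and \<open>B_cyclic\<close> says that every
  element outside generates the quotient. The character \<psi> of \<open>B\<close> has stabilizer
  \<open>B\<close>, and \<epsilon> is a nontrivial additive character of \<open>F\<close>.\<close>

locale heis_ext_chars = heis_ext H F e \<alpha> \<beta> \<gamma> \<nu>
  for H :: "'h monoid" (structure) and F :: "'k::comm_ring_1 set" and e \<alpha> \<beta> \<gamma> \<nu> +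
  fixes R B :: "'h set" and q :: nat and \<psi> :: "'h \<Rightarrow> complex" and \<epsilon> :: "'k \<Rightarrow> complex"
  assumes R_subgroup: "subgroup R H" and R_comm: "h \<in> R \<Longrightarrow> k \<in> R \<Longrightarrow> h \<otimes> k = k \<otimes> h"
    and \<gamma>_R: "h \<in> R \<Longrightarrow> x \<in> F \<Longrightarrow> \<gamma> h x = x"
    and \<gamma>_free: "h \<in> carrier H \<Longrightarrow> x \<in> F \<Longrightarrow> \<gamma> h x = x \<Longrightarrow> x \<noteq> 0 \<Longrightarrow> h \<in> R"
    and B_normal: "B \<lhd> H" and B_comm: "h \<in> B \<Longrightarrow> k \<in> B \<Longrightarrow> h \<otimes> k = k \<otimes> h"
    and card_B: "q * card B = order H"
    and B_cyclic: "h \<in> carrier H \<Longrightarrow> h \<notin> B \<Longrightarrow> g \<in> carrier H \<Longrightarrow>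
      \<exists>k::nat. g \<otimes> inv (h [^] k) \<in> B"
    and \<psi>_mult: "h \<in> B \<Longrightarrow> k \<in> B \<Longrightarrow> \<psi> (h \<otimes> k) = \<psi> h * \<psi> k" and \<psi>_one: "\<psi> \<one> = 1"
    and \<psi>_moved: "h \<in> carrier H \<Longrightarrow> h \<notin> B \<Longrightarrow> \<exists>b\<in>B. \<psi> (h \<otimes> b \<otimes> inv h) \<noteq> \<psi> b"
    and \<epsilon>_add: "x \<in> F \<Longrightarrow> y \<in> F \<Longrightarrow> \<epsilon> (x + y) = \<epsilon> x * \<epsilon> y" and \<epsilon>_0: "\<epsilon> 0 = 1"
    and \<epsilon>_nontrivial: "\<exists>x\<in>F. \<epsilon> x \<noteq> 1"
begin

definition ap where "ap x = fst (inv_into D \<nu> x)"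
definition zp where "zp x = fst (snd (snd (inv_into D \<nu> x)))"
definition hp where "hp x = snd (snd (snd (inv_into D \<nu> x)))"

lemma ap_mk [simp]: "a \<in> F \<Longrightarrow> b \<in> F \<Longrightarrow> z \<in> F \<Longrightarrow> h \<in> carrier H \<Longrightarrow> ap (mk a b z h) = a"
  and zp_mk [simp]: "a \<in> F \<Longrightarrow> b \<in> F \<Longrightarrow> z \<in> F \<Longrightarrow> h \<in> carrier H \<Longrightarrow> zp (mk a b z h) = z"
  and hp_mk [simp]: "a \<in> F \<Longrightarrow> b \<in> F \<Longrightarrow> z \<in> F \<Longrightarrow> h \<in> carrier H \<Longrightarrow> hp (mk a b z h) = h"
  by (simp_all add: ap_def zp_def hp_def mk_def inv_into_f_f[OF inj_\<nu>])

lemma R_subset: "R \<subseteq> carrier H" using R_subgroup by (rule subgroup.subset)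
lemma B_subgroup: "subgroup B H" using B_normal by (rule normal_imp_subgroup)
lemma B_subset: "B \<subseteq> carrier H" using B_subgroup by (rule subgroup.subset)

definition addchar :: "('k \<Rightarrow> complex) \<Rightarrow> bool" where
  "addchar \<mu> \<longleftrightarrow> (\<forall>x\<in>F. \<forall>y\<in>F. \<mu> (x + y) = \<mu> x * \<mu> y) \<and> \<mu> 0 = 1"

lemma addchar_add: "addchar \<mu> \<Longrightarrow> x \<in> F \<Longrightarrow> y \<in> F \<Longrightarrow> \<mu> (x + y) = \<mu> x * \<mu> y"
  by (simp add: addchar_def)

lemma addchar_0: "addchar \<mu> \<Longrightarrow> \<mu> 0 = 1"
  by (simp add: addchar_def)

lemma addchar_neq_0: "addchar \<mu> \<Longrightarrow> x \<in> F \<Longrightarrow> \<mu> x \<noteq> 0"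
  using addchar_add[of \<mu> x "- x"] addchar_0[of \<mu>] by auto

lemma addchar_trivial:
  assumes \<mu>: "addchar \<mu>" and "x \<in> F" "y \<in> F" "\<mu> y = \<mu> x"
  shows "\<mu> (y - x) = 1"
  using addchar_add[OF \<mu>, of "y - x" x] addchar_neq_0[OF \<mu>, of x] assms by simp

lemma sum_addchar:
  assumes \<mu>: "addchar \<mu>" and x: "x \<in> F" "\<mu> x \<noteq> 1"
  shows "(\<Sum>y\<in>F. \<mu> y) = 0"
proof -
  have "(\<Sum>y\<in>F. \<mu> y) = (\<Sum>y\<in>F. \<mu> (x + y))"
    by (rule sum.reindex_bij_witness[of _ "\<lambda>y. x + y" "\<lambda>y. y - x"]) (use x in auto)
  also have "\<dots> = \<mu> x * (\<Sum>y\<in>F. \<mu> y)"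
    by (simp add: addchar_add[OF \<mu> x(1)] sum_distrib_left)
  finally show ?thesis using x(2) by simp
qed

text \<open>Every element of \<open>F\<close> is a displacement of \<open>h\<close>, and an
  invariant character is 1 on displacements. The two lemmas after this one argue in the same
  way.\<close>

lemma addchar_\<alpha>_fixed:
  assumes \<mu>: "addchar \<mu>" and h: "h \<in> carrier H" "h \<noteq> \<one>"
    and inv: "\<And>x. x \<in> F \<Longrightarrow> \<mu> (\<alpha> h x) = \<mu> x" and y: "y \<in> F"
  shows "\<mu> y = 1"
proof -
  obtain x where "x \<in> F" "\<alpha> h x - x = y" by (rule \<alpha>_surj[OF h y])
  then show ?thesis using addchar_trivial[OF \<mu>, of x "\<alpha> h x"] inv h by simp
qed

lemma addchar_\<beta>_fixed:
  assumes \<mu>: "addchar \<mu>" and h: "h \<in> carrier H" "h \<noteq> \<one>"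
    and inv: "\<And>x. x \<in> F \<Longrightarrow> \<mu> (\<beta> h x) = \<mu> x" and y: "y \<in> F"
  shows "\<mu> y = 1"
proof -
  obtain x where "x \<in> F" "\<beta> h x - x = y" by (rule \<beta>_surj[OF h y])
  then show ?thesis using addchar_trivial[OF \<mu>, of x "\<beta> h x"] inv h by simp
qed

lemma addchar_\<gamma>_fixed:
  assumes \<mu>: "addchar \<mu>" and h: "h \<in> carrier H" "h \<notin> R"
    and inv: "\<And>x. x \<in> F \<Longrightarrow> \<mu> (\<gamma> h x) = \<mu> x" and y: "y \<in> F"
  shows "\<mu> y = 1"
proof -
  obtain x where "x \<in> F" "\<gamma> h x - x = y"
    by (rule \<gamma>.displacement_surj[OF finite_F F_add h(1) _ y]) (use \<gamma>_free[OF h(1)] h(2) in blast)+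
  then show ?thesis using addchar_trivial[OF \<mu>, of x "\<gamma> h x"] inv h by simp
qed

text \<open>Conjugation by \<open>mk a b z h\<close> turns the character into
  \<open>\<mu> (\<gamma> h z' + a * \<beta> h b')\<close>. Central elements force \<open>h\<close>
  into \<open>R\<close>, and then nonzero \<open>a\<close> is impossible because
  \<open>a * \<beta> h b'\<close> would run through all of \<open>F\<close>.\<close>

lemma stabilizer_above_R:
  assumes \<mu>: "addchar \<mu>" and nt: "\<exists>x\<in>F. \<mu> x \<noteq> 1" and g: "g \<in> carrier G"
    and inv: "\<And>x. x \<in> A \<Longrightarrow> \<mu> (zp (g \<cdot> x \<cdot> inv\<^sub>G g)) = \<mu> (zp x)"
  shows "g \<in> above R"
proof -
  obtain a b z h where gx: "a \<in> F" "b \<in> F" "z \<in> F" "h \<in> carrier H" "g = mk a b z h"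
    using g by (rule carrier_G_cases)
  have inv': "\<mu> (\<gamma> h z' + a * \<beta> h b') = \<mu> z'" if "b' \<in> F" "z' \<in> F" for b' z'
    using inv[of "mk 0 b' z' \<one>"] that gx by (simp add: conj_P del: mk_mult)
  have h: "h \<in> R"
  proof (rule ccontr)
    assume "h \<notin> R"
    then have "\<mu> y = 1" if "y \<in> F" for y
      using addchar_\<gamma>_fixed[OF \<mu> gx(4) _ _ that] inv'[of 0] gx by simp
    then show False using nt by blast
  qed
  have "a = 0"
  proof (rule ccontr)
    assume "a \<noteq> 0"
    then obtain c where c: "c \<in> F" "a * c = e" using F_inverse gx by blast
    have "\<mu> y = 1" if y: "y \<in> F" for y
    proof -
      \<comment> \<open>Chosen so that \<open>a * \<beta> h ?b\<close> is the given
        \<open>y\<close>.\<close>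
      let ?b = "\<beta> (inv h) (c * y)"
      have "\<beta> h ?b = c * y" using gx c y by (simp add: \<beta>.act_mult[symmetric])
      moreover have "a * (c * y) = y" using c y by (simp add: mult.assoc[symmetric])
      ultimately show ?thesis using inv'[of ?b 0] gx c y addchar_0[OF \<mu>] by simp
    qed
    then show False using nt by blast
  qed
  then show ?thesis using gx h R_subset by simp
qed

lemma addchar_\<epsilon>: "addchar \<epsilon>"
  using \<epsilon>_add \<epsilon>_0 by (simp add: addchar_def)

lemma degree_1: "1 \<in> char_degrees G"
  by (rule G.induced_char_degree[where T = "carrier G" and N = "{\<one>\<^bsub>G\<^esub>}" and \<chi> = "\<lambda>_. 1"])
    (simp_all add: finite_G G.subgroup_self Coset.order_def)

text \<open>Inflate \<psi> along the projection of \<open>G\<close> onto \<open>H\<close>; no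
  element outside the preimage of \<open>B\<close> fixes it.\<close>

lemma degree_q: "q \<in> char_degrees G"
proof (rule G.induced_char_degree[where T = "over B" and N = "over B" and \<chi> = "\<lambda>x. \<psi> (hp x)"])
  show "subgroup (over B) G" by (rule over_subgroup[OF B_subgroup])
  show "\<psi> (hp (s \<cdot> t)) = \<psi> (hp s) * \<psi> (hp t)" if "s \<in> over B" "t \<in> over B" for s t
    using that by (elim over_cases) (use B_subset in \<open>simp add: subset_iff \<psi>_mult\<close>)
  show "\<psi> (hp \<one>\<^bsub>G\<^esub>) = 1" by (simp add: one_G \<psi>_one)
  show "g \<cdot> x \<cdot> inv\<^sub>G g \<in> over B" if "g \<in> carrier G" "x \<in> over B" for g x
    by (rule over_conj[OF B_subset normal.inv_op_closed2[OF B_normal] that])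
  show "q * card (over B) = order G"
    using card_B by (simp add: card_over[OF B_subset] order_G mult.left_commute)
  fix g assume g: "g \<in> carrier G"
    and inv: "\<And>x. x \<in> over B \<Longrightarrow> \<psi> (hp (g \<cdot> x \<cdot> inv\<^sub>G g)) = \<psi> (hp x)"
  obtain a b z h where gx: "a \<in> F" "b \<in> F" "z \<in> F" "h \<in> carrier H" "g = mk a b z h"
    using g by (rule carrier_G_cases)
  show "g \<in> over B"
  proof (rule ccontr)
    assume "g \<notin> over B"
    then have "h \<notin> B" using gx B_subset by simp
    then obtain k where k: "k \<in> B" "\<psi> (h \<otimes> k \<otimes> inv h) \<noteq> \<psi> k"
      using \<psi>_moved gx by blast
    then show False
      using inv[of "mk 0 0 0 k"] gx B_subset by (simp add: inv_mk subset_iff)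
  qed
qed (simp_all add: finite_G)

text \<open>The character of \<open>P\<close> is nontrivial on the first coordinate only, and since
  \<alpha> is free, its stabilizer is \<open>P\<close>.\<close>

lemma degree_order_H: "order H \<in> char_degrees G"
proof (rule G.induced_char_degree[where T = P and N = P and \<chi> = "\<lambda>x. \<epsilon> (ap x)"])
  show "subgroup P G" by (rule P_subgroup)
  show "\<epsilon> (ap (s \<cdot> t)) = \<epsilon> (ap s) * \<epsilon> (ap t)" if "s \<in> P" "t \<in> P" for s t
    using that by (elim over_cases) (simp add: \<epsilon>_add)
  show "\<epsilon> (ap \<one>\<^bsub>G\<^esub>) = 1" by (simp add: one_G \<epsilon>_0)
  show "order H * card P = order G"
    by (simp add: card_over order_G mult.commute)
  fix g assume g: "g \<in> carrier G"
    and inv: "\<And>x. x \<in> P \<Longrightarrow> \<epsilon> (ap (g \<cdot> x \<cdot> inv\<^sub>G g)) = \<epsilon> (ap x)"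
  obtain a b z h where gx: "a \<in> F" "b \<in> F" "z \<in> F" "h \<in> carrier H" "g = mk a b z h"
    using g by (rule carrier_G_cases)
  have "\<epsilon> (\<alpha> h x) = \<epsilon> x" if "x \<in> F" for x
    using inv[of "mk x 0 0 \<one>"] that gx by (simp add: conj_P del: mk_mult)
  then have "h = \<one>"
    using addchar_\<alpha>_fixed[OF addchar_\<epsilon> gx(4)] \<epsilon>_nontrivial by blast
  then show "g \<in> P" using gx by simp
qed (simp_all add: finite_G P_conj)

text \<open>The stabilizer is tested on \<open>A\<close> and not on the centre: elements with
  nonzero first coordinate may fix the central character, but they move its extension to
  \<open>A\<close>. The index of \<open>above R\<close> is \<open>card F * K\<close>.\<close>

lemma degree_above_R:
  assumes "K * card R = order H"
  shows "card F * K \<in> char_degrees G"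
proof (rule G.induced_char_degree[where T = "above R" and N = A and \<chi> = "\<lambda>x. \<epsilon> (zp x)"])
  show "subgroup (above R) G" by (rule above_subgroup[OF R_subgroup])
  show "\<epsilon> (zp (s \<cdot> t)) = \<epsilon> (zp s) * \<epsilon> (zp t)" if "s \<in> above R" "t \<in> above R" for s t
    using that by (elim above_cases) (use R_subset in \<open>simp add: subset_iff \<epsilon>_add \<gamma>_R\<close>)
  show "\<epsilon> (zp \<one>\<^bsub>G\<^esub>) = 1" by (simp add: one_G \<epsilon>_0)
  show "A \<subseteq> above R"
    using subgroup.one_closed[OF R_subgroup] by (auto simp: above_def)
  show "card F * K * card (above R) = order G"
    unfolding card_above[OF R_subset] order_G assms[symmetric]
    by (simp add: power2_eq_square power3_eq_cube)
  show "g \<in> above R" if "g \<in> carrier G"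
    "\<And>x. x \<in> A \<Longrightarrow> \<epsilon> (zp (g \<cdot> x \<cdot> inv\<^sub>G g)) = \<epsilon> (zp x)" for g
    by (rule stabilizer_above_R[OF addchar_\<epsilon> \<epsilon>_nontrivial that])
qed (simp_all add: finite_G A_conj)

end

section \<open>Degrees of arbitrary irreducible representations\<close>

context heis_ext_chars
begin

definition "Z = {mk 0 0 z \<one> | z. z \<in> F}"

lemma Z_conj:
  assumes "g \<in> carrier G" "x \<in> Z"
  shows "g \<cdot> x \<cdot> inv\<^sub>G g \<in> Z"
proof -
  obtain a b z h where gx: "a \<in> F" "b \<in> F" "z \<in> F" "h \<in> carrier H" "g = mk a b z h"
    using assms(1) by (rule carrier_G_cases)
  obtain z' where z': "z' \<in> F" "x = mk 0 0 z' \<one>" using assms(2) by (auto simp: Z_def)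
  have "g \<cdot> x \<cdot> inv\<^sub>G g = mk 0 0 (\<gamma> h z') \<one>"
    using gx z' by (simp add: conj_P del: mk_mult)
  moreover have "\<gamma> h z' \<in> F" using gx z' by simp
  ultimately show ?thesis unfolding Z_def by (intro CollectI exI conjI)
qed

lemma Z_subset: "Z \<subseteq> carrier G"
  by (auto simp: Z_def)

lemma over_subset: "S \<subseteq> carrier H \<Longrightarrow> over S \<subseteq> carrier G"
  by (auto elim!: over_cases)

context
  fixes n \<phi>
  assumes rep: "fun_rep G n \<phi>" and irr: "fun_rep.irreducible G n \<phi>" and n_pos: "n > 0"
begin

interpretation V: fun_rep G n \<phi> by (rule rep)

text \<open>It supplies the commutation needed in \<open>common_eigenvector\<close> from an abelian
  quotient by a set that acts trivially.\<close>

lemma commute_mod_trivial: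
  assumes triv: "\<And>x f. x \<in> N \<Longrightarrow> f \<in> fspace n \<Longrightarrow> \<phi> x f = f" and "N \<subseteq> carrier G"
    and st: "s \<in> carrier G" "t \<in> carrier G" and x: "x \<in> N" "s \<cdot> t = x \<cdot> (t \<cdot> s)"
    and f: "f \<in> fspace n"
  shows "\<phi> s (\<phi> t f) = \<phi> t (\<phi> s f)"
proof -
  have "\<phi> s (\<phi> t f) = \<phi> (x \<cdot> (t \<cdot> s)) f" using st f by (simp add: V.mult x(2)[symmetric])
  also have "\<dots> = \<phi> x (\<phi> (t \<cdot> s) f)" using st f x assms(2) by (intro V.mult) auto
  also have "\<dots> = \<phi> t (\<phi> s f)" using st f x by (simp add: triv V.range V.mult)
  finally show ?thesis .
qed

text \<open>With the centre acting trivially, the character of \<open>P\<close> is a product of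
  additive characters \<open>la\<close> and \<open>lb\<close> of the two coordinates. A nontrivial
  \<open>h\<close> in the stabilizer would fix both and so make both trivial.\<close>

lemma degree_Z_P_nontrivial:
  assumes triv: "\<And>x f. x \<in> Z \<Longrightarrow> f \<in> fspace n \<Longrightarrow> \<phi> x f = f"
    and v: "v \<in> fspace n" "v \<noteq> 0" "\<And>x. x \<in> P \<Longrightarrow> \<phi> x v = fscale (\<chi> x) v"
    and nt: "x0 \<in> P" "\<chi> x0 \<noteq> 1"
  shows "n = order H"
proof -
  have PG: "P \<subseteq> carrier G" by (rule over_subset) simp
  have mult: "\<chi> (x \<cdot> y) = \<chi> x * \<chi> y" if "x \<in> P" "y \<in> P" for x y
  proof (rule V.eigenvalue_mult[OF _ _ v(1,2) v(3)[OF that(1)] v(3)[OF that(2)]])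
    show "\<phi> (x \<cdot> y) v = fscale (\<chi> (x \<cdot> y)) v"
      by (rule v(3)[OF subgroup.m_closed[OF P_subgroup that]])
  qed (use that PG in auto)
  have zz: "\<chi> (mk 0 0 z \<one>) = 1" if "z \<in> F" for z
  proof -
    have "mk 0 0 z \<one> \<in> Z" using that by (auto simp: Z_def)
    then have "fscale (\<chi> (mk 0 0 z \<one>)) v = fscale 1 v"
      using v(3)[of "mk 0 0 z \<one>"] triv v(1) that by simp
    then show ?thesis using v(2) by (simp only: fv.scale_cancel_right) simp
  qed
  define la where "la x = \<chi> (mk x 0 0 \<one>)" for x
  define lb where "lb x = \<chi> (mk 0 x 0 \<one>)" for x
  have la: "addchar la" unfolding addchar_def la_def
  proof (intro conjI ballI)
    show "\<chi> (mk (x + y) 0 0 \<one>) = \<chi> (mk x 0 0 \<one>) * \<chi> (mk y 0 0 \<one>)" if "x \<in> F" "y \<in> F" for x y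
      using mult[of "mk x 0 0 \<one>" "mk y 0 0 \<one>"] that by simp
  qed (use zz[of 0] in simp)
  have lb: "addchar lb" unfolding addchar_def lb_def
  proof (intro conjI ballI)
    show "\<chi> (mk 0 (x + y) 0 \<one>) = \<chi> (mk 0 x 0 \<one>) * \<chi> (mk 0 y 0 \<one>)" if "x \<in> F" "y \<in> F" for x y
      using mult[of "mk 0 x 0 \<one>" "mk 0 y 0 \<one>"] that by simp
  qed (use zz[of 0] in simp)
  have decomp: "\<chi> (mk a b z \<one>) = lb b * la a" if "a \<in> F" "b \<in> F" "z \<in> F" for a b z
    using mult[of "mk 0 0 z \<one>" "mk a b 0 \<one>"] mult[of "mk 0 b 0 \<one>" "mk a 0 0 \<one>"] that zz[of z]
    by (simp add: la_def lb_def)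
  have "n * card P = order G"
  proof (rule V.irreducible_degree[OF irr P_subgroup v order_refl P_conj])
    fix g assume g: "g \<in> carrier G" and inv: "\<And>x. x \<in> P \<Longrightarrow> \<chi> (g \<cdot> x \<cdot> inv\<^sub>G g) = \<chi> x"
    obtain a b z h where gx: "a \<in> F" "b \<in> F" "z \<in> F" "h \<in> carrier H" "g = mk a b z h"
      using g by (rule carrier_G_cases)
    have inv': "lb (\<beta> h b') * la (\<alpha> h a') = lb b' * la a'" if "a' \<in> F" "b' \<in> F" for a' b'
      using inv[of "mk a' b' 0 \<one>"] that gx by (simp add: conj_P decomp del: mk_mult)
    have "h = \<one>"
    proof (rule ccontr)
      assume h: "h \<noteq> \<one>"
      have a1: "la y = 1" if "y \<in> F" for y
        by (rule addchar_\<alpha>_fixed[OF la gx(4) h _ that])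
          (use inv'[of _ 0] gx addchar_0[OF lb] in simp)
      have b1: "lb y = 1" if "y \<in> F" for y
        by (rule addchar_\<beta>_fixed[OF lb gx(4) h _ that])
          (use inv'[of 0] gx addchar_0[OF la] in simp)
      from nt(1) obtain a b z where "a \<in> F" "b \<in> F" "z \<in> F" "x0 = mk a b z \<one>"
        by (auto elim: over_cases)
      then show False using nt(2) decomp a1 b1 by simp
    qed
    then show "g \<in> P" using gx by simp
  qed
  then have "n * card F ^ 3 = order H * card F ^ 3"
    by (simp add: card_over order_G mult.commute)
  moreover have "card F > 0" using finite_F F_0 card_gt_0_iff by blast
  ultimately show ?thesis by simp
qed

text \<open>Take a character \<chi> of the preimage of \<open>B\<close> on a common eigenvector. If
  its stabilizer is no larger, the degree is the index \<open>q\<close>. Otherwise some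
  \<open>g\<close> outside fixes \<chi> and has an eigenvector in its eigenspace; as
  \<open>g\<close> generates the group modulo that preimage, this vector spans an invariant
  line.\<close>

lemma degree_P_trivial:
  assumes triv: "\<And>x f. x \<in> P \<Longrightarrow> f \<in> fspace n \<Longrightarrow> \<phi> x f = f"
  shows "n \<in> {1, q}"
proof -
  have PG: "P \<subseteq> carrier G" by (rule over_subset) simp
  have BG: "over B \<subseteq> carrier G" by (rule over_subset[OF B_subset])
  have pos: "order G > 0" using finite_G by (simp add: G.order_gt_0_iff_finite)
  have B_conj: "g \<cdot> x \<cdot> inv\<^sub>G g \<in> over B" if "g \<in> carrier G" "x \<in> over B" for g x
    by (rule over_conj[OF B_subset normal.inv_op_closed2[OF B_normal] that])
  have comm: "\<phi> s (\<phi> t f) = \<phi> t (\<phi> s f)" if st: "s \<in> over B" "t \<in> over B" and f: "f \<in> fspace n" for s t f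
  proof (rule commute_mod_trivial[OF triv PG _ _ _ _ f])
    let ?x = "(s \<cdot> t) \<cdot> inv\<^sub>G (t \<cdot> s)"
    show "?x \<in> P"
      using st
    proof (elim over_cases)
      fix a b z h a' b' z' h' assume s: "a \<in> F" "b \<in> F" "z \<in> F" "h \<in> B" "s = mk a b z h"
        "a' \<in> F" "b' \<in> F" "z' \<in> F" "h' \<in> B" "t = mk a' b' z' h'"
      then have "h \<otimes> h' \<otimes> inv (h' \<otimes> h) = \<one>"
        using B_subset B_comm[of h h'] by (simp add: subset_iff)
      then show ?thesis using s B_subset by (simp add: inv_mk subset_iff)
    qed
    show "s \<cdot> t = ?x \<cdot> (t \<cdot> s)" using st BG by (simp add: G.m_assoc subset_iff)
  qed (use st BG in auto)
  obtain v \<chi> where v: "v \<in> fspace n" "v \<noteq> 0" "\<And>x. x \<in> over B \<Longrightarrow> \<phi> x v = fscale (\<chi> x) v"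
    by (rule V.common_eigenvector[OF subspace_fspace order_refl fbasis_in_fspace[OF n_pos] fbasis_neq_0 BG _ comm])
      (use BG V.range in auto)
  show ?thesis
  proof (cases "\<exists>g\<in>carrier G. g \<notin> over B \<and> (\<forall>x\<in>over B. \<chi> (g \<cdot> x \<cdot> inv\<^sub>G g) = \<chi> x)")
    case True
    then obtain g where g: "g \<in> carrier G" "g \<notin> over B"
      and inv: "\<And>x. x \<in> over B \<Longrightarrow> \<chi> (g \<cdot> x \<cdot> inv\<^sub>G g) = \<chi> x" by blast
    let ?E = "V.eigsp (over B) \<chi>"
    have vE: "v \<in> ?E" using v by (simp add: V.eigsp_def)
    have gE: "\<phi> g f \<in> ?E" if "f \<in> ?E" for f
    proof (rule V.eigsp_invariant[OF BG g(1) that])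
      fix x assume x: "x \<in> over B"
      then have xG: "x \<in> carrier G" using BG by blast
      show c: "inv\<^sub>G g \<cdot> x \<cdot> inv\<^sub>G (inv\<^sub>G g) \<in> over B" using B_conj[of "inv\<^sub>G g" x] g x by simp
      have "g \<cdot> (inv\<^sub>G g \<cdot> x \<cdot> inv\<^sub>G (inv\<^sub>G g)) \<cdot> inv\<^sub>G g = x"
        using g xG by (simp add: G.m_assoc) (simp add: G.m_assoc[symmetric])
      then show "\<chi> (inv\<^sub>G g \<cdot> x \<cdot> inv\<^sub>G (inv\<^sub>G g)) = \<chi> x" using inv[OF c] by simp
    qed
    obtain w c where w: "w \<in> ?E" "w \<noteq> 0" "\<phi> g w = fscale c w"
      by (rule V.eigenvector[OF g(1) V.eigsp_subspace[OF BG] V.eigsp_subset gE vE v(2)])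
    have wn: "w \<in> fspace n" using w(1) by (rule V.eigspD)
    have pow: "\<phi> (g [^]\<^bsub>G\<^esub> k) w = fscale (c ^ k) w" for k :: nat
    proof (induction k)
      case 0
      then show ?case using V.one[OF wn] by simp
    next
      case (Suc k)
      have "\<phi> (g [^]\<^bsub>G\<^esub> Suc k) w = \<phi> (g [^]\<^bsub>G\<^esub> k) (\<phi> g w)"
        using V.mult[OF _ g(1) wn, of "g [^]\<^bsub>G\<^esub> k"] g(1) by simp
      also have "\<dots> = fscale (c ^ Suc k) w" using Suc w(3) V.scale[of "g [^]\<^bsub>G\<^esub> k"] g(1) by simp
      finally show ?case .
    qed
    have hp_pow: "x [^]\<^bsub>G\<^esub> k \<in> carrier G \<and> hp (x [^]\<^bsub>G\<^esub> k) = hp x [^] k" if "x \<in> carrier G" for x and k :: nat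
    proof (induction k)
      case 0
      then show ?case by (simp add: one_G)
    next
      case (Suc k)
      have "hp (x [^]\<^bsub>G\<^esub> k \<cdot> x) = hp (x [^]\<^bsub>G\<^esub> k) \<otimes> hp x"
        using conjunct1[OF Suc] that by (elim carrier_G_cases) simp
      then show ?case using Suc that by simp
    qed
    have ex: "\<exists>d. \<phi> y w = fscale d w" if y: "y \<in> carrier G" for y
    proof -
      obtain a b z h where gx: "a \<in> F" "b \<in> F" "z \<in> F" "h \<in> carrier H" "g = mk a b z h"
        using g(1) by (rule carrier_G_cases)
      obtain a' b' z' h' where yx: "a' \<in> F" "b' \<in> F" "z' \<in> F" "h' \<in> carrier H" "y = mk a' b' z' h'"
        using y by (rule carrier_G_cases)
      have "h \<notin> B" using g(2) gx B_subset by simp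
      then obtain k :: nat where k: "h' \<otimes> inv (h [^] k) \<in> B" using B_cyclic gx yx by blast
      obtain a2 b2 z2 h2 where gk: "a2 \<in> F" "b2 \<in> F" "z2 \<in> F" "h2 \<in> carrier H" "g [^]\<^bsub>G\<^esub> k = mk a2 b2 z2 h2"
        using hp_pow[OF g(1), of k] by (auto elim: carrier_G_cases)
      have "h2 = h [^] k" using hp_pow[OF g(1), of k] gk gx by simp
      then have x: "y \<cdot> inv\<^sub>G (g [^]\<^bsub>G\<^esub> k) \<in> over B" (is "?x \<in> _")
        using k gk yx B_subset by (simp add: inv_mk)
      have "y = ?x \<cdot> (g [^]\<^bsub>G\<^esub> k)" using y g(1) by (simp add: G.m_assoc)
      then have "\<phi> y w = \<phi> ?x (\<phi> (g [^]\<^bsub>G\<^esub> k) w)"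
        using V.mult[OF _ _ wn, of ?x "g [^]\<^bsub>G\<^esub> k"] y g(1) by simp
      also have "\<dots> = fscale (c ^ k) (\<phi> ?x w)" unfolding pow using y g(1) by (simp add: V.scale)
      also have "\<phi> ?x w = fscale (\<chi> ?x) w" using w(1) x by (rule V.eigspD)
      finally have "\<phi> y w = fscale (c ^ k * \<chi> ?x) w" by simp
      then show ?thesis by (rule exI)
    qed
    \<comment> \<open>Now \<open>w\<close> is an eigenvector of the whole group, so the degree
      formula applies with the whole group as \<open>T\<close> and gives degree 1.\<close>
    have "\<phi> y w = fscale (SOME d. \<phi> y w = fscale d w) w" if "y \<in> carrier G" for y
      by (rule someI_ex[OF ex[OF that]])
    then have "n * card (carrier G) = order G"
      by (rule V.irreducible_degree[OF irr G.subgroup_self wn w(2), where N = "{\<one>\<^bsub>G\<^esub>}"]) simp_all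
    then show ?thesis using pos by (simp add: Coset.order_def)
  next
    case False
    have "n * card (over B) = order G"
      by (rule V.irreducible_degree[OF irr over_subgroup[OF B_subgroup] v order_refl B_conj]) (use False in blast)+
    moreover have "q * card (over B) = order G"
      using card_B by (simp add: card_over[OF B_subset] order_G mult.left_commute)
    ultimately have "n * card (over B) = q * card (over B)" by simp
    moreover have "card (over B) > 0"
      using \<open>n * card (over B) = order G\<close> pos by (metis gr0I mult_0_right less_irrefl)
    ultimately show ?thesis by simp
  qed
qed


text \<open>A translate of an eigenvector of \<open>A\<close> has a character that depends on
  \<open>z\<close> alone. Its eigenspace is preserved by the abelian group \<open>R\<close>, so it
  contains an eigenvector of all of \<open>above R\<close>, and \<open>stabilizer_above_R\<close>
  shows that this group contains the stabilizer.\<close>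

lemma degree_Z_nontrivial:
  assumes nofix: "\<And>f. f \<in> fspace n \<Longrightarrow> (\<And>x. x \<in> Z \<Longrightarrow> \<phi> x f = f) \<Longrightarrow> f = 0"
    and K: "K * card R = order H"
  shows "n = card F * K"
proof -
  let ?A = "\<lambda>b z. mk 0 b z \<one>"
  have A: "A = {?A b z | b z. b \<in> F \<and> z \<in> F}" by (auto simp: above_def)
  have AG: "A \<subseteq> carrier G" by (auto elim!: above_cases)
  have comm: "\<phi> s (\<phi> t f) = \<phi> t (\<phi> s f)" if st: "s \<in> A" "t \<in> A" and f: "f \<in> fspace n" for s t f
  proof -
    have "s \<cdot> t = t \<cdot> s" using st by (elim above_cases) (simp add: add.commute)
    moreover have "\<phi> (s \<cdot> t) f = \<phi> s (\<phi> t f)" "\<phi> (t \<cdot> s) f = \<phi> t (\<phi> s f)"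
      using st AG f by (auto intro: V.mult)
    ultimately show ?thesis by simp
  qed
  obtain v \<chi> where v: "v \<in> fspace n" "v \<noteq> 0" "\<And>x. x \<in> A \<Longrightarrow> \<phi> x v = fscale (\<chi> x) v"
    by (rule V.common_eigenvector[OF subspace_fspace order_refl fbasis_in_fspace[OF n_pos] fbasis_neq_0 AG _ comm])
      (use AG V.range in auto)
  have A_mem: "?A b z \<in> A" if "b \<in> F" "z \<in> F" for b z using that by (auto simp: A)
  have mult: "\<chi> (?A (b + b') (z + z')) = \<chi> (?A b z) * \<chi> (?A b' z')"
    if "b \<in> F" "z \<in> F" "b' \<in> F" "z' \<in> F" for b z b' z'
  proof (rule V.eigenvalue_mult[OF _ _ v(1,2) v(3) v(3)])
    have "?A b z \<cdot> ?A b' z' = ?A (b + b') (z + z')" using that by simp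
    then show "\<phi> (?A b z \<cdot> ?A b' z') v = fscale (\<chi> (?A (b + b') (z + z'))) v"
      using v(3) A_mem that by simp
  qed (use that A_mem AG in auto)
  have "\<chi> (?A 0 0) = 1"
    by (rule V.eigenvalue_one[OF v(1,2)]) (use v(3)[OF A_mem, of 0 0] in \<open>simp add: one_G\<close>)
  define \<mu> where "\<mu> z = \<chi> (?A 0 z)" for z
  define \<delta> where "\<delta> b = \<chi> (?A b 0)" for b
  have \<mu>: "addchar \<mu>" and \<delta>: "addchar \<delta>"
    unfolding addchar_def \<mu>_def \<delta>_def
    using mult[of 0 _ 0] mult[of _ 0 _ 0] \<open>\<chi> (?A 0 0) = 1\<close> by simp_all
  have decomp: "\<chi> (?A b z) = \<delta> b * \<mu> z" if "b \<in> F" "z \<in> F" for b z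
    using mult[of b 0 0 z] that by (simp add: \<mu>_def \<delta>_def)
  have \<mu>_nt: "\<exists>z\<in>F. \<mu> z \<noteq> 1"
  proof (rule ccontr)
    assume "\<not> ?thesis"
    then have "\<phi> x v = v" if "x \<in> Z" for x
      using that v(3)[OF A_mem, of 0] by (auto simp: Z_def \<mu>_def)
    then show False using nofix v by blast
  qed
  then obtain z0 where z0: "z0 \<in> F" "\<mu> z0 \<noteq> 1" by blast
  define \<kappa> where "\<kappa> a b = \<delta> b * \<mu> (a * b)" for a b
  have \<kappa>: "addchar (\<kappa> a)" if "a \<in> F" for a
    using that by (simp add: addchar_def \<kappa>_def distrib_left addchar_add[OF \<mu>] addchar_add[OF \<delta>]
        addchar_0[OF \<mu>] addchar_0[OF \<delta>] mult_ac)
  \<comment> \<open>Some \<open>\<kappa> a\<close> is trivial, since the sum of all \<open>\<kappa> a b\<close> is \<open>|F|\<close>; so after conjugating by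
    \<open>mk (- a) 0 0 1\<close> the character of \<open>A\<close> factors through the centre.\<close>
  have "\<exists>a\<in>F. \<forall>b\<in>F. \<kappa> a b = 1"
  proof (rule ccontr)
    assume contr: "\<not> ?thesis"
    have "(\<Sum>a\<in>F. \<Sum>b\<in>F. \<kappa> a b) = 0"
    proof (rule sum.neutral, rule ballI)
      fix a assume a: "a \<in> F"
      then obtain b where "b \<in> F" "\<kappa> a b \<noteq> 1" using contr by blast
      then show "(\<Sum>b\<in>F. \<kappa> a b) = 0" by (rule sum_addchar[OF \<kappa>[OF a]])
    qed
    moreover have "(\<Sum>a\<in>F. \<Sum>b\<in>F. \<kappa> a b) = (\<Sum>b\<in>F. \<Sum>a\<in>F. \<kappa> a b)" by (rule sum.swap)
    \<comment> \<open>Nondegeneracy of the product: for nonzero \<open>b\<close> the map from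
      \<open>a\<close> to \<open>\<mu> (a * b)\<close> is a nontrivial character, its value at
      \<open>c * z0\<close> being \<open>\<mu> z0\<close>.\<close>
    moreover have "(\<Sum>a\<in>F. \<kappa> a b) = (if b = 0 then of_nat (card F) else 0)" if b: "b \<in> F" for b
    proof (cases "b = 0")
      case True
      then show ?thesis by (simp add: \<kappa>_def addchar_0[OF \<mu>] addchar_0[OF \<delta>])
    next
      case False
      then obtain c where c: "c \<in> F" "b * c = e" using F_inverse b by blast
      have "addchar (\<lambda>a. \<mu> (a * b))"
        using b by (simp add: addchar_def distrib_right addchar_add[OF \<mu>] addchar_0[OF \<mu>])
      moreover have "(c * z0) * b = z0" using c z0 e_mult[OF z0(1)] by (metis mult.commute mult.left_commute)
      ultimately have "(\<Sum>a\<in>F. \<mu> (a * b)) = 0"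
        using sum_addchar[of "\<lambda>a. \<mu> (a * b)" "c * z0"] c z0 by simp
      then show ?thesis using False by (simp add: \<kappa>_def sum_distrib_left[symmetric])
    qed
    ultimately have "(\<Sum>b\<in>F. if b = 0 then of_nat (card F) else 0 :: complex) = 0" by simp
    then have "card F = 0" using finite_F by (simp add: sum.delta)
    then show False using finite_F F_0 by auto
  qed
  then obtain a0 where a0: "a0 \<in> F" "\<And>b. b \<in> F \<Longrightarrow> \<delta> b * \<mu> (a0 * b) = 1" unfolding \<kappa>_def by blast
  let ?g = "mk (- a0) 0 0 \<one>"
  have gG: "?g \<in> carrier G" using a0 by simp
  define u where "u = \<phi> ?g v"
  have u: "u \<in> fspace n" "u \<noteq> 0" unfolding u_def by (rule V.range[OF gG v(1)], rule V.neq_0[OF gG v(1,2)])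
  have Au: "\<phi> (?A b z) u = fscale (\<mu> z) u" if bz: "b \<in> F" "z \<in> F" for b z
  proof -
    \<comment> \<open>Moving an element of \<open>A\<close> past \<open>?g\<close> changes
      \<open>z\<close> by \<open>a0 * b\<close>, and this cancels the factor
      \<open>\<delta> b\<close>.\<close>
    have "?A b z \<cdot> ?g = ?g \<cdot> ?A b (z + a0 * b)" using bz a0 by simp
    then have "\<phi> (?A b z) u = \<phi> ?g (\<phi> (?A b (z + a0 * b)) v)"
      unfolding u_def using bz a0 gG v(1) by (simp add: V.mult[symmetric] del: mk_mult)
    also have "\<phi> (?A b (z + a0 * b)) v = fscale (\<delta> b * \<mu> (z + a0 * b)) v"
      using v(3)[OF A_mem] decomp bz a0 by simp
    also have "\<delta> b * \<mu> (z + a0 * b) = \<mu> z"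
      using a0(2)[OF bz(1)] bz a0(1) by (simp add: addchar_add[OF \<mu>] mult_ac)
    also have "\<phi> ?g (fscale (\<mu> z) v) = fscale (\<mu> z) u" unfolding u_def by (rule V.scale[OF gG])
    finally show ?thesis .
  qed
  let ?E = "V.eigsp A (\<lambda>x. \<mu> (zp x))"
  have uE: "u \<in> ?E" using u(1) Au by (auto simp: V.eigsp_def A)
  \<comment> \<open>A copy of \<open>R\<close> in \<open>G\<close>. It fixes the character of
    \<open>A\<close> because \<open>R\<close> acts trivially on the centre.\<close>
  let ?R = "(\<lambda>h. mk 0 0 0 h) ` R"
  have RH: "h \<in> carrier H" if "h \<in> R" for h using that R_subset by blast
  have RG: "?R \<subseteq> carrier G" using RH by auto
  have RE: "\<phi> s f \<in> ?E" if s: "s \<in> ?R" and f: "f \<in> ?E" for s f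
  proof -
    obtain h where h: "h \<in> R" "s = mk 0 0 0 h" using s by blast
    have sG: "s \<in> carrier G" using s RG by blast
    have hi: "inv h \<in> R" using h R_subgroup by (simp add: subgroup.m_inv_closed)
    show ?thesis
    proof (rule V.eigsp_invariant[OF AG sG f])
      fix x assume x: "x \<in> A"
      show "inv\<^sub>G s \<cdot> x \<cdot> inv\<^sub>G (inv\<^sub>G s) \<in> A" by (rule A_conj[OF G.inv_closed[OF sG] x])
      have si: "inv\<^sub>G s = mk 0 0 0 (inv h)" using h RH by (simp add: inv_mk)
      show "\<mu> (zp (inv\<^sub>G s \<cdot> x \<cdot> inv\<^sub>G (inv\<^sub>G s))) = \<mu> (zp x)"
        using x unfolding si by (elim above_cases) (use RH[OF hi] in \<open>simp add: conj_P \<gamma>_R[OF hi] del: mk_mult\<close>)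
    qed
  qed
  have Rcomm: "\<phi> s (\<phi> t f) = \<phi> t (\<phi> s f)" if st: "s \<in> ?R" "t \<in> ?R" and "f \<in> ?E" for s t f
  proof -
    have f: "f \<in> fspace n" by (rule V.eigspD[OF that(3)])
    obtain h k where hk: "h \<in> R" "s = mk 0 0 0 h" "k \<in> R" "t = mk 0 0 0 k" using st by blast
    have "s \<cdot> t = t \<cdot> s" using hk RH R_comm[of h k] by simp
    moreover have "\<phi> (s \<cdot> t) f = \<phi> s (\<phi> t f)" "\<phi> (t \<cdot> s) f = \<phi> t (\<phi> s f)"
      using st RG f by (auto intro: V.mult)
    ultimately show ?thesis by simp
  qed
  obtain w \<tau> where w: "w \<in> ?E" "w \<noteq> 0" "\<And>s. s \<in> ?R \<Longrightarrow> \<phi> s w = fscale (\<tau> s) w"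
    by (rule V.common_eigenvector[OF V.eigsp_subspace[OF AG] V.eigsp_subset uE u(2) RG RE Rcomm])
      (assumption | rule that)+
  have wn: "w \<in> fspace n" by (rule V.eigspD[OF w(1)])
  have one_R: "\<one> \<in> R" using R_subgroup by (rule subgroup.one_closed)
  have \<tau>1: "\<tau> (mk 0 0 0 \<one>) = 1"
    by (rule V.eigenvalue_one[OF wn w(2)]) (use w(3) one_R in \<open>simp add: one_G\<close>)
  define \<theta> where "\<theta> x = \<mu> (zp x) * \<tau> (mk 0 0 0 (hp x))" for x
  have \<theta>: "\<phi> x w = fscale (\<theta> x) w" if "x \<in> above R" for x
    using that
  proof (rule above_cases)
    fix b z h assume x: "b \<in> F" "z \<in> F" "h \<in> R" "x = mk 0 b z h"
    have "x = ?A b z \<cdot> mk 0 0 0 h" using x RH by simp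
    then have "\<phi> x w = \<phi> (?A b z) (\<phi> (mk 0 0 0 h) w)"
      using x RH wn by (simp add: V.mult[symmetric] del: mk_mult)
    also have "\<phi> (mk 0 0 0 h) w = fscale (\<tau> (mk 0 0 0 h)) w" using w(3) x by blast
    also have "\<phi> (?A b z) (fscale (\<tau> (mk 0 0 0 h)) w) = fscale (\<tau> (mk 0 0 0 h)) (\<phi> (?A b z) w)"
      using x by (simp add: V.scale)
    also have "\<phi> (?A b z) w = fscale (\<mu> z) w" using V.eigspD(2)[OF w(1) A_mem] x by simp
    finally show ?thesis using x RH by (simp add: \<theta>_def mult.commute)
  qed
  have \<theta>A: "\<theta> x = \<mu> (zp x)" if "x \<in> A" for x
    using that by (elim above_cases) (simp add: \<theta>_def \<tau>1)
  have "n * card (above R) = order G"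
  proof (rule V.irreducible_degree[OF irr above_subgroup[OF R_subgroup] wn w(2) \<theta> _ A_conj])
    show "A \<subseteq> above R" using one_R by (auto simp: above_def)
    show "g \<in> above R" if g: "g \<in> carrier G"
      and inv: "\<And>x. x \<in> A \<Longrightarrow> \<theta> (g \<cdot> x \<cdot> inv\<^sub>G g) = \<theta> x" for g
    proof (rule stabilizer_above_R[OF \<mu> \<mu>_nt g])
      fix x assume x: "x \<in> A"
      show "\<mu> (zp (g \<cdot> x \<cdot> inv\<^sub>G g)) = \<mu> (zp x)"
        using inv[OF x] unfolding \<theta>A[OF x] \<theta>A[OF A_conj[OF g x]] .
    qed
  qed
  moreover have "card F * K * card (above R) = order G"
    unfolding card_above[OF R_subset] order_G K[symmetric]
    by (simp add: power2_eq_square power3_eq_cube)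
  ultimately have "n * card (above R) = card F * K * card (above R)" by simp
  moreover have "order G > 0" using finite_G by (simp add: G.order_gt_0_iff_finite)
  then have "card (above R) > 0" using \<open>n * card (above R) = order G\<close> by (metis gr0I mult_0_right less_not_refl)
  ultimately show ?thesis by simp
qed

text \<open>By irreducibility each of \<open>Z\<close> and \<open>P\<close> acts trivially as soon
  as it fixes one nonzero vector, which separates the three preceding lemmas.\<close>

lemma degree_cases:
  assumes K: "K * card R = order H"
  shows "n \<in> {1, q, order H, card F * K}"
proof (cases "\<exists>f\<in>fspace n. f \<noteq> 0 \<and> (\<forall>x\<in>Z. \<phi> x f = f)")
  case False
  then have "n = card F * K" by (intro degree_Z_nontrivial K) blast
  then show ?thesis by simp
next
  case True
  then obtain f where f: "f \<in> fspace n" "f \<noteq> 0" "\<forall>x\<in>Z. \<phi> x f = f" by blast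
  have "V.eigsp Z (\<lambda>_. 1) = fspace n"
    by (rule V.eigsp_full[OF irr Z_subset _ f(2) Z_conj]) (use f in \<open>simp_all add: V.eigsp_def\<close>)
  then have triv: "\<phi> x f = f" if "x \<in> Z" "f \<in> fspace n" for x f
    using V.eigspD(2)[of f Z "\<lambda>_. 1" x] that by simp
  have PG: "P \<subseteq> carrier G" by (rule over_subset) simp
  have comm: "\<phi> s (\<phi> t f) = \<phi> t (\<phi> s f)" if st: "s \<in> P" "t \<in> P" and f: "f \<in> fspace n" for s t f
    using st
  proof (elim over_cases)
    fix a b z h a' b' z' h' assume s: "a \<in> F" "b \<in> F" "z \<in> F" "h \<in> {\<one>}" "s = mk a b z h"
        "a' \<in> F" "b' \<in> F" "z' \<in> F" "h' \<in> {\<one>}" "t = mk a' b' z' h'"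
    show ?thesis
    proof (rule commute_mod_trivial[OF triv Z_subset _ _ _ _ f])
      show "mk 0 0 (a * b' - a' * b) \<one> \<in> Z" using s by (auto simp: Z_def)
      show "s \<cdot> t = mk 0 0 (a * b' - a' * b) \<one> \<cdot> (t \<cdot> s)"
        using s by (simp add: algebra_simps)
    qed (use st PG in auto)
  qed
  obtain v \<chi> where v: "v \<in> fspace n" "v \<noteq> 0" "\<And>x. x \<in> P \<Longrightarrow> \<phi> x v = fscale (\<chi> x) v"
    by (rule V.common_eigenvector[OF subspace_fspace order_refl fbasis_in_fspace[OF n_pos] fbasis_neq_0 PG _ comm])
      (use PG V.range in auto)
  show ?thesis
  proof (cases "\<exists>x\<in>P. \<chi> x \<noteq> 1")
    case True
    then obtain x0 where "x0 \<in> P" "\<chi> x0 \<noteq> 1" by blast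
    from degree_Z_P_nontrivial[OF triv v this] have "n = order H" .
    then show ?thesis by simp
  next
    case False
    have "V.eigsp P (\<lambda>_. 1) = fspace n"
      by (rule V.eigsp_full[OF irr PG _ v(2) P_conj]) (use v False in \<open>simp_all add: V.eigsp_def\<close>)
    then have "\<phi> x f = f" if "x \<in> P" "f \<in> fspace n" for x f
      using V.eigspD(2)[of f P "\<lambda>_. 1" x] that by simp
    then have "n \<in> {1, q}" by (rule degree_P_trivial)
    then show ?thesis by blast
  qed
qed

end

lemma char_degrees_G:
  assumes "K * card R = order H"
  shows "char_degrees G = {1, q, order H, card F * K}"
proof (intro equalityI subsetI)
  fix n assume "n \<in> char_degrees G"
  then obtain \<rho> where \<rho>: "irreducible_rep G n \<rho>" unfolding char_degrees_def by blast
  then have rep: "is_rep G n \<rho>" by (rule irreducible_rep_is_rep)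
  show "n \<in> {1, q, order H, card F * K}"
    using \<rho> degree_cases[OF fun_rep_of_is_rep[OF group_G finite_G rep] _ _ assms]
    unfolding irreducible_rep_iff[OF group_G finite_G rep] by blast
qed (use degree_1 degree_q degree_order_H degree_above_R[OF assms] in blast)

end

section \<open>Derived length and Fitting height\<close>

text \<open>Class at most two is enough: \<open>P\<close> has class two and the other factors of the
  Fitting series are abelian.\<close>

lemma nilpotent_quotientI:
  fixes K (structure)
  assumes "N \<lhd> K" and Y: "subgroup Y K"
    and comm1: "\<And>x y. x \<in> carrier K \<Longrightarrow> y \<in> carrier K \<Longrightarrow> x \<otimes> y \<otimes> inv x \<otimes> inv y \<in> Y"
    and comm2: "\<And>x y. x \<in> Y \<Longrightarrow> y \<in> carrier K \<Longrightarrow> x \<otimes> y \<otimes> inv x \<otimes> inv y \<in> N"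
  shows "nilpotent_group (K Mod N)"
proof -
  interpret N: normal N K by fact
  let ?Q = "K Mod N" and ?f = "\<lambda>a. N #> a"
  have Q: "group ?Q" by (rule N.factorgroup_is_group)
  interpret f: group_hom K ?Q ?f
    by (rule group_hom.intro[OF N.is_group Q]) (simp add: group_hom_axioms_def N.r_coset_hom_Mod)
  have carrier_Q: "carrier ?Q = ?f ` carrier K" by (auto simp: FactGroup_def RCOSETS_def)
  have fc: "?f x \<otimes>\<^bsub>?Q\<^esub> ?f y \<otimes>\<^bsub>?Q\<^esub> inv\<^bsub>?Q\<^esub> ?f x \<otimes>\<^bsub>?Q\<^esub> inv\<^bsub>?Q\<^esub> ?f y =
      ?f (x \<otimes> y \<otimes> inv x \<otimes> inv y)" if "x \<in> carrier K" "y \<in> carrier K" for x y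
    using that by (simp only: f.hom_mult f.hom_inv N.m_closed N.inv_closed)
  have YK: "Y \<subseteq> carrier K" using Y by (rule subgroup.subset)
  have l1: "lower_central ?Q 1 \<subseteq> ?f ` Y"
    unfolding One_nat_def lower_central.simps commutator_subgroup_def
  proof (rule group.generate_subgroup_incl[OF Q _ f.subgroup_img_is_subgroup[OF Y]], rule subsetI)
    fix c assume "c \<in> {x \<otimes>\<^bsub>?Q\<^esub> y \<otimes>\<^bsub>?Q\<^esub> inv\<^bsub>?Q\<^esub> x \<otimes>\<^bsub>?Q\<^esub> inv\<^bsub>?Q\<^esub> y |x y. x \<in> carrier ?Q \<and> y \<in> carrier ?Q}"
    then obtain x y where "x \<in> carrier K" "y \<in> carrier K"
      "c = ?f x \<otimes>\<^bsub>?Q\<^esub> ?f y \<otimes>\<^bsub>?Q\<^esub> inv\<^bsub>?Q\<^esub> ?f x \<otimes>\<^bsub>?Q\<^esub> inv\<^bsub>?Q\<^esub> ?f y"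
      unfolding carrier_Q by blast
    then have "c = ?f (x \<otimes> y \<otimes> inv x \<otimes> inv y)" by (simp only: fc)
    then show "c \<in> ?f ` Y" using comm1[OF \<open>x \<in> carrier K\<close> \<open>y \<in> carrier K\<close>] by (rule image_eqI)
  qed
  have "lower_central ?Q (Suc 1) \<subseteq> {\<one>\<^bsub>?Q\<^esub>}"
    unfolding lower_central.simps(2) commutator_subgroup_def
  proof (rule group.generate_subgroup_incl[OF Q _ group.triv_subgroup[OF Q]], rule subsetI)
    fix c assume "c \<in> {x \<otimes>\<^bsub>?Q\<^esub> y \<otimes>\<^bsub>?Q\<^esub> inv\<^bsub>?Q\<^esub> x \<otimes>\<^bsub>?Q\<^esub> inv\<^bsub>?Q\<^esub> y |x y. x \<in> lower_central ?Q 1 \<and> y \<in> carrier ?Q}"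
    then obtain x y where xy: "x \<in> Y" "y \<in> carrier K"
      "c = ?f x \<otimes>\<^bsub>?Q\<^esub> ?f y \<otimes>\<^bsub>?Q\<^esub> inv\<^bsub>?Q\<^esub> ?f x \<otimes>\<^bsub>?Q\<^esub> inv\<^bsub>?Q\<^esub> ?f y"
      using l1 unfolding carrier_Q by blast
    then have "c = ?f (x \<otimes> y \<otimes> inv x \<otimes> inv y)" using fc[of x y] YK by blast
    then show "c \<in> {\<one>\<^bsub>?Q\<^esub>}" using comm2[OF xy(1,2)] by (simp add: N.rcos_const)
  qed
  moreover have "\<one>\<^bsub>?Q\<^esub> \<in> lower_central ?Q (Suc 1)"
    unfolding lower_central.simps(2) commutator_subgroup_def by (rule generate.one)
  ultimately have "lower_central ?Q (Suc 1) = {\<one>\<^bsub>?Q\<^esub>}" by blast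
  then show ?thesis using Q unfolding nilpotent_group_def by blast
qed

text \<open>The image of such a set \<open>S\<close> lies in every term of the lower central series
  of the quotient. Being only a set, \<open>S\<close> may be a union of pieces that are no subgroup
  together.\<close>

lemma nilpotent_quotientD:
  fixes K (structure)
  assumes "N \<lhd> K" and nil: "nilpotent_group (K Mod N)"
    and S: "S \<subseteq> carrier K" "S \<subseteq> commutator_subgroup K S (carrier K)"
  shows "S \<subseteq> N"
proof -
  interpret N: normal N K by fact
  let ?Q = "K Mod N" and ?f = "\<lambda>a. N #> a"
  have Q: "group ?Q" by (rule N.factorgroup_is_group)
  interpret f: group_hom K ?Q ?f
    by (rule group_hom.intro[OF N.is_group Q]) (simp add: group_hom_axioms_def N.r_coset_hom_Mod)
  have f_carrier: "?f x \<in> carrier ?Q" if "x \<in> carrier K" for x using that by (rule f.hom_closed)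
  have fc: "?f x \<otimes>\<^bsub>?Q\<^esub> ?f y \<otimes>\<^bsub>?Q\<^esub> inv\<^bsub>?Q\<^esub> ?f x \<otimes>\<^bsub>?Q\<^esub> inv\<^bsub>?Q\<^esub> ?f y =
      ?f (x \<otimes> y \<otimes> inv x \<otimes> inv y)" if "x \<in> carrier K" "y \<in> carrier K" for x y
    using that by (simp only: f.hom_mult f.hom_inv N.m_closed N.inv_closed)
  let ?C = "{x \<otimes> y \<otimes> inv x \<otimes> inv y |x y. x \<in> S \<and> y \<in> carrier K}"
  have CK: "?C \<subseteq> carrier K" using S(1) by blast
  have "?f ` S \<subseteq> lower_central ?Q k" for k
  proof (induction k)
    case 0
    then show ?case using S f_carrier by auto
  next
    case (Suc k)
    have "?f ` S \<subseteq> ?f ` generate K ?C" using S(2) unfolding commutator_subgroup_def by (rule image_mono)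
    also have "\<dots> = generate ?Q (?f ` ?C)" by (rule f.generate_img[OF CK, symmetric])
    also have "\<dots> \<subseteq> lower_central ?Q (Suc k)"
      unfolding lower_central.simps commutator_subgroup_def
    proof (rule group.mono_generate[OF Q], rule subsetI)
      fix c assume "c \<in> ?f ` ?C"
      then obtain x y where xy: "x \<in> S" "y \<in> carrier K"
        "c = ?f (x \<otimes> y \<otimes> inv x \<otimes> inv y)" by blast
      then have "c = ?f x \<otimes>\<^bsub>?Q\<^esub> ?f y \<otimes>\<^bsub>?Q\<^esub> inv\<^bsub>?Q\<^esub> ?f x \<otimes>\<^bsub>?Q\<^esub> inv\<^bsub>?Q\<^esub> ?f y"
        using fc[of x y] S(1) by auto
      moreover have "?f x \<in> lower_central ?Q k" using Suc xy(1) by blast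
      moreover have "?f y \<in> carrier ?Q" by (rule f_carrier[OF xy(2)])
      ultimately show "c \<in> {x \<otimes>\<^bsub>?Q\<^esub> y \<otimes>\<^bsub>?Q\<^esub> inv\<^bsub>?Q\<^esub> x \<otimes>\<^bsub>?Q\<^esub> inv\<^bsub>?Q\<^esub> y |x y. x \<in> lower_central ?Q k \<and> y \<in> carrier ?Q}"
        by blast
    qed
    finally show ?case .
  qed
  then obtain "?f ` S \<subseteq> {\<one>\<^bsub>?Q\<^esub>}" using nil unfolding nilpotent_group_def by metis
  show ?thesis
  proof
    fix s assume s: "s \<in> S"
    then have "?f s = N" using \<open>?f ` S \<subseteq> {\<one>\<^bsub>?Q\<^esub>}\<close> by auto
    then show "s \<in> N" using s S(1) N.rcos_self[of s N] N.subgroup_axioms by blast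
  qed
qed

lemma (in group) commutator_subgroup_consistent:
  assumes "subgroup M G" "X \<subseteq> M" "Y \<subseteq> M"
  shows "commutator_subgroup (G\<lparr>carrier := M\<rparr>) X Y = commutator_subgroup G X Y"
proof -
  have "{x \<otimes> y \<otimes> inv\<^bsub>G\<lparr>carrier := M\<rparr>\<^esub> x \<otimes> inv\<^bsub>G\<lparr>carrier := M\<rparr>\<^esub> y |x y. x \<in> X \<and> y \<in> Y} =
      {x \<otimes> y \<otimes> inv x \<otimes> inv y |x y. x \<in> X \<and> y \<in> Y}" (is "?A = ?B")
    using assms by (auto simp: subset_iff; force)
  moreover have "?B \<subseteq> M"
    using assms by (auto simp: subset_iff subgroup.m_closed subgroup.m_inv_closed)
  ultimately show ?thesis
    unfolding commutator_subgroup_def using generate_consistent[OF _ assms(1)] by simp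
qed

lemma (in group) commutator_eqI:
  assumes "x \<in> carrier G" "y \<in> carrier G" "c \<in> carrier G" "x \<otimes> y = c \<otimes> (y \<otimes> x)"
  shows "x \<otimes> y \<otimes> inv x \<otimes> inv y = c"
  using assms by (simp add: m_assoc)

text \<open>\<open>C\<close> witnesses that \<open>H\<close> is not nilpotent: its elements are
  commutators of elements of \<open>C\<close>, so it survives in the whole lower central
  series.\<close>

locale heis_ext_series = heis_ext_chars +
  fixes C :: "'a set"
  assumes comm_H: "h \<in> carrier H \<Longrightarrow> k \<in> carrier H \<Longrightarrow> h \<otimes> k \<otimes> inv h \<otimes> inv k \<in> B"
    and C_subset: "C \<subseteq> carrier H"
    and C_comm: "c \<in> C \<Longrightarrow> \<exists>d\<in>C. \<exists>t\<in>carrier H. d \<otimes> t \<otimes> inv d \<otimes> inv t = c"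
    and C_nontrivial: "\<exists>c\<in>C. c \<noteq> \<one>"
begin

abbreviation commG where "commG x y \<equiv> x \<cdot> y \<cdot> inv\<^sub>G x \<cdot> inv\<^sub>G y"

lemma hp_hom: "x \<in> carrier G \<Longrightarrow> y \<in> carrier G \<Longrightarrow> hp (x \<cdot> y) = hp x \<otimes> hp y"
  by (elim carrier_G_cases) simp

lemma hp_inv: "x \<in> carrier G \<Longrightarrow> hp (inv\<^sub>G x) = inv hp x"
  by (elim carrier_G_cases) (simp add: inv_mk)

lemma in_over_iff: "S \<subseteq> carrier H \<Longrightarrow> x \<in> over S \<longleftrightarrow> x \<in> carrier G \<and> hp x \<in> S"
  by (auto elim!: over_cases carrier_G_cases)

lemma hp_carrier: "x \<in> carrier G \<Longrightarrow> hp x \<in> carrier H"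
  by (elim carrier_G_cases) simp

lemma commG_over_B: "x \<in> carrier G \<Longrightarrow> y \<in> carrier G \<Longrightarrow> commG x y \<in> over B"
  by (simp add: in_over_iff[OF B_subset] hp_hom hp_inv comm_H hp_carrier)

lemma commG_P:
  assumes "x \<in> over B" "y \<in> over B" shows "commG x y \<in> P"
proof -
  have x: "x \<in> carrier G" "hp x \<in> B" "y \<in> carrier G" "hp y \<in> B" using assms in_over_iff[OF B_subset] by auto
  have "hp x \<otimes> hp y \<otimes> inv hp x \<otimes> inv hp y = \<one>"
    by (rule H.commutator_eqI) (use x B_subset B_comm hp_carrier in auto)
  then show ?thesis using x by (simp add: in_over_iff hp_hom hp_inv hp_carrier)
qed

lemma commG_Z:
  assumes "x \<in> P" "y \<in> P" shows "commG x y \<in> Z"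
  using assms
proof (elim over_cases)
  fix a b z h a' b' z' h' assume s: "a \<in> F" "b \<in> F" "z \<in> F" "h \<in> {\<one>}" "x = mk a b z h"
      "a' \<in> F" "b' \<in> F" "z' \<in> F" "h' \<in> {\<one>}" "y = mk a' b' z' h'"
  have "commG x y = mk 0 0 (a * b' - a' * b) \<one>"
    by (rule G.commutator_eqI) (use s in \<open>simp_all add: algebra_simps\<close>)
  then show ?thesis using s by (auto simp: Z_def)
qed

lemma commG_one:
  assumes "x \<in> Z" "y \<in> P" shows "commG x y = \<one>\<^bsub>G\<^esub>"
proof -
  obtain z where z: "z \<in> F" "x = mk 0 0 z \<one>" using assms(1) by (auto simp: Z_def)
  show ?thesis
    using assms(2)
    by (elim over_cases, intro G.commutator_eqI) (use z in \<open>simp_all add: one_G add.commute\<close>)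
qed

lemma Z_subgroup: "subgroup Z G"
proof (rule G.subgroupI)
  show "Z \<subseteq> carrier G" by (rule Z_subset)
  show "Z \<noteq> {}" using F_0 unfolding Z_def by blast
  show "inv\<^sub>G x \<in> Z" if "x \<in> Z" for x
    using that unfolding Z_def by (auto simp: inv_mk)
  show "x \<cdot> y \<in> Z" if "x \<in> Z" "y \<in> Z" for x y
    using that unfolding Z_def by auto
qed

lemma P_subset: "P \<subseteq> carrier G" by (rule over_subset) simp

lemma Z_P: "Z \<subseteq> P" by (auto simp: Z_def)

text \<open>Commutators with \<open>h\<close> give all elements of either coordinate by the
  surjectivity of displacements, and commutators inside \<open>P\<close> give the centre. It is
  applied to derived subgroups and to terms of commutator series.\<close>

lemma P_contained:
  assumes K: "subgroup K G" and h: "h \<in> carrier H" "h \<noteq> \<one>"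
    and 1: "\<And>x. x \<in> P \<Longrightarrow> commG x (mk 0 0 0 h) \<in> K"
    and 2: "\<And>x y. x \<in> P \<Longrightarrow> y \<in> P \<Longrightarrow> commG x y \<in> K"
  shows "P \<subseteq> K"
proof -
  have a: "mk a 0 0 \<one> \<in> K" if aF: "a \<in> F" for a
  proof -
    \<comment> \<open>The sign comes from the order in the commutator, whose first coordinate is
      \<open>x - \<alpha> h x\<close>.\<close>
    obtain x where x: "x \<in> F" "\<alpha> h x - x = - a" by (rule \<alpha>_surj[OF h F_minus[OF aF]])
    have "commG (mk x 0 0 \<one>) (mk 0 0 0 h) = mk a 0 0 \<one>"
      by (rule G.commutator_eqI) (use x h aF in \<open>simp_all add: algebra_simps eq_neg_iff_add_eq_0\<close>)
    then show ?thesis using 1[of "mk x 0 0 \<one>"] x by simp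
  qed
  have b: "mk 0 b 0 \<one> \<in> K" if bF: "b \<in> F" for b
  proof -
    obtain x where x: "x \<in> F" "\<beta> h x - x = - b" by (rule \<beta>_surj[OF h F_minus[OF bF]])
    have "commG (mk 0 x 0 \<one>) (mk 0 0 0 h) = mk 0 b 0 \<one>"
      by (rule G.commutator_eqI) (use x h bF in \<open>simp_all add: algebra_simps eq_neg_iff_add_eq_0\<close>)
    then show ?thesis using 1[of "mk 0 x 0 \<one>"] x by simp
  qed
  have z: "mk 0 0 z \<one> \<in> K" if "z \<in> F" for z
  proof -
    have "commG (mk z 0 0 \<one>) (mk 0 e 0 \<one>) = mk 0 0 z \<one>"
      by (rule G.commutator_eqI) (use that e_mult[OF that] in \<open>simp_all add: mult.commute\<close>)
    then show ?thesis using 2[of "mk z 0 0 \<one>" "mk 0 e 0 \<one>"] that by simp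
  qed
  show ?thesis
  proof
    fix x assume "x \<in> P"
    then obtain a' b' z' where x: "a' \<in> F" "b' \<in> F" "z' \<in> F" "x = mk a' b' z' \<one>"
      by (auto elim: over_cases)
    have "x = mk 0 0 z' \<one> \<cdot> (mk 0 b' 0 \<one> \<cdot> mk a' 0 0 \<one>)" using x by simp
    also have "\<dots> \<in> K" using a b z x by (intro subgroup.m_closed[OF K]) auto
    finally show "x \<in> K" .
  qed
qed

lemma derived_memI: "x \<in> S \<Longrightarrow> y \<in> S \<Longrightarrow> commG x y \<in> derived G S"
  unfolding derived_def by (rule generate.incl) blast

lemma commutator_subgroup_memI: "x \<in> S \<Longrightarrow> y \<in> T \<Longrightarrow> commG x y \<in> commutator_subgroup G S T"
  unfolding commutator_subgroup_def by (rule generate.incl) blast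

lemma commutator_subgroup_is_subgroup:
  "S \<subseteq> carrier G \<Longrightarrow> T \<subseteq> carrier G \<Longrightarrow> subgroup (commutator_subgroup G S T) G"
  unfolding commutator_subgroup_def by (rule G.generate_is_subgroup) (auto simp: subset_iff)

lemma e_not_one: "mk 0 0 e \<one> \<noteq> \<one>\<^bsub>G\<^esub>"
  using e_neq_0 by (simp add: one_G)

lemma derived_G: "(derived G ^^ 4) (carrier G) = {\<one>\<^bsub>G\<^esub>}"
proof -
  have der: "derived G S \<subseteq> T" if "\<And>x y. x \<in> S \<Longrightarrow> y \<in> S \<Longrightarrow> commG x y \<in> T" "subgroup T G" for S T
    unfolding derived_def using that by (intro G.generate_subgroup_incl) auto
  have d: "derived G (carrier G) \<subseteq> over B" by (rule der[OF commG_over_B over_subgroup[OF B_subgroup]])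
  have d2: "derived G (over B) \<subseteq> P" by (rule der[OF commG_P P_subgroup])
  have d3: "derived G P \<subseteq> Z" by (rule der[OF commG_Z Z_subgroup])
  have d4: "derived G Z \<subseteq> {\<one>\<^bsub>G\<^esub>}"
    by (rule der[OF _ G.triv_subgroup]) (use commG_one Z_P in blast)
  have "(derived G ^^ 4) (carrier G) = derived G (derived G (derived G (derived G (carrier G))))"
    by (simp add: numeral_eq_Suc)
  also have "\<dots> \<subseteq> derived G (derived G (derived G (over B)))" by (intro G.mono_derived d)
  also have "\<dots> \<subseteq> derived G (derived G P)" by (intro G.mono_derived d2)
  also have "\<dots> \<subseteq> derived G Z" by (intro G.mono_derived d3)
  also have "\<dots> \<subseteq> {\<one>\<^bsub>G\<^esub>}" by (rule d4)
  finally have "(derived G ^^ 4) (carrier G) \<subseteq> {\<one>\<^bsub>G\<^esub>}" .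
  moreover have "\<one>\<^bsub>G\<^esub> \<in> (derived G ^^ 4) (carrier G)"
    by (rule subgroup.one_closed[OF G.exp_of_derived_is_subgroup[OF G.subgroup_self]])
  ultimately show ?thesis by blast
qed

lemma solvable_G: "solvable G"
  using derived_G by (auto simp: G.solvable_iff_trivial_derived_seq)

text \<open>The first derived subgroup contains \<open>P\<close> and, through \<open>C_comm\<close>,
  a nontrivial element of \<open>H\<close>. Therefore the second one still contains
  \<open>P\<close>, and the third contains commutators of \<open>P\<close>, among them a nontrivial
  central element.\<close>

lemma derived_lower:
  assumes "n < 4" shows "mk 0 0 e \<one> \<in> (derived G ^^ n) (carrier G)"
proof -
  obtain c where c: "c \<in> C" "c \<noteq> \<one>" using C_nontrivial by blast
  then have cH: "c \<in> carrier H" using C_subset by blast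
  let ?D = "derived G (carrier G)"
  have PS: "P \<subseteq> derived G S" if "P \<subseteq> S" "mk 0 0 0 c \<in> S" "S \<subseteq> carrier G" for S
    by (rule P_contained[OF G.derived_is_subgroup[OF that(3)] cH c(2)])
      (rule derived_memI, use that in blast, use that in blast)+
  have P1: "P \<subseteq> ?D" by (rule PS[OF P_subset]) (use cH in simp_all)
  obtain d t where d: "d \<in> C" "t \<in> carrier H" "d \<otimes> t \<otimes> inv d \<otimes> inv t = c"
    using C_comm[OF c(1)] by blast
  then have dH: "d \<in> carrier H" using C_subset by blast
  have "commG (mk 0 0 0 d) (mk 0 0 0 t) = mk 0 0 0 c"
    using d dH by (simp add: inv_mk)
  then have c1: "mk 0 0 0 c \<in> ?D" using derived_memI[of "mk 0 0 0 d" "carrier G" "mk 0 0 0 t"] dH d(2) by simp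
  have DG: "?D \<subseteq> carrier G" by (rule G.derived_in_carrier) simp
  have P2: "P \<subseteq> derived G ?D" by (rule PS[OF P1 c1 DG])
  have "commG (mk e 0 0 \<one>) (mk 0 e 0 \<one>) = mk 0 0 e \<one>"
    by (rule G.commutator_eqI) simp_all
  then have "mk 0 0 e \<one> \<in> derived G P"
    using derived_memI[of "mk e 0 0 \<one>" P "mk 0 e 0 \<one>"] by simp
  then have P3: "mk 0 0 e \<one> \<in> derived G (derived G ?D)" using G.mono_derived[OF P2] by blast
  have eP: "mk 0 0 e \<one> \<in> P" by simp
  consider "n = 0" | "n = 1" | "n = 2" | "n = 3" using assms by linarith
  then show ?thesis
  proof cases
    case 1 then show ?thesis by simp
  next
    case 2 then show ?thesis using P1 eP by auto
  next
    case 3 then show ?thesis using P2 eP by (auto simp: numeral_eq_Suc)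
  next
    case 4 then show ?thesis using P3 by (simp add: numeral_eq_Suc)
  qed
qed

lemma derived_length_G: "derived_length G = 4"
  unfolding derived_length_def
proof (rule Least_equality[where P = "\<lambda>n. (derived G ^^ n) (carrier G) = {\<one>\<^bsub>G\<^esub>}", OF derived_G])
  fix n assume "(derived G ^^ n) (carrier G) = {\<one>\<^bsub>G\<^esub>}"
  then show "4 \<le> n" using derived_lower[of n] e_not_one by (metis not_le singletonD)
qed

lemma quotient_nilpotentI:
  assumes M: "subgroup M G" and N: "N \<lhd> G" and Y: "subgroup Y G" and sub: "N \<subseteq> M" "Y \<subseteq> M"
    and comm1: "\<And>x y. x \<in> M \<Longrightarrow> y \<in> M \<Longrightarrow> commG x y \<in> Y"
    and comm2: "\<And>x y. x \<in> Y \<Longrightarrow> y \<in> M \<Longrightarrow> commG x y \<in> N"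
  shows "nilpotent_group ((G\<lparr>carrier := M\<rparr>) Mod N)"
proof (rule nilpotent_quotientI[where Y = Y])
  show "N \<lhd> G\<lparr>carrier := M\<rparr>" by (rule G.normal_restrict_supergroup[OF M N sub(1)])
  show "subgroup Y (G\<lparr>carrier := M\<rparr>)" by (rule G.subgroup_incl[OF Y M sub(2)])
qed (use M sub comm1 comm2 in \<open>auto simp: subset_iff\<close>)

lemma quotient_nilpotentD:
  assumes "M \<lhd> G" "N \<lhd> G" "N \<subseteq> M" "nilpotent_group ((G\<lparr>carrier := M\<rparr>) Mod N)"
    and S: "S \<subseteq> M" "S \<subseteq> commutator_subgroup G S M"
  shows "S \<subseteq> N"
proof -
  have M: "subgroup M G" using assms(1) by (rule normal_imp_subgroup)
  show ?thesis
    by (rule nilpotent_quotientD[OF G.normal_restrict_supergroup[OF M assms(2,3)] assms(4)])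
      (use S G.commutator_subgroup_consistent[OF M S(1) order_refl] in simp_all)
qed

text \<open>The series through \<open>P\<close> and the preimage of \<open>B\<close> has length
  three. For the lower bound, \<open>P\<close> together with \<open>C\<close> lies in its own
  commutator with \<open>G\<close>, so in any series it lies in the last proper term. If that is
  \<open>N 1\<close>, then \<open>N 1\<close> contains a nontrivial \<open>c\<close>, whence
  \<open>P\<close> lies in its commutator with \<open>N 1\<close> and would be trivial.\<close>

lemma fitting_height_G: "fitting_height G = 3"
  unfolding fitting_height_def
proof (rule Least_equality)
  let ?N = "\<lambda>i::nat. if i = 0 then {\<one>\<^bsub>G\<^esub>} else if i = 1 then P else if i = 2 then over B else carrier G"
  have PB: "P \<subseteq> over B" using subgroup.one_closed[OF B_subgroup] B_subset by (auto elim!: over_cases)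
  have PN: "P \<lhd> G" by (rule over_normal[OF H.one_is_normal])
  have BN: "over B \<lhd> G" by (rule over_normal[OF B_normal])
  have BG: "over B \<subseteq> carrier G" by (rule over_subset[OF B_subset])
  have n0: "nilpotent_group ((G\<lparr>carrier := P\<rparr>) Mod {\<one>\<^bsub>G\<^esub>})"
    by (rule quotient_nilpotentI[OF P_subgroup G.one_is_normal Z_subgroup])
      (use commG_Z commG_one Z_P in \<open>auto simp: one_G\<close>)
  have n1: "nilpotent_group ((G\<lparr>carrier := over B\<rparr>) Mod P)"
    by (rule quotient_nilpotentI[OF over_subgroup[OF B_subgroup] PN P_subgroup PB PB]) (use commG_P PB in blast)+
  have n2: "nilpotent_group ((G\<lparr>carrier := carrier G\<rparr>) Mod over B)"
    by (rule quotient_nilpotentI[OF G.subgroup_self BN over_subgroup[OF B_subgroup] BG BG])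
      (use commG_over_B BG in blast)+
  show "\<exists>N. N 0 = {\<one>\<^bsub>G\<^esub>} \<and> N 3 = carrier G \<and> (\<forall>i\<le>3. N i \<lhd> G) \<and>
     (\<forall>i<3. N i \<subseteq> N (Suc i) \<and> nilpotent_group ((G\<lparr>carrier := N (Suc i)\<rparr>) Mod N i))"
  proof (intro exI[of _ ?N] conjI allI impI)
    show "?N i \<lhd> G" if "i \<le> 3" for i using PN BN G.one_is_normal G.normal_self by simp
    show "?N i \<subseteq> ?N (Suc i)" if "i < 3" for i
    proof -
      consider "i = 0" | "i = 1" | "i = 2" using \<open>i < 3\<close> by linarith
      then show ?thesis using PB BG by cases (simp_all add: one_G)
    qed
    show "nilpotent_group ((G\<lparr>carrier := ?N (Suc i)\<rparr>) Mod ?N i)" if "i < 3" for i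
    proof -
      consider "i = 0" | "i = 1" | "i = 2" using \<open>i < 3\<close> by linarith
      then show ?thesis using n0 n1 n2 by cases simp_all
    qed
  qed simp_all
next
  fix h assume "\<exists>N. N 0 = {\<one>\<^bsub>G\<^esub>} \<and> N h = carrier G \<and> (\<forall>i\<le>h. N i \<lhd> G) \<and>
     (\<forall>i<h. N i \<subseteq> N (Suc i) \<and> nilpotent_group ((G\<lparr>carrier := N (Suc i)\<rparr>) Mod N i))"
  then obtain N where N: "N 0 = {\<one>\<^bsub>G\<^esub>} \<and> N h = carrier G \<and> (\<forall>i\<le>h. N i \<lhd> G) \<and>
     (\<forall>i<h. N i \<subseteq> N (Suc i) \<and> nilpotent_group ((G\<lparr>carrier := N (Suc i)\<rparr>) Mod N i))" by (rule exE)
  then have N0: "N 0 = {\<one>\<^bsub>G\<^esub>}" and Nh: "N h = carrier G" and norm: "\<And>i. i \<le> h \<Longrightarrow> N i \<lhd> G"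
    and step: "\<And>i. i < h \<Longrightarrow> N i \<subseteq> N (Suc i)"
      "\<And>i. i < h \<Longrightarrow> nilpotent_group ((G\<lparr>carrier := N (Suc i)\<rparr>) Mod N i)" by simp_all
  obtain c where c: "c \<in> C" "c \<noteq> \<one>" using C_nontrivial by blast
  then have cH: "c \<in> carrier H" using C_subset by blast
  have P_comm: "P \<subseteq> commutator_subgroup G S M" if "P \<subseteq> S" "P \<subseteq> M" "mk 0 0 0 c \<in> M" "S \<subseteq> carrier G" "M \<subseteq> carrier G" for S M
    by (rule P_contained[OF commutator_subgroup_is_subgroup[OF that(4,5)] cH c(2)])
      (rule commutator_subgroup_memI, use that in blast, use that in blast)+
  let ?S = "P \<union> (\<lambda>c. mk 0 0 0 c) ` C"
  have SG: "?S \<subseteq> carrier G" using P_subset C_subset by auto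
  have S_comm: "?S \<subseteq> commutator_subgroup G ?S (carrier G)"
  proof (rule Un_least)
    show "P \<subseteq> commutator_subgroup G ?S (carrier G)"
      by (rule P_comm) (use SG P_subset cH in auto)
    show "(\<lambda>c. mk 0 0 0 c) ` C \<subseteq> commutator_subgroup G ?S (carrier G)"
    proof (rule image_subsetI)
      fix c assume c: "c \<in> C"
      obtain d t where d: "d \<in> C" "t \<in> carrier H" "d \<otimes> t \<otimes> inv d \<otimes> inv t = c"
        using C_comm[OF c] by blast
      then have dH: "d \<in> carrier H" using C_subset by blast
      have "commG (mk 0 0 0 d) (mk 0 0 0 t) = mk 0 0 0 c"
        using d dH by (simp add: inv_mk)
      then show "mk 0 0 0 c \<in> commutator_subgroup G ?S (carrier G)"
        using commutator_subgroup_memI[of "mk 0 0 0 d" ?S "mk 0 0 0 t" "carrier G"] d by simp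
    qed
  qed
  have eP: "mk 0 0 e \<one> \<in> P" by simp
  show "3 \<le> h"
  proof (rule ccontr)
    assume "\<not> 3 \<le> h"
    then consider "h = 0" | "h = 1" | "h = 2" by linarith
    then show False
    proof cases
      case 1
      then have "carrier G = {\<one>\<^bsub>G\<^esub>}" using N0 Nh by simp
      then show False using eP P_subset e_not_one by blast
    next
      case 2
      have "?S \<subseteq> N 0"
        by (rule quotient_nilpotentD[of "N 1"]) (use norm step[of 0] SG S_comm 2 Nh in \<open>simp_all add: G.normal_self\<close>)
      then show False using eP e_not_one N0 by blast
    next
      case 3
      have N2: "N (Suc 1) = carrier G" using Nh 3 by (simp add: numeral_eq_Suc)
      have S1: "?S \<subseteq> N 1"
        by (rule quotient_nilpotentD[of "N (Suc 1)"])
          (use norm[of 1] norm[of "Suc 1"] step[of 1] SG S_comm 3 N2 in \<open>simp_all add: G.normal_self\<close>)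
      have N1G: "N 1 \<subseteq> carrier G" using norm[of 1] 3 by (simp add: normal_imp_subgroup subgroup.subset)
      have "P \<subseteq> N 0"
      proof (rule quotient_nilpotentD[of "N 1"])
        show "P \<subseteq> commutator_subgroup G P (N 1)"
          by (rule P_comm) (use S1 N1G P_subset c in auto)
      qed (use norm[of 0] norm[of 1] step[of 0] 3 S1 in simp_all)
      then show False using eP e_not_one N0 by blast
    qed
  qed
qed

end

section \<open>The field with prime power many elements\<close>

definition ring_ideal :: "'r::comm_ring_1 set \<Rightarrow> bool" where
  "ring_ideal I \<longleftrightarrow> 0 \<in> I \<and> (\<forall>x\<in>I. \<forall>y\<in>I. x - y \<in> I) \<and> (\<forall>x\<in>I. \<forall>r. r * x \<in> I)"

lemma ring_ideal_add: "ring_ideal I \<Longrightarrow> x \<in> I \<Longrightarrow> y \<in> I \<Longrightarrow> x + y \<in> I"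
  unfolding ring_ideal_def by (metis diff_0 diff_minus_eq_add)

lemma ring_ideal_minus: "ring_ideal I \<Longrightarrow> x \<in> I \<Longrightarrow> - x \<in> I"
  unfolding ring_ideal_def by (metis diff_0)

text \<open>The product of all quotients of a commutative ring. As the prime \<open>p\<close> is a variable of the
  theorem, no type can depend on it; the field with \<open>p^q\<close> elements is found instead as one
  factor, a non-unital subring of this type.\<close>

definition quot_rel :: "('r::comm_ring_1 set \<Rightarrow> 'r) \<Rightarrow> ('r set \<Rightarrow> 'r) \<Rightarrow> bool" where
  "quot_rel f g \<longleftrightarrow> (\<forall>I. ring_ideal I \<longrightarrow> f I - g I \<in> I)"

quotient_type (overloaded) 'r quotients = "'r::comm_ring_1 set \<Rightarrow> 'r" / quot_rel
proof (rule equivpI)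
  show "reflp (quot_rel :: ('r set \<Rightarrow> 'r) \<Rightarrow> _)"
    by (auto simp: reflp_def quot_rel_def ring_ideal_def)
  show "symp (quot_rel :: ('r set \<Rightarrow> 'r) \<Rightarrow> _)"
    unfolding symp_def quot_rel_def by (metis minus_diff_eq ring_ideal_minus)
  show "transp (quot_rel :: ('r set \<Rightarrow> 'r) \<Rightarrow> _)"
  proof (unfold transp_def quot_rel_def, intro allI impI)
    fix f g h :: "'r set \<Rightarrow> 'r" and I :: "'r set"
    assume "\<forall>I. ring_ideal I \<longrightarrow> f I - g I \<in> I" "\<forall>I. ring_ideal I \<longrightarrow> g I - h I \<in> I" "ring_ideal I"
    then have "(f I - g I) + (g I - h I) \<in> I" by (blast intro: ring_ideal_add)
    then show "f I - h I \<in> I" by simp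
  qed
qed

instantiation quotients :: (comm_ring_1) comm_ring_1
begin

lift_definition zero_quotients :: "'a quotients" is "\<lambda>_. 0" .
lift_definition one_quotients :: "'a quotients" is "\<lambda>_. 1" .
lift_definition plus_quotients :: "'a quotients \<Rightarrow> 'a quotients \<Rightarrow> 'a quotients" is "\<lambda>f g I. f I + g I"
  unfolding quot_rel_def by (metis add_diff_add ring_ideal_add)
lift_definition uminus_quotients :: "'a quotients \<Rightarrow> 'a quotients" is "\<lambda>f I. - f I"
  unfolding quot_rel_def by (metis minus_diff_minus ring_ideal_minus)
lift_definition minus_quotients :: "'a quotients \<Rightarrow> 'a quotients \<Rightarrow> 'a quotients" is "\<lambda>f g I. f I - g I"
proof (unfold quot_rel_def, intro allI impI)
  fix f f' g g' :: "'a set \<Rightarrow> 'a" and I :: "'a set"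
  assume a: "\<forall>I. ring_ideal I \<longrightarrow> f I - f' I \<in> I" "\<forall>I. ring_ideal I \<longrightarrow> g I - g' I \<in> I" "ring_ideal I"
  then have "(f I - f' I) - (g I - g' I) \<in> I" by (simp add: ring_ideal_def)
  then show "f I - g I - (f' I - g' I) \<in> I" by (simp add: algebra_simps)
qed
lift_definition times_quotients :: "'a quotients \<Rightarrow> 'a quotients \<Rightarrow> 'a quotients" is "\<lambda>f g I. f I * g I"
proof (unfold quot_rel_def, intro allI impI)
  fix f f' g g' :: "'a set \<Rightarrow> 'a" and I :: "'a set"
  assume a: "\<forall>I. ring_ideal I \<longrightarrow> f I - f' I \<in> I" "\<forall>I. ring_ideal I \<longrightarrow> g I - g' I \<in> I" "ring_ideal I"
  then have "g I * (f I - f' I) \<in> I" "f' I * (g I - g' I) \<in> I" by (auto simp: ring_ideal_def)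
  then have "g I * (f I - f' I) + f' I * (g I - g' I) \<in> I" by (rule ring_ideal_add[OF a(3)])
  then show "f I * g I - f' I * g' I \<in> I" by (simp add: algebra_simps)
qed

instance
proof
  show "(0::'a quotients) \<noteq> 1"
  proof (transfer, unfold quot_rel_def, intro notI)
    assume "\<forall>I::'a set. ring_ideal I \<longrightarrow> 0 - 1 \<in> I"
    moreover have "ring_ideal {0::'a}" by (auto simp: ring_ideal_def)
    ultimately show False by force
  qed
qed (transfer, simp add: quot_rel_def ring_ideal_def algebra_simps)+

end

text \<open>The value zero at all other ideals makes the embedding additive and multiplicative, but
  its image of 1 is only an idempotent; this becomes the identity \<open>e\<close> of the
  field.\<close>

lift_definition factor_emb :: "'r::comm_ring_1 set \<Rightarrow> 'r \<Rightarrow> 'r quotients" is "\<lambda>I f J. if J = I then f else 0" .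

lemma factor_emb_add: "factor_emb I (f + g) = factor_emb I f + factor_emb I g"
  by transfer (auto simp: quot_rel_def ring_ideal_def)

lemma factor_emb_mult: "factor_emb I (f * g) = factor_emb I f * factor_emb I g"
  by transfer (auto simp: quot_rel_def ring_ideal_def)

lemma factor_emb_0 [simp]: "factor_emb I 0 = 0"
  by transfer (auto simp: quot_rel_def ring_ideal_def)

lemma factor_emb_eq_iff: "ring_ideal I \<Longrightarrow> factor_emb I f = factor_emb I g \<longleftrightarrow> f - g \<in> I"
  by transfer (auto simp: quot_rel_def ring_ideal_def)

text \<open>The ambient ring does not have characteristic \<open>p\<close>, so the hypothesis is
  placed on \<open>x\<close>, which occurs in every middle term of the binomial sum.\<close>

lemma freshmans_dream:
  fixes x y :: "'r::comm_ring_1"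
  assumes "prime p" "of_nat p * x = 0"
  shows "(x + y) ^ p = x ^ p + y ^ p"
proof -
  have p: "p > 0" using assms(1) by (rule prime_gt_0_nat)
  have zero: "of_nat (p choose k) * x ^ k * y ^ (p - k) = 0" if k: "0 < k" "k < p" for k
  proof -
    obtain m where m: "p choose k = p * m" using dvd_choose_prime[of k p] assms(1) k p by (auto elim: dvdE)
    obtain l where l: "k = Suc l" using k by (cases k) auto
    have "of_nat (p choose k) * x ^ k * y ^ (p - k) = (of_nat p * x) * (of_nat m * x ^ l * y ^ (p - k))"
      by (simp only: m) (simp add: l mult_ac)
    then show ?thesis using assms by simp
  qed
  have "(x + y) ^ p = (\<Sum>k\<le>p. of_nat (p choose k) * x ^ k * y ^ (p - k))" by (rule binomial_ring)
  also have "\<dots> = (\<Sum>k\<in>{0, p}. of_nat (p choose k) * x ^ k * y ^ (p - k))"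
    by (rule sum.mono_neutral_right) (auto simp: zero)
  also have "\<dots> = x ^ p + y ^ p" using p by simp
  finally show ?thesis .
qed

text \<open>A Kummer extension: a q-th root of the primitive root \<open>d\<close> is adjoined to
  the prime field, which contains the q-th roots of unity because q divides p - 1. That this is a
  field is obtained without factoring polynomials, from the Frobenius map, which is diagonal on the
  powers of \<open>X\<close>.\<close>

locale kummer =
  fixes p q d :: nat
  assumes p: "prime p" and q: "prime q" and q_dvd: "q dvd p - 1" and d: "residue_primroot p d"
begin

definition rel :: "int poly" where "rel = monom 1 q - [:int d:]"

definition I :: "int poly set" where "I = {smult (int p) u + rel * v | u v. True}"

lemma ideal_I: "ring_ideal I"
  unfolding ring_ideal_def
proof (intro conjI ballI allI)
  show "0 \<in> I" unfolding I_def by (auto intro!: exI[of _ 0])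
  fix x assume "x \<in> I"
  then obtain u v where x: "x = smult (int p) u + rel * v" by (auto simp: I_def)
  show "x - y \<in> I" if yI: "y \<in> I" for y
  proof -
    obtain u' v' where y: "y = smult (int p) u' + rel * v'" using yI by (auto simp: I_def)
    have "x - y = smult (int p) (u - u') + rel * (v - v')" by (simp add: x y smult_diff_right algebra_simps)
    then show ?thesis unfolding I_def by blast
  qed
  show "r * x \<in> I" for r
  proof -
    have "r * x = smult (int p) (r * u) + rel * (r * v)" by (simp add: x algebra_simps)
    then show ?thesis unfolding I_def by blast
  qed
qed

lemma q_pos: "q > 0" using q by (rule prime_gt_0_nat)

lemma coeff_rel_mult: "coeff (rel * v) n = (if n < q then 0 else coeff v (n - q)) - int d * coeff v n"
  by (simp add: rel_def left_diff_distrib coeff_monom_mult)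

text \<open>As \<open>rel\<close> is monic of degree \<open>q\<close>, the leading coefficient of
  \<open>v\<close> is divisible by \<open>p\<close> whenever \<open>f\<close> has degree below
  \<open>q\<close>; that term can then be moved into \<open>u\<close>, and the bound on the degree
  of \<open>v\<close> drops.\<close>

lemma small_degree_in_I:
  assumes "f \<in> I" "\<And>n. n \<ge> q \<Longrightarrow> coeff f n = 0"
  shows "int p dvd coeff f n"
proof -
  have *: "int p dvd coeff f n" if "f = smult (int p) u + rel * v" "\<And>n. n \<ge> k \<Longrightarrow> coeff v n = 0" for u v k n
    using that
  proof (induction k arbitrary: u v)
    case 0
    then have "v = 0" by (intro poly_eqI) simp
    then show ?case using 0 by simp
  next
    case (Suc k)
    have "0 = coeff f (k + q)" using assms(2) by simp
    also have "\<dots> = int p * coeff u (k + q) + (coeff v k - int d * coeff v (k + q))"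
      unfolding Suc.prems(1) by (simp add: coeff_rel_mult)
    also have "coeff v (k + q) = 0" using Suc.prems(2) q_pos by simp
    finally have "coeff v k = int p * (- coeff u (k + q))" by simp
    then obtain c where c: "coeff v k = int p * c" by blast
    define v' where "v' = v - monom (coeff v k) k"
    have "monom (int p * c) k = smult (int p) (monom c k)" by (simp add: smult_monom)
    then have "f = smult (int p) (u + rel * monom c k) + rel * v'"
      unfolding Suc.prems(1) v'_def c by (simp add: algebra_simps smult_add_right)
    moreover have "coeff v' n = 0" if "n \<ge> k" for n
      using that Suc.prems(2)[of n] by (cases "n = k") (auto simp: v'_def)
    ultimately show ?case by (rule Suc.IH)
  qed
  obtain u v where f: "f = smult (int p) u + rel * v" using assms(1) by (auto simp: I_def)
  show ?thesis by (rule *[OF f, of "Suc (degree v)"]) (simp add: coeff_eq_0)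
qed

abbreviation \<phi> :: "int poly \<Rightarrow> int poly quotients" where "\<phi> \<equiv> factor_emb I"

lemmas \<phi>_add = factor_emb_add[of I] and \<phi>_mult = factor_emb_mult[of I]

lemma \<phi>_eq_iff: "\<phi> f = \<phi> g \<longleftrightarrow> f - g \<in> I"
  by (rule factor_emb_eq_iff[OF ideal_I])

lemma \<phi>_diff: "\<phi> (f - g) = \<phi> f - \<phi> g"
  using \<phi>_add[of "f - g" g] by (simp add: algebra_simps)

lemma \<phi>_sum: "\<phi> (\<Sum>i\<in>A. f i) = (\<Sum>i\<in>A. \<phi> (f i))"
  by (induction A rule: infinite_finite_induct) (simp_all add: \<phi>_add)

lemma smult_in_I: "smult (int p) u \<in> I"
  unfolding I_def by (rule CollectI, rule exI[of _ u], rule exI[of _ 0]) simp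

lemma rel_in_I: "rel * v \<in> I"
  unfolding I_def by (rule CollectI, rule exI[of _ 0], rule exI[of _ v]) simp

definition F :: "int poly quotients set" where "F = range \<phi>"
definition e where "e = \<phi> 1"
definition X where "X = \<phi> (monom 1 1)"

definition reduced :: "int poly set" where
  "reduced = {f. (\<forall>n\<ge>q. coeff f n = 0) \<and> (\<forall>n. coeff f n \<in> {0..<int p})}"

lemma reduced_inj: "inj_on \<phi> reduced"
proof (rule inj_onI, rule poly_eqI)
  fix f g n assume fg: "f \<in> reduced" "g \<in> reduced" "\<phi> f = \<phi> g"
  have "int p dvd coeff (f - g) n"
    by (rule small_degree_in_I) (use fg in \<open>auto simp: reduced_def \<phi>_eq_iff\<close>)
  moreover have "coeff f n \<in> {0..<int p}" "coeff g n \<in> {0..<int p}" using fg by (auto simp: reduced_def)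
  ultimately show "coeff f n = coeff g n"
    by (simp add: mod_eq_dvd_iff[symmetric])
qed

lemma p_pos: "p > 0" using p by (rule prime_gt_0_nat)

lemma small_degree_rep: "\<exists>g. (\<forall>n\<ge>q. coeff g n = 0) \<and> \<phi> f = \<phi> g"
proof (induction f)
  case 0
  show ?case by (rule exI[of _ 0]) simp
next
  case (pCons a f)
  then obtain g where g: "\<And>n. n \<ge> q \<Longrightarrow> coeff g n = 0" "\<phi> f = \<phi> g" by blast
  let ?c = "coeff g (q - 1)"
  let ?h = "pCons a g - smult ?c rel"
  have "coeff ?h n = 0" if "n \<ge> q" for n
  proof (cases "n = q")
    case True
    then show ?thesis using q_pos by (auto simp: rel_def coeff_pCons split: nat.splits)
  next
    case False
    then show ?thesis using that g(1)[of "n - 1"] by (auto simp: rel_def coeff_pCons split: nat.splits)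
  qed
  moreover have "\<phi> (pCons a f) = \<phi> ?h"
  proof -
    have "\<phi> (pCons a f) = \<phi> [:a:] + \<phi> [:0, 1:] * \<phi> f" by (simp flip: \<phi>_add \<phi>_mult)
    also have "\<dots> = \<phi> (pCons a g)" unfolding g(2) by (simp flip: \<phi>_add \<phi>_mult)
    also have "\<dots> = \<phi> ?h" using rel_in_I[of "[:?c:]"] by (simp add: \<phi>_eq_iff)
    finally show ?thesis .
  qed
  ultimately show ?case by blast
qed

lemma reduced_image: "\<phi> ` reduced = F"
proof
  show "F \<subseteq> \<phi> ` reduced"
  proof
    fix y assume "y \<in> F"
    then obtain f where "y = \<phi> f" by (auto simp: F_def)
    then obtain g where g: "\<And>n. n \<ge> q \<Longrightarrow> coeff g n = 0" "y = \<phi> g" using small_degree_rep[of f] by auto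
    let ?h = "map_poly (\<lambda>c. c mod int p) g"
    have h: "coeff ?h n = coeff g n mod int p" for n by (simp add: coeff_map_poly)
    have "g - ?h = smult (int p) (map_poly (\<lambda>c. c div int p) g)"
      by (rule poly_eqI) (simp add: coeff_map_poly minus_mod_eq_mult_div)
    then have "\<phi> g = \<phi> ?h" using smult_in_I by (simp add: \<phi>_eq_iff)
    moreover have "?h \<in> reduced" using g(1) p_pos by (auto simp: reduced_def h)
    ultimately show "y \<in> \<phi> ` reduced" using g(2) by blast
  qed
qed (auto simp: F_def)

lemma card_reduced: "card reduced = p ^ q"
proof -
  let ?S = "{..<q} \<rightarrow>\<^sub>E {0..<int p}"
  have "bij_betw (\<lambda>f. restrict (coeff f) {..<q}) reduced ?S"
  proof (rule bij_betw_byWitness[where f' = "\<lambda>a. \<Sum>i<q. monom (a i) i"])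
    have c: "coeff (\<Sum>i<q. monom (a i) i) n = (if n < q then a n else 0)" for a :: "nat \<Rightarrow> int" and n
      by (simp add: coeff_sum)
    show "\<forall>f\<in>reduced. (\<Sum>i<q. monom (restrict (coeff f) {..<q} i) i) = f"
      by (auto intro!: poly_eqI simp: c reduced_def)
    show "\<forall>a\<in>?S. restrict (coeff (\<Sum>i<q. monom (a i) i)) {..<q} = a"
      by (auto simp: fun_eq_iff c PiE_def extensional_def)
    show "(\<lambda>f. restrict (coeff f) {..<q}) ` reduced \<subseteq> ?S"
    proof (rule image_subsetI)
      fix f assume "f \<in> reduced"
      then show "restrict (coeff f) {..<q} \<in> ?S" by (simp add: restrict_PiE_iff reduced_def)
    qed
    show "(\<lambda>a. \<Sum>i<q. monom (a i) i) ` ?S \<subseteq> reduced"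
      using p_pos by (force simp: reduced_def c PiE_def Pi_def)
  qed
  then have "card reduced = card ?S" by (rule bij_betw_same_card)
  then show ?thesis by (simp add: card_PiE)
qed

lemma card_F: "card F = p ^ q"
  using card_image[OF reduced_inj] card_reduced by (simp add: reduced_image)

lemma finite_F: "finite F"
  using card_F p_pos by (metis card.infinite power_eq_0_iff less_not_refl)

lemma F_add: "x \<in> F \<Longrightarrow> y \<in> F \<Longrightarrow> x + y \<in> F"
  by (auto simp: F_def simp flip: \<phi>_add)

lemma F_mult: "x \<in> F \<Longrightarrow> y \<in> F \<Longrightarrow> x * y \<in> F"
  by (auto simp: F_def simp flip: \<phi>_mult)

lemma F_0: "0 \<in> F"
  using factor_emb_0[of I] unfolding F_def by (metis rangeI)

lemma F_minus: "x \<in> F \<Longrightarrow> - x \<in> F"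
proof -
  assume "x \<in> F"
  then obtain f where "x = \<phi> f" by (auto simp: F_def)
  then have "- x = \<phi> (0 - f)" unfolding \<phi>_diff by simp
  then show ?thesis by (simp only: F_def rangeI)
qed

lemma F_e: "e \<in> F" by (simp add: F_def e_def)

lemma e_mult: "x \<in> F \<Longrightarrow> e * x = x"
  by (auto simp: F_def e_def simp flip: \<phi>_mult)

text \<open>The zeroth power is the unit of the ambient ring and not \<open>e\<close>, which is why
  powers in \<open>F\<close> come with positive exponents from here on.\<close>

lemma e_power: "e ^ n = e" if "n > 0"
  using that by (induction n) (auto simp: e_mult F_e, metis F_e e_mult gr0I mult_1_right power_0)

lemma F_power: "x \<in> F \<Longrightarrow> n > 0 \<Longrightarrow> x ^ n \<in> F"
proof (induction n)
  case (Suc n)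
  then show ?case by (cases "n = 0") (auto simp: F_mult)
qed simp

lemma e_neq_0: "e \<noteq> 0"
proof
  assume "e = 0"
  then have "F \<subseteq> {0}" using e_mult by force
  then have "card F \<le> 1" using card_mono[of "{0::int poly quotients}" F] by simp
  moreover have "p ^ q > 1" using one_less_power[OF prime_gt_1_nat[OF p] q_pos] .
  ultimately show False using card_F by simp
qed

lemma of_nat_mult_\<phi>: "of_nat n * \<phi> f = \<phi> (of_nat n * f)"
  by (induction n) (simp_all add: distrib_right \<phi>_add)

lemma char_F: "x \<in> F \<Longrightarrow> of_nat p * x = 0"
proof -
  assume "x \<in> F"
  then obtain f where "x = \<phi> f" by (auto simp: F_def)
  then have "of_nat p * x = \<phi> (smult (int p) f)" by (simp add: of_nat_mult_\<phi> of_nat_poly)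
  also have "\<dots> = \<phi> 0" unfolding \<phi>_eq_iff using smult_in_I[of f] by simp
  finally show ?thesis by simp
qed

lemma frob_add: "x \<in> F \<Longrightarrow> (x + y) ^ p = x ^ p + y ^ p"
  by (rule freshmans_dream[OF p char_F])

lemma frob_sum: "finite A \<Longrightarrow> (\<And>i. i \<in> A \<Longrightarrow> x i \<in> F) \<Longrightarrow> (\<Sum>i\<in>A. x i) ^ p = (\<Sum>i\<in>A. x i ^ p)"
  by (induction A rule: finite_induct) (simp_all add: frob_add zero_power[OF p_pos])

lemma const_\<phi>: "\<phi> [:a:] = of_nat (nat (a mod int p)) * e"
proof -
  have "a - a mod int p = int p * (a div int p)" by (simp add: minus_mod_eq_mult_div)
  then have "\<phi> [:a:] = \<phi> [:a mod int p:]" using smult_in_I[of "[:a div int p:]"] by (simp add: \<phi>_eq_iff)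
  also have "a mod int p = int (nat (a mod int p))" using p_pos by simp
  also have "\<phi> [:int n:] = of_nat n * e" for n by (simp add: e_def of_nat_mult_\<phi> of_nat_poly)
  finally show ?thesis .
qed

lemma frob_of_nat: "(of_nat n * e) ^ p = of_nat n * e"
proof (induction n)
  case (Suc n)
  have "of_nat n * e \<in> F" by (simp add: e_def of_nat_mult_\<phi> F_def)
  then show ?case using Suc p_pos by (simp add: distrib_right frob_add e_power add.commute[of e])
qed (use p_pos in \<open>simp add: zero_power\<close>)

lemma frob_const: "\<phi> [:a:] ^ p = \<phi> [:a:]"
  unfolding const_\<phi> by (rule frob_of_nat)

definition \<zeta> :: nat where "\<zeta> = d ^ ((p - 1) div q)"

lemma zeta_cong: "[\<zeta> ^ i = 1] (mod p) \<longleftrightarrow> q dvd i"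
proof -
  obtain m where m: "p - 1 = q * m" using q_dvd by (elim dvdE)
  have p1: "p - 1 > 0" using p prime_gt_1_nat by simp
  then have m0: "m > 0" using m by (cases m) auto
  have "ord p d = p - 1" using d p by (simp add: residue_primroot_def totient_prime)
  then have "[\<zeta> ^ i = 1] (mod p) \<longleftrightarrow> q * m dvd m * i"
    using q_pos by (simp add: \<zeta>_def m power_mult[symmetric] ord_divides del: One_nat_def)
  then show ?thesis using m0 by (simp add: mult.commute)
qed

lemma \<phi>_power: "n > 0 \<Longrightarrow> \<phi> (f ^ n) = \<phi> f ^ n"
proof (induction n)
  case (Suc n)
  then show ?case by (cases "n = 0") (simp_all add: \<phi>_mult)
qed simp

lemma X_power_q: "X ^ q = \<phi> [:int d:]"
  using rel_in_I[of 1] q_pos by (simp add: X_def rel_def monom_power \<phi>_eq_iff flip: \<phi>_power)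

text \<open>X^(p-1) is the power of X^q = d with exponent (p-1)/q, that is, the q-th root of unity
  \<zeta>.\<close>

lemma frob_X: "X ^ p = \<phi> [:int \<zeta>:] * X"
proof -
  obtain m where m: "p - 1 = q * m" using q_dvd by (elim dvdE)
  have m0: "m > 0" using m p prime_gt_1_nat[OF p] by (cases m) auto
  have "X ^ p = X ^ (p - 1) * X" using p_pos by (metis Suc_pred' power_Suc2)
  also have "X ^ (p - 1) = (X ^ q) ^ m" by (simp only: m power_mult)
  also have "\<dots> = \<phi> [:int (d ^ m):]"
    unfolding X_power_q using m0 by (simp add: poly_const_pow flip: \<phi>_power)
  also have "d ^ m = \<zeta>" unfolding \<zeta>_def m using q_pos by simp
  finally show ?thesis .
qed

lemma const_eq_iff: "\<phi> [:a:] = \<phi> [:b:] \<longleftrightarrow> int p dvd a - b"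
proof
  assume "\<phi> [:a:] = \<phi> [:b:]"
  then have "[:a - b:] \<in> I" by (simp add: \<phi>_eq_iff)
  then show "int p dvd a - b"
    using small_degree_in_I[of "[:a - b:]" 0] q_pos by (simp add: coeff_pCons split: nat.splits)
next
  assume "int p dvd a - b"
  then obtain c where "a - b = int p * c" by (elim dvdE)
  then show "\<phi> [:a:] = \<phi> [:b:]" using smult_in_I[of "[:c:]"] by (simp add: \<phi>_eq_iff)
qed

lemma frob_iter_X: "X ^ (p ^ k) = \<phi> [:int (\<zeta> ^ k):] * X"
proof (induction k)
  case 0
  then show ?case by (simp add: X_def flip: \<phi>_mult)
next
  case (Suc k)
  have "X ^ (p ^ Suc k) = (X ^ (p ^ k)) ^ p" by (simp add: power_mult[symmetric] mult.commute)
  also have "\<dots> = \<phi> [:int (\<zeta> ^ k):] * (\<phi> [:int \<zeta>:] * X)"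
    unfolding Suc power_mult_distrib frob_const frob_X ..
  also have "\<dots> = \<phi> ([:int (\<zeta> ^ k):] * [:int \<zeta>:]) * X" by (simp only: \<phi>_mult mult.assoc)
  also have "[:int (\<zeta> ^ k):] * [:int \<zeta>:] = [:int (\<zeta> ^ Suc k):]" by (simp add: mult.commute)
  finally show ?case .
qed

lemma frob_iter_add: "x \<in> F \<Longrightarrow> y \<in> F \<Longrightarrow> (x + y) ^ (p ^ k) = x ^ (p ^ k) + y ^ (p ^ k)"
proof (induction k)
  case (Suc k)
  have "(x + y) ^ (p ^ Suc k) = ((x + y) ^ (p ^ k)) ^ p" by (simp add: power_mult[symmetric] mult.commute)
  also have "\<dots> = (x ^ (p ^ k)) ^ p + (y ^ (p ^ k)) ^ p"
    using Suc p_pos by (simp add: frob_add F_power)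
  finally show ?case by (simp add: power_mult[symmetric] mult.commute)
qed simp

text \<open>The q-th iterate of the Frobenius map fixes constants, and it fixes \<open>X\<close>
  because \<zeta>^q = 1; being a ring homomorphism on \<open>F\<close>, it fixes all polynomials in
  \<open>X\<close>.\<close>

lemma power_card: "x \<in> F \<Longrightarrow> x ^ (p ^ q) = x"
proof -
  have "\<phi> f ^ (p ^ q) = \<phi> f" for f
  proof (induction f)
    case 0
    then show ?case using p_pos by (simp add: zero_power)
  next
    case (pCons a f)
    have c: "\<phi> [:a:] ^ (p ^ k) = \<phi> [:a:]" for k
      by (induction k) (simp_all add: power_mult[symmetric] frob_const power_mult)
    have "int p dvd int (\<zeta> ^ q) - 1"
      using zeta_cong[of q] by (metis cong_iff_dvd_diff cong_int_iff dvd_refl of_nat_1)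
    then have "\<phi> [:int (\<zeta> ^ q):] = \<phi> [:1:]" by (simp only: const_eq_iff)
    then have X: "X ^ (p ^ q) = X" unfolding frob_iter_X by (simp add: X_def flip: \<phi>_mult)
    have eq: "\<phi> (pCons a f) = \<phi> [:a:] + X * \<phi> f" by (simp add: X_def monom_altdef flip: \<phi>_add \<phi>_mult)
    have "\<phi> (pCons a f) ^ (p ^ q) = \<phi> [:a:] ^ (p ^ q) + (X * \<phi> f) ^ (p ^ q)"
      unfolding eq by (rule frob_iter_add) (auto simp: F_def X_def simp flip: \<phi>_mult)
    also have "\<dots> = \<phi> (pCons a f)" by (simp only: c power_mult_distrib X pCons.IH eq)
    finally show ?case .
  qed
  then show "x \<in> F \<Longrightarrow> ?thesis" by (auto simp: F_def)
qed

text \<open>The Frobenius map multiplies \<open>X^i\<close> by \<open>\<zeta>^i\<close>, and \<open>\<zeta>\<close> has order \<open>q\<close>.\<close>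
lemma frob_fixed:
  assumes "y \<in> F" "y ^ p = y"
  obtains a where "y = \<phi> [:a:]"
proof -
  obtain f where f: "f \<in> reduced" "y = \<phi> f" using assms(1) reduced_image by (metis imageE)
  have fs: "f = (\<Sum>i<q. monom (coeff f i) i)"
    using f(1) by (intro poly_eqI) (auto simp: coeff_sum reduced_def)
  have m: "\<phi> (monom c i) = \<phi> [:c:] * X ^ i" if "i > 0" for c i
    using that by (simp add: X_def monom_power flip: \<phi>_mult \<phi>_power) (simp add: smult_monom)
  have mp: "\<phi> (monom c i) ^ p = \<phi> (monom (c * int (\<zeta> ^ i)) i)" for c i
  proof (cases "i = 0")
    case True
    then show ?thesis using frob_const by (simp add: monom_0)
  next
    case False
    have "\<phi> (monom c i) ^ p = \<phi> [:c:] ^ p * (X ^ i) ^ p"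
      using False by (simp only: m power_mult_distrib neq0_conv)
    also have "(X ^ i) ^ p = (X ^ p) ^ i" by (simp only: power_mult[symmetric] mult.commute)
    finally have "\<phi> (monom c i) ^ p = \<phi> [:c:] * (\<phi> [:int \<zeta>:] * X) ^ i" by (simp only: frob_const frob_X)
    also have "\<phi> [:c:] * (\<phi> [:int \<zeta>:] * X) ^ i = \<phi> [:c * int (\<zeta> ^ i):] * X ^ i"
      using False by (simp add: power_mult_distrib mult.assoc[symmetric] poly_const_pow flip: \<phi>_mult \<phi>_power)
        (simp only: mult.commute)
    finally show ?thesis using False by (simp add: m)
  qed
  have "y ^ p = (\<Sum>i<q. \<phi> (monom (coeff f i) i) ^ p)"
    unfolding f(2) by (subst fs, subst \<phi>_sum, rule frob_sum) (auto simp: F_def)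
  also have "\<dots> = \<phi> (\<Sum>i<q. monom (coeff f i * int (\<zeta> ^ i)) i)"
    by (simp only: mp \<phi>_sum)
  finally have "\<phi> (\<Sum>i<q. monom (coeff f i * int (\<zeta> ^ i)) i) = \<phi> f" using assms f by simp
  then have inI: "(\<Sum>i<q. monom (coeff f i * int (\<zeta> ^ i)) i) - f \<in> I" by (simp only: \<phi>_eq_iff)
  have "coeff f i = 0" if i: "0 < i" for i
  proof (cases "i < q")
    case True
    have "int p dvd coeff ((\<Sum>i<q. monom (coeff f i * int (\<zeta> ^ i)) i) - f) i"
      by (rule small_degree_in_I[OF inI]) (use f(1) in \<open>auto simp: coeff_sum reduced_def\<close>)
    then have "int p dvd coeff f i * (int (\<zeta> ^ i) - 1)" using True by (simp add: coeff_sum algebra_simps)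
    moreover have "\<not> int p dvd int (\<zeta> ^ i) - 1"
    proof
      assume "int p dvd int (\<zeta> ^ i) - 1"
      then have "[\<zeta> ^ i = 1] (mod p)" by (metis cong_iff_dvd_diff cong_int_iff of_nat_1)
      then have "q dvd i" by (simp only: zeta_cong)
      then show False using True i by (auto dest: dvd_imp_le)
    qed
    ultimately have "int p dvd coeff f i" using p by (simp add: prime_dvd_mult_iff)
    moreover have "0 \<le> coeff f i" "coeff f i < int p" using f(1) by (auto simp: reduced_def)
    ultimately show ?thesis by (metis zdvd_imp_le not_le le_less)
  qed (use f(1) in \<open>simp add: reduced_def\<close>)
  then have "f = [:coeff f 0:]" by (intro poly_eqI) (auto simp: coeff_pCons split: nat.splits)
  then show ?thesis using that f(2) by metis
qed

text \<open>\<open>y^(p^q - 1)\<close> is idempotent, hence fixed by the Frobenius map, hence \<open>0\<close> or \<open>e\<close>.\<close>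
lemma power_card_minus_1:
  assumes y: "y \<in> F" "y \<noteq> 0"
  shows "y ^ (p ^ q - 1) = e"
proof -
  let ?N = "p ^ q - 1" and ?u = "y ^ (p ^ q - 1)"
  have "2 ^ 1 \<le> p ^ q" using p q_pos prime_ge_2_nat by (metis One_nat_def Suc_leI power_increasing power_mono le_trans one_le_numeral zero_le)
  then have N: "?N > 0" "Suc ?N = p ^ q" by auto
  have u: "?u \<in> F" by (rule F_power[OF y(1) N(1)])
  have uy: "?u * y = y" using power_card[OF y(1)] by (metis N(2) power_Suc2)
  have uu: "?u * ?u = ?u"
  proof -
    have "?u * y ^ k = y ^ k" if "k > 0" for k
      using that uy by (cases k) (simp_all add: mult.assoc[symmetric])
    then show ?thesis using N(1) by blast
  qed
  have "?u ^ k = ?u" if "k > 0" for k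
    using that
  proof (induction k)
    case (Suc k)
    then show ?case using uu by (cases "k = 0") simp_all
  qed simp
  then have "?u ^ p = ?u" using p_pos by blast
  then obtain a where a: "?u = \<phi> [:a:]" using frob_fixed[OF u] by blast
  have "\<phi> [:a * a:] = \<phi> [:a:]" using uu unfolding a by (simp flip: \<phi>_mult)
  then have "int p dvd a * (a - 1)" by (simp add: const_eq_iff algebra_simps)
  then have "int p dvd a \<or> int p dvd a - 1" using p by (simp add: prime_dvd_mult_iff)
  then show ?thesis
  proof
    assume "int p dvd a"
    then have "\<phi> [:a:] = \<phi> [:0:]" by (simp only: const_eq_iff) simp
    then have "y = 0" using uy a by simp
    then show ?thesis using y by simp
  next
    assume "int p dvd a - 1"
    then have "\<phi> [:a:] = \<phi> [:1:]" by (simp only: const_eq_iff)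
    then show ?thesis using a by (simp add: e_def one_pCons)
  qed
qed

text \<open>The constant coefficient is a nonzero linear form over the prime field, which serves
  here in place of the trace.\<close>

definition \<epsilon> :: "int poly quotients \<Rightarrow> complex" where
  "\<epsilon> y = cis (2 * pi * of_int (coeff (inv_into reduced \<phi> y) 0) / of_nat p)"

lemma cis_cong:
  assumes "int p dvd a - b"
  shows "cis (2 * pi * of_int a / of_nat p) = cis (2 * pi * of_int b / of_nat p)"
proof -
  obtain c where "a - b = int p * c" using assms by (elim dvdE)
  then have a: "a = b + int p * c" by simp
  have "2 * pi * of_int a / of_nat p = 2 * pi * of_int b / of_nat p + 2 * pi * of_int c"
    using p_pos by (simp add: a field_simps)
  then show ?thesis by (simp add: cis_mult[symmetric] cis_multiple_2pi)
qed

lemma \<epsilon>_add: "x \<in> F \<Longrightarrow> y \<in> F \<Longrightarrow> \<epsilon> (x + y) = \<epsilon> x * \<epsilon> y"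
proof -
  assume xy: "x \<in> F" "y \<in> F"
  let ?r = "inv_into reduced \<phi>"
  have r: "?r z \<in> reduced" "\<phi> (?r z) = z" if "z \<in> F" for z
    using that by (simp_all add: inv_into_into f_inv_into_f flip: reduced_image)
  let ?f = "?r (x + y) - (?r x + ?r y)"
  have "?f \<in> I" using r F_add xy by (simp flip: \<phi>_eq_iff add: \<phi>_add)
  then have "int p dvd coeff ?f 0"
    by (rule small_degree_in_I) (use r(1) F_add xy in \<open>simp add: reduced_def\<close>)
  then have "\<epsilon> (x + y) = cis (2 * pi * of_int (coeff (?r x) 0 + coeff (?r y) 0) / of_nat p)"
    unfolding \<epsilon>_def by (intro cis_cong) simp
  also have "\<dots> = \<epsilon> x * \<epsilon> y" by (simp add: \<epsilon>_def cis_mult distrib_left add_divide_distrib)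
  finally show ?thesis .
qed

lemma \<epsilon>_\<phi>: "f \<in> reduced \<Longrightarrow> \<epsilon> (\<phi> f) = cis (2 * pi * of_int (coeff f 0) / of_nat p)"
  by (simp add: \<epsilon>_def inv_into_f_f[OF reduced_inj])

lemma \<epsilon>_0: "\<epsilon> 0 = 1"
  using \<epsilon>_\<phi>[of 0] p_pos by (simp add: reduced_def)

lemma \<epsilon>_e: "\<epsilon> e \<noteq> 1"
proof -
  have p1: "p > 1" using p by (rule prime_gt_1_nat)
  have "1 \<in> reduced" using p1 q_pos by (auto simp: reduced_def)
  then have "\<epsilon> e = cis (2 * pi * real 1 / real p)" using \<epsilon>_\<phi>[of 1] by (simp add: e_def)
  moreover have "cis (2 * pi * real 1 / real p) \<noteq> cis (2 * pi * real 0 / real p)"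
  proof
    assume "cis (2 * pi * real 1 / real p) = cis (2 * pi * real 0 / real p)"
    then have "(1::nat) = 0"
      by (rule inj_onD[OF bij_betw_imp_inj_on[OF bij_betw_roots_unity[OF p_pos]]]) (use p1 in auto)
    then show False by simp
  qed
  ultimately show ?thesis by simp
qed

end

section \<open>The operator group\<close>

lemma cong_1_iff_dvd_nat: "(x::nat) \<ge> 1 \<Longrightarrow> [x = 1] (mod n) \<longleftrightarrow> n dvd x - 1"
  by (rule cong_altdef_nat)

text \<open>In the application \<open>m\<close> is the \<open>q'\<close>-part of \<open>(p^q - 1)/(p - 1)\<close> and \<open>Q\<close> the \<open>q\<close>-part of
  \<open>p - 1\<close>. With \<open>\<omega>\<close> a generator of the multiplicative group, the pair \<open>(u, v)\<close> in \<open>H\<close> encodes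
  the map \<open>x \<mapsto> c x^(p^u)\<close> with \<open>c = \<omega>^(r t u)\<close> of order dividing \<open>M q\<close>, together with the
  \<open>r\<close>-th root of unity \<open>s = \<omega>^(t M q v)\<close>. In particular \<open>c\<close> determines the power of the
  Frobenius map.\<close>
locale heis_params =
  fixes p q r M t m Q :: nat
  assumes p: "prime p" and q: "prime q" and q_odd: "odd q" and q_dvd: "q dvd p - 1" and r_dvd: "r dvd p - 1"
    and N_eq: "p ^ q - 1 = M * q * (r * t)" and M_eq: "M = m * Q" and Q_dvd: "q dvd Q"
    and N_dvd: "p ^ q - 1 dvd M * (p - 1)" and M_odd: "odd M" and r_coprime: "coprime r (M * q)"
    and m_gt_1: "m > 1" and m_coprime: "coprime m (p - 1)"
begin

definition "N = p ^ q - 1"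

lemma p_gt_1: "p > 1" using p by (rule prime_gt_1_nat)
lemma q_gt_1: "q > 1" using q by (rule prime_gt_1_nat)

lemma N_pos: "N > 0"
  unfolding N_def using one_less_power[OF p_gt_1, of q] q_gt_1 by simp

lemma N_eq': "N = M * q * (r * t)" unfolding N_def by (rule N_eq)

lemma pos: "M > 0" "r > 0" "t > 0" "q > 0" "p > 0" "M * q > 0"
  using N_pos N_eq' q_gt_1 p_gt_1 by (auto intro: Nat.gr0I)

lemma p_cong_q: "[p ^ u = 1] (mod q)"
proof -
  have "[p = 1] (mod q)" using q_dvd p_gt_1 cong_1_iff_dvd_nat[of p q] by linarith
  then have "[p ^ u = 1 ^ u] (mod q)" by (rule cong_pow)
  then show ?thesis by simp
qed

lemma p_cong_r: "[p ^ u = 1] (mod r)"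
proof -
  have "[p = 1] (mod r)" using r_dvd p_gt_1 cong_1_iff_dvd_nat[of p r] by linarith
  then have "[p ^ u = 1 ^ u] (mod r)" by (rule cong_pow)
  then show ?thesis by simp
qed

text \<open>Frobenius has order \<open>q\<close> on the field, so the same exponent \<open>u\<close>
  can be read modulo M q in the coefficient and modulo q in the Frobenius power.\<close>

lemma p_power_cong:
  assumes "[u = w] (mod q)" shows "[p ^ u = p ^ w] (mod N)"
proof -
  have 1: "[p ^ q = 1] (mod N)"
    unfolding N_def by (rule iffD2[OF cong_1_iff_dvd_nat]) (use pos in simp_all)
  have "[p ^ x = p ^ (x mod q)] (mod N)" for x
  proof -
    have "p ^ x = (p ^ q) ^ (x div q) * p ^ (x mod q)" by (simp flip: power_mult power_add)
    also have "[\<dots> = 1 ^ (x div q) * p ^ (x mod q)] (mod N)" by (intro cong_mult cong_pow 1 cong_refl)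
    finally show ?thesis by simp
  qed
  then have "[p ^ u = p ^ (w mod q)] (mod N)" using assms by (metis cong_def)
  then show ?thesis using \<open>\<And>x. [p ^ x = p ^ (x mod q)] (mod N)\<close> cong_sym cong_trans by blast
qed

lemma n_dvd_N: "M * q dvd N" by (simp add: N_eq')

lemma p_power_cong': "[u = w] (mod q) \<Longrightarrow> [p ^ u = p ^ w] (mod (M * q))"
  using p_power_cong n_dvd_N by (rule cong_dvd_modulus_nat)

text \<open>The first component is composition: with \<eta> = \<omega>^(r t), following x ->
  \<eta>^u' x^(p^u') by x -> \<eta>^u x^(p^u) has coefficient exponent u + p^u u' and Frobenius
  exponent u + u', and these agree modulo q.\<close>

definition H :: "(nat \<times> nat) monoid" where
  "H = \<lparr>carrier = {..<M * q} \<times> {..<r},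
    monoid.mult = (\<lambda>(u, v) (u', v'). ((u + p ^ u * u') mod (M * q), (v + v') mod r)),
    one = (0, 0)\<rparr>"

abbreviation H_mult (infixl "\<star>" 70) where "x \<star> y \<equiv> x \<otimes>\<^bsub>H\<^esub> y"
abbreviation H_inv ("inv\<^sub>H _" [81] 80) where "inv\<^sub>H x \<equiv> inv\<^bsub>H\<^esub> x"
abbreviation H_one ("\<one>\<^sub>H") where "\<one>\<^sub>H \<equiv> \<one>\<^bsub>H\<^esub>"

lemma carrier_H [simp]: "(u, v) \<in> carrier H \<longleftrightarrow> u < M * q \<and> v < r"
  by (simp add: H_def)

lemma mult_H [simp]: "(u, v) \<star> (u', v') = ((u + p ^ u * u') mod (M * q), (v + v') mod r)"
  by (simp add: H_def)

lemma one_H [simp]: "\<one>\<^sub>H = (0, 0)"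
  by (simp add: H_def)

lemma order_H: "order H = M * q * r"
  by (simp add: Coset.order_def H_def card_cartesian_product)

lemma finite_H: "finite (carrier H)"
  by (simp add: H_def)

lemma cong_mod_q: "[x mod (M * q) = x] (mod q)"
  by (rule cong_dvd_modulus_nat[of _ _ "M * q"]) (simp_all add: cong_def)

lemma mult_cong_q: "[(u + p ^ u * u') mod (M * q) = u + u'] (mod q)"
proof -
  have "[u + p ^ u * u' = u + 1 * u'] (mod q)" by (intro cong_add cong_mult p_cong_q cong_refl)
  then show ?thesis using cong_mod_q cong_trans by fastforce
qed

lemma group_H: "group H"
proof (rule groupI)
  fix x y assume "x \<in> carrier H" "y \<in> carrier H"
  then show "x \<star> y \<in> carrier H"
    using pos by (cases x; cases y) simp
next
  fix x y z assume "x \<in> carrier H" "y \<in> carrier H" "z \<in> carrier H"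
  obtain a b c a' b' c' where x: "x = (a, a')" "y = (b, b')" "z = (c, c')" by (metis surj_pair)
  let ?n = "M * q"
  let ?w = "(a + p ^ a * b) mod ?n"
  have "[?w + p ^ ?w * c = (a + p ^ a * b) + p ^ (a + b) * c] (mod ?n)"
    by (intro cong_add cong_mult p_power_cong' mult_cong_q cong_refl) (simp add: cong_def)
  also have "(a + p ^ a * b) + p ^ (a + b) * c = a + p ^ a * (b + p ^ b * c)"
    by (simp add: algebra_simps power_add)
  also have "[\<dots> = a + p ^ a * ((b + p ^ b * c) mod ?n)] (mod ?n)"
    by (intro cong_add cong_mult cong_refl) (simp add: cong_def)
  finally show "x \<star> y \<star> z = x \<star> (y \<star> z)"
    unfolding x by (simp add: cong_def mod_simps add.assoc)
next
  fix x assume x: "x \<in> carrier H"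
  then show "\<one>\<^sub>H \<star> x = x" by (cases x) simp
  obtain u v where u: "x = (u, v)" "u < M * q" "v < r" using x by (cases x) simp
  \<comment> \<open>An inverse of p^u modulo M q. The first component of the inverse of
    \<open>x\<close> is congruent to (q - 1) u modulo q, so \<open>?c\<close> is also the power of
    \<open>p\<close> by which that inverse acts.\<close>
  let ?c = "p ^ ((q - 1) * u)"
  let ?u = "(M * q - u) * ?c mod (M * q)" and ?v = "(r - v) mod r"
  have "[?u = (M * q - u) * 1] (mod q)"
    by (rule cong_trans[OF cong_mod_q]) (intro cong_mult p_cong_q cong_refl)
  also have "[(M * q - u) * 1 = (q - 1) * u] (mod q)"
  proof -
    have "[(M * q - u) + u = (q - 1) * u + u] (mod q)"
    proof -
      have "(M * q - u) + u = M * q" using u by simp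
      moreover have "(q - 1) * u + u = q * u" using q_gt_1 by (cases q) simp_all
      ultimately show ?thesis by (simp add: cong_def)
    qed
    then show ?thesis by (simp only: cong_add_rcancel_nat mult_1_right)
  qed
  finally have "[?u + p ^ ?u * u = (M * q - u) * ?c + ?c * u] (mod (M * q))"
    by (intro cong_add cong_mult p_power_cong' cong_refl) (simp_all add: cong_def)
  also have "(M * q - u) * ?c + ?c * u = (M * q) * ?c"
    using u(2) by (simp add: diff_mult_distrib mult.commute)
  finally have "(?u + p ^ ?u * u) mod (M * q) = 0" by (simp add: cong_def)
  moreover have "(?v + v) mod r = 0" using u by (simp add: mod_simps)
  ultimately have "(?u, ?v) \<star> x = \<one>\<^sub>H" unfolding u(1) by simp
  then show "\<exists>y\<in>carrier H. y \<star> x = \<one>\<^sub>H"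
    using pos by (intro bexI[of _ "(?u, ?v)"]) simp_all
qed (use pos in simp)

sublocale H: group H by (rule group_H)

text \<open>Reduction of the first component modulo q is thus a homomorphism; its kernel is
  \<open>B\<close>, the part of \<open>H\<close> that acts without Frobenius.\<close>

lemma fst_mult: "[fst (x \<star> y) = fst x + fst y] (mod q)"
  using mult_cong_q by (cases x; cases y) simp

lemma fst_inv: "x \<in> carrier H \<Longrightarrow> [fst (inv\<^sub>H x) + fst x = 0] (mod q)"
  using fst_mult[of "inv\<^sub>H x" x] by (simp add: cong_sym_eq)

lemma fst_pow: "[fst (x [^]\<^bsub>H\<^esub> k) = k * fst x] (mod q)" for k :: nat
proof (induction k)
  case (Suc k)
  have "[fst (x [^]\<^bsub>H\<^esub> k \<star> x) = fst (x [^]\<^bsub>H\<^esub> k) + fst x] (mod q)" by (rule fst_mult)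
  also have "[fst (x [^]\<^bsub>H\<^esub> k) + fst x = k * fst x + fst x] (mod q)" by (intro cong_add Suc cong_refl)
  finally show ?case by (simp add: add.commute)
qed simp

text \<open>\<open>B\<close> collects the multiplications by scalars, and \<open>C\<close> is the
  subgroup of order m of the first factor, on which conjugation acts through powers of p.\<close>

definition "R = {0} \<times> {..<r}"
definition "B = {x \<in> carrier H. q dvd fst x}"
definition "C = {x \<in> carrier H. Q * q dvd fst x \<and> snd x = 0}"

lemma R_subgroup: "subgroup R H"
proof (rule H.subgroupI)
  show "R \<subseteq> carrier H" using pos by (auto simp: R_def)
  show "R \<noteq> {}" using pos by (auto simp: R_def)
  show "x \<star> y \<in> R" if "x \<in> R" "y \<in> R" for x y using that pos by (auto simp: R_def)
  show "inv\<^sub>H x \<in> R" if x: "x \<in> R" for x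
  proof -
    obtain v where v: "x = (0, v)" "v < r" using x by (auto simp: R_def)
    have "inv\<^sub>H x = (0, (r - v) mod r)"
      by (rule H.inv_equality) (use v pos in \<open>simp_all add: mod_simps\<close>)
    then show ?thesis using pos by (simp add: R_def)
  qed
qed

lemma R_comm: "x \<in> R \<Longrightarrow> y \<in> R \<Longrightarrow> x \<star> y = y \<star> x"
  by (auto simp: R_def add.commute)

lemma card_R: "card R = r"
  by (simp add: R_def card_cartesian_product)

lemma in_B_iff: "x \<in> B \<longleftrightarrow> x \<in> carrier H \<and> [fst x = 0] (mod q)"
  by (simp add: B_def cong_0_iff)

lemma B_normal: "B \<lhd> H"
proof (rule H.normal_invI)
  show "subgroup B H"
  proof (rule H.subgroupI)
    show "B \<subseteq> carrier H" by (auto simp: B_def)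
    show "B \<noteq> {}" using H.one_closed by (force simp: B_def)
    show "x \<star> y \<in> B" if "x \<in> B" "y \<in> B" for x y
      using that fst_mult[of x y] cong_add[of "fst x" 0 q "fst y" 0] cong_trans by (fastforce simp: in_B_iff)
    show "inv\<^sub>H x \<in> B" if "x \<in> B" for x
      using that fst_inv[of x] by (auto simp: B_def cong_0_iff dvd_add_left_iff)
  qed
  show "g \<star> x \<star> inv\<^sub>H g \<in> B" if g: "g \<in> carrier H" and x: "x \<in> B" for x g
  proof -
    have xH: "x \<in> carrier H" using x by (simp add: B_def)
    have "[fst (g \<star> x \<star> inv\<^sub>H g) = fst (g \<star> x) + fst (inv\<^sub>H g)] (mod q)" by (rule fst_mult)
    also have "[fst (g \<star> x) + fst (inv\<^sub>H g) = (fst g + 0) + fst (inv\<^sub>H g)] (mod q)"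
      by (intro cong_add cong_refl cong_trans[OF fst_mult]) (use x in \<open>simp_all add: in_B_iff\<close>)
    also have "[(fst g + 0) + fst (inv\<^sub>H g) = 0] (mod q)" using fst_inv[OF g] by (simp add: add.commute)
    finally show ?thesis using g xH by (simp add: in_B_iff)
  qed
qed

lemma comm_H:
  assumes h: "h \<in> carrier H" and k: "k \<in> carrier H"
  shows "h \<star> k \<star> inv\<^sub>H h \<star> inv\<^sub>H k \<in> B"
proof -
  have "[fst (h \<star> k \<star> inv\<^sub>H h \<star> inv\<^sub>H k) = fst h + fst k + fst (inv\<^sub>H h) + fst (inv\<^sub>H k)] (mod q)"
    by (rule cong_trans[OF fst_mult], rule cong_add[OF cong_trans[OF fst_mult cong_add[OF fst_mult cong_refl]] cong_refl])
  also have "fst h + fst k + fst (inv\<^sub>H h) + fst (inv\<^sub>H k) = (fst (inv\<^sub>H h) + fst h) + (fst (inv\<^sub>H k) + fst k)" by simp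
  also have "[\<dots> = 0 + 0] (mod q)" by (intro cong_add fst_inv h k)
  finally show ?thesis using h k by (simp add: in_B_iff)
qed

lemma B_mult:
  assumes "(u, v) \<in> B" shows "(u, v) \<star> (u', v') = ((u + u') mod (M * q), (v + v') mod r)"
proof -
  have "[u = 0] (mod q)" using assms by (simp add: in_B_iff)
  then have "[u + p ^ u * u' = u + p ^ 0 * u'] (mod (M * q))"
    by (intro cong_add cong_mult p_power_cong' cong_refl)
  then show ?thesis by (simp add: cong_def)
qed

lemma B_comm: "x \<in> B \<Longrightarrow> y \<in> B \<Longrightarrow> x \<star> y = y \<star> x"
  by (cases x; cases y) (simp add: B_mult add.commute del: mult_H)

lemma card_B: "q * card B = order H"
proof -
  have "B = (\<lambda>i. q * i) ` {..<M} \<times> {..<r}"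
  proof (intro equalityI subsetI)
    fix x assume "x \<in> B"
    then obtain i where "fst x = q * i" "fst x < M * q" "snd x < r" by (cases x) (auto simp: B_def)
    then show "x \<in> (\<lambda>i. q * i) ` {..<M} \<times> {..<r}" by (cases x) (auto simp: mult.commute)
  qed (use pos in \<open>auto simp: B_def mult.commute\<close>)
  moreover have "inj_on (\<lambda>i. q * i) {..<M}" using pos by (auto intro: inj_onI)
  ultimately have "card B = M * r" by (simp add: card_cartesian_product card_image)
  then show ?thesis by (simp add: order_H)
qed

lemma B_cyclic:
  assumes h: "h \<in> carrier H" "h \<notin> B" and g: "g \<in> carrier H"
  shows "\<exists>k::nat. g \<star> inv\<^sub>H (h [^]\<^bsub>H\<^esub> k) \<in> B"
proof -
  have "\<not> q dvd fst h" using h by (simp add: B_def)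
  then have "coprime (fst h) q" using q by (metis coprime_commute prime_imp_coprime)
  then obtain l where "[fst h * l = 1] (mod q)" using cong_solve_coprime_nat by (metis One_nat_def)
  then have l: "[fst h * l * fst g = 1 * fst g] (mod q)" by (rule cong_mult) simp
  let ?k = "l * fst g"
  have "[fst (h [^]\<^bsub>H\<^esub> ?k) = ?k * fst h] (mod q)" by (rule fst_pow)
  also have "?k * fst h = fst h * l * fst g" by (simp add: mult_ac)
  also have "[\<dots> = fst g] (mod q)" using l by simp
  finally have hk: "[fst (h [^]\<^bsub>H\<^esub> ?k) = fst g] (mod q)" .
  have "[fst (g \<star> inv\<^sub>H (h [^]\<^bsub>H\<^esub> ?k)) = fst g + fst (inv\<^sub>H (h [^]\<^bsub>H\<^esub> ?k))] (mod q)" by (rule fst_mult)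
  also have "[fst g + fst (inv\<^sub>H (h [^]\<^bsub>H\<^esub> ?k)) = fst (h [^]\<^bsub>H\<^esub> ?k) + fst (inv\<^sub>H (h [^]\<^bsub>H\<^esub> ?k))] (mod q)"
    by (intro cong_add cong_refl) (use hk in \<open>simp add: cong_sym_eq\<close>)
  also have "[fst (h [^]\<^bsub>H\<^esub> ?k) + fst (inv\<^sub>H (h [^]\<^bsub>H\<^esub> ?k)) = 0] (mod q)"
    using fst_inv[of "h [^]\<^bsub>H\<^esub> ?k"] h(1) by (simp add: add.commute)
  finally show ?thesis using h(1) g by (intro exI[of _ ?k]) (simp add: in_B_iff)
qed

text \<open>On \<open>B\<close> the quotient by q is a residue modulo M, and \<psi> is faithful on
  it while trivial on \<open>R\<close>.\<close>

definition \<psi> :: "nat \<times> nat \<Rightarrow> complex" where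
  "\<psi> x = cis (2 * pi * of_nat (fst x div q) / of_nat M)"

lemma cis_cong_M:
  assumes "[a = b] (mod M)"
  shows "cis (2 * pi * of_nat a / of_nat M) = cis (2 * pi * of_nat b / of_nat M)"
proof -
  have red: "cis (2 * pi * of_nat a / of_nat M) = cis (2 * pi * of_nat (a mod M) / of_nat M)" for a
  proof -
    have "real a = real (M * (a div M) + a mod M)" by simp
    then have "2 * pi * of_nat a / of_nat M = 2 * pi * of_nat (a mod M) / of_nat M + 2 * pi * of_nat (a div M)"
      using pos by (simp only: of_nat_add of_nat_mult) (simp add: field_simps)
    then show ?thesis by (simp add: cis_mult[symmetric] cis_multiple_2pi)
  qed
  show ?thesis using red[of a] red[of b] assms by (simp add: cong_def)
qed

lemma cis_inj_M:
  assumes "cis (2 * pi * of_nat a / of_nat M) = cis (2 * pi * of_nat b / of_nat M)"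
  shows "[a = b] (mod M)"
proof -
  have "cis (2 * pi * of_nat (a mod M) / of_nat M) = cis (2 * pi * of_nat (b mod M) / of_nat M)"
    using assms cis_cong_M[of "a mod M" a] cis_cong_M[of "b mod M" b] by (simp add: cong_def)
  then have "a mod M = b mod M"
    by (rule inj_onD[OF bij_betw_imp_inj_on[OF bij_betw_roots_unity[OF pos(1)]]]) (use pos in auto)
  then show ?thesis by (simp add: cong_def)
qed

lemma \<psi>_mult:
  assumes "x \<in> B" "y \<in> B" shows "\<psi> (x \<star> y) = \<psi> x * \<psi> y"
proof -
  obtain i v j v' where x: "x = (q * i, v)" and y: "y = (q * j, v')"
    using assms by (cases x; cases y) (auto simp: B_def elim!: dvdE)
  have "fst (x \<star> y) = (q * i + q * j) mod (q * M)" using assms unfolding x y by (simp add: B_mult mult.commute del: mult_H)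
  also have "\<dots> = q * ((i + j) mod M)" by (simp add: mult_mod_right distrib_left)
  finally have "\<psi> (x \<star> y) = cis (2 * pi * of_nat ((i + j) mod M) / of_nat M)" using pos by (simp add: \<psi>_def)
  also have "\<dots> = cis (2 * pi * of_nat (i + j) / of_nat M)" by (rule cis_cong_M) (simp add: cong_def)
  also have "\<dots> = \<psi> x * \<psi> y" using pos by (simp add: \<psi>_def x y cis_mult distrib_left add_divide_distrib)
  finally show ?thesis .
qed

text \<open>The order of p modulo m divides the prime q; it is not 1, since m > 1 is coprime to p -
  1.\<close>

lemma m_not_dvd: "\<not> q dvd u \<Longrightarrow> \<not> [p ^ u = 1] (mod M)"
proof
  assume u: "\<not> q dvd u" and "[p ^ u = 1] (mod M)"
  then have "[p ^ u = 1] (mod m)" using M_eq by (metis cong_dvd_modulus_nat dvd_triv_left)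
  then have o1: "ord m p dvd u" by (simp only: ord_divides)
  have "[p ^ q = 1] (mod N)" unfolding N_def by (rule iffD2[OF cong_1_iff_dvd_nat]) (use pos in simp_all)
  moreover have "m dvd N" by (simp add: N_eq' M_eq)
  ultimately have "[p ^ q = 1] (mod m)" by (rule cong_dvd_modulus_nat)
  then have o2: "ord m p dvd q" by (simp only: ord_divides)
  have "ord m p = 1 \<or> ord m p = q" using o2 q by (simp add: prime_nat_iff)
  then have "ord m p dvd 1" using o1 u by auto
  then have "[p ^ 1 = 1] (mod m)" by (simp only: ord_divides)
  then have "m dvd p - 1" using p_gt_1 cong_1_iff_dvd_nat[of p m] by simp
  then show False using coprime_common_divisor[OF m_coprime dvd_refl] m_gt_1 by simp
qed

lemma M_gt_1: "M > 1"
  using m_gt_1 pos M_eq by (metis One_nat_def dvd_imp_le dvd_triv_left less_le_trans)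

text \<open>Conjugation by \<open>(u, v)\<close> multiplies first components in \<open>B\<close> by
  p^u. The element \<open>(q, 0)\<close> detects this, since \<psi> sends it to a primitive M-th
  root of unity.\<close>

lemma \<psi>_moved:
  assumes h: "h \<in> carrier H" "h \<notin> B"
  shows "\<exists>b\<in>B. \<psi> (h \<star> b \<star> inv\<^sub>H h) \<noteq> \<psi> b"
proof
  obtain u v where u: "h = (u, v)" "u < M * q" "v < r" using h by (cases h) simp
  have qM: "q < M * q" using M_gt_1 pos by simp
  show b: "(q, 0) \<in> B" using qM pos by (simp add: B_def)
  define w where "w = p ^ u * q mod (M * q)"
  have wB: "(w, 0) \<in> B" using pos by (simp add: w_def B_def dvd_mod_iff)
  then have wH: "(w, 0) \<in> carrier H" by (simp add: B_def)
  have conj: "h \<star> (q, 0) \<star> inv\<^sub>H h = (w, 0)"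
  proof -
    have "(w, 0) \<star> h = h \<star> (q, 0)" unfolding u B_mult[OF wB] unfolding mult_H w_def mod_add_left_eq by (simp add: add.commute)
    then have "h \<star> (q, 0) \<star> inv\<^sub>H h = (w, 0) \<star> h \<star> inv\<^sub>H h" by simp
    also have "\<dots> = (w, 0)" by (simp only: H.m_assoc[OF wH h(1) H.inv_closed[OF h(1)]] H.r_inv[OF h(1)] H.r_one[OF wH])
    finally show ?thesis .
  qed
  have "w = q * (p ^ u mod M)" by (simp add: w_def)
  then have w2: "w div q = p ^ u mod M" using pos by simp
  have 1: "\<psi> (h \<star> (q, 0) \<star> inv\<^sub>H h) = cis (2 * pi * of_nat (p ^ u mod M) / of_nat M)"
    unfolding conj \<psi>_def fst_conv w2 ..
  have 2: "\<psi> (q, 0) = cis (2 * pi * of_nat 1 / of_nat M)" using pos by (simp add: \<psi>_def)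
  have "\<not> q dvd u" using h u by (simp add: B_def)
  then have "\<not> [p ^ u mod M = 1] (mod M)" using m_not_dvd by (simp add: cong_def)
  then show "\<psi> (h \<star> (q, 0) \<star> inv\<^sub>H h) \<noteq> \<psi> (q, 0)" unfolding 1 2 using cis_inj_M by blast
qed

text \<open>The commutator of \<open>(d, 0)\<close> with \<open>(1, 0)\<close> has first component
  (1 - p) d, and p - 1 is invertible modulo m, the order of \<open>C\<close>.\<close>

lemma C_comm:
  assumes c: "c \<in> C"
  shows "\<exists>d\<in>C. \<exists>k\<in>carrier H. d \<star> k \<star> inv\<^sub>H d \<star> inv\<^sub>H k = c"
proof -
  have "Q * q dvd fst c" using c by (simp add: C_def)
  then obtain w where "fst c = Q * q * w" by (elim dvdE)
  then have w: "c = (Q * q * w, 0)" "Q * q * w < M * q" using c by (cases c, simp add: C_def)+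
  obtain y where y: "[(p - 1) * y = 1] (mod m)" using cong_solve_coprime_nat m_coprime by (metis coprime_commute One_nat_def)
  \<comment> \<open>With \<open>y\<close> inverse to p - 1 and m - 1 standing for -1, this solves (1
    - p) x = w modulo m in natural numbers.\<close>
  define x where "x = (m - 1) * y * w"
  have "[(p - 1) * x + w = 0] (mod m)"
  proof -
    have "[(p - 1) * y * ((m - 1) * w) + w = 1 * ((m - 1) * w) + w] (mod m)"
      by (intro cong_add cong_mult y cong_refl)
    also have "1 * ((m - 1) * w) + w = m * w" using m_gt_1 by (cases m) simp_all
    finally have "[(p - 1) * y * ((m - 1) * w) + w = 0] (mod m)" by (simp add: cong_def)
    then show ?thesis by (simp add: x_def mult_ac)
  qed
  then have "[Q * q * ((p - 1) * x + w) = 0] (mod (M * q))"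
    by (auto simp: cong_0_iff M_eq mult_ac)
  then have key: "[Q * q * w + p * (Q * q * x) = Q * q * x] (mod (M * q))"
  proof -
    have "Q * q * w + p * (Q * q * x) = Q * q * ((p - 1) * x + w) + Q * q * x"
      using p_gt_1 by (cases p) (simp_all add: algebra_simps)
    also have "[\<dots> = 0 + Q * q * x] (mod (M * q))"
      using \<open>[Q * q * ((p - 1) * x + w) = 0] (mod (M * q))\<close> by (intro cong_add cong_refl)
    finally show ?thesis by simp
  qed
  define d where "d = Q * q * x mod (M * q)"
  have dcong: "[Q * q * x = d] (mod (M * q))" by (simp only: cong_def d_def mod_mod_trivial)
  have Qd: "Q * q dvd M * q" by (simp add: M_eq)
  have dC: "(d, 0) \<in> C" using pos Qd by (simp add: C_def d_def dvd_mod_iff)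
  then have dB: "(d, 0) \<in> B" unfolding B_def C_def by (auto intro: dvd_mult_right)
  have cB: "c \<in> B" using c unfolding B_def C_def by (auto intro: dvd_mult_right)
  have "1 < M * q" using M_gt_1 q_gt_1 by (metis One_nat_def less_1_mult)
  then have kH: "(1, 0) \<in> carrier H" using pos by simp
  have "(d, 0) \<star> (1, 0) = c \<star> ((1, 0) \<star> (d, 0))"
  proof -
    have "[d + 1 = Q * q * x + 1] (mod (M * q))" by (intro cong_add cong_refl cong_sym[OF dcong])
    also have "[Q * q * x + 1 = (Q * q * w + p * (Q * q * x)) + 1] (mod (M * q))"
      using key by (intro cong_add cong_refl) (simp add: cong_sym_eq)
    also have "(Q * q * w + p * (Q * q * x)) + 1 = Q * q * w + (1 + p * (Q * q * x))" by simp
    also have "[\<dots> = Q * q * w + (1 + p * d)] (mod (M * q))" by (intro cong_add cong_mult dcong cong_refl)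
    also have "[Q * q * w + (1 + p * d) = Q * q * w + (1 + p * d) mod (M * q)] (mod (M * q))"
      by (intro cong_add cong_refl) (simp only: cong_def mod_mod_trivial)
    finally have fst_eq: "(d + 1) mod (M * q) = (Q * q * w + (1 + p * d) mod (M * q)) mod (M * q)"
      by (simp only: cong_def)
    have "(1, 0) \<star> (d, 0) = ((1 + p * d) mod (M * q), 0)" unfolding mult_H by simp
    then have "c \<star> ((1, 0) \<star> (d, 0)) = ((Q * q * w + (1 + p * d) mod (M * q)) mod (M * q), 0)"
      using B_mult[OF cB[unfolded w(1)]] by (simp only: w(1) add_0 mod_0)
    moreover have "(d, 0) \<star> (1, 0) = ((d + 1) mod (M * q), 0)"
      unfolding B_mult[OF dB] by (simp only: add_0 mod_0)
    ultimately show ?thesis by (simp only: fst_eq)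
  qed
  then have "(d, 0) \<star> (1, 0) \<star> inv\<^sub>H (d, 0) \<star> inv\<^sub>H (1, 0) = c"
    using dC kH c by (intro H.commutator_eqI) (auto simp: C_def simp del: mult_H)
  then show ?thesis using dC kH by blast
qed

lemma C_nontrivial: "\<exists>c\<in>C. c \<noteq> \<one>\<^sub>H"
proof
  have "Q > 0" using pos M_eq by (cases Q) auto
  then have "Q * q < M * q" "Q * q \<noteq> 0" using m_gt_1 pos M_eq by simp_all
  then show "(Q * q, 0) \<in> C" "(Q * q, 0) \<noteq> \<one>\<^sub>H" using pos by (simp_all add: C_def)
qed

end

section \<open>Discrete logarithms in the field\<close>

context kummer
begin

text \<open>The subset is wrapped into a ring record in order to quote that finite multiplicative
  groups of fields are cyclic. The factor \<open>e\<close> makes exponent zero give the identity of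
  \<open>F\<close>.\<close>

lemma generator:
  obtains g where "g \<in> F" "g \<noteq> 0" "\<And>x. x \<in> F \<Longrightarrow> x \<noteq> 0 \<Longrightarrow> \<exists>i. x = e * g ^ i"
proof -
  define K :: "int poly quotients ring"
    where "K = \<lparr>carrier = F, monoid.mult = times, one = e, zero = 0, add = plus\<rparr>"
  have K: "carrier K = F" "monoid.mult K = times" "one K = e" "ring.zero K = 0" "ring.add K = plus"
    by (simp_all add: K_def)
  have "cring K"
  proof (rule cringI)
    show "abelian_group K"
      by (rule abelian_groupI) (auto simp: K F_add F_0 add_ac intro: F_minus exI[of _ "- x" for x] intro!: bexI[OF _ F_minus])
    show "comm_monoid K"
      by (rule comm_monoidI) (auto simp: K F_mult F_e e_mult e_mult[unfolded mult.commute[of e]] mult_ac)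
  qed (simp add: K distrib_right)
  then interpret K: cring K .
  have inv: "\<exists>y\<in>F. y * x = e" if x: "x \<in> F" "x \<noteq> 0" for x
  proof -
    have "2 ^ 1 \<le> p ^ q" using p q_pos prime_ge_2_nat by (metis One_nat_def Suc_leI power_increasing power_mono le_trans one_le_numeral zero_le)
    then obtain k where "p ^ q - 1 = Suc k" by (cases "p ^ q - 1") auto
    then have k: "x ^ k * x = e" using power_card_minus_1[OF x] by (simp add: mult.commute)
    show ?thesis
    proof
      show "(e * x ^ k) * x = e" unfolding mult.assoc k by (rule e_mult[OF F_e])
      show "e * x ^ k \<in> F" using x F_e F_power[of x k] by (cases "k = 0") (auto intro: F_mult)
    qed
  qed
  have "field K"
    by (rule K.cring_fieldI2) (use inv e_neq_0 in \<open>auto simp: K mult.commute\<close>)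
  then interpret K: field K .
  have pow: "a [^]\<^bsub>K\<^esub> (i::nat) = e * a ^ i" for a i
    by (induction i) (simp_all add: nat_pow_def K mult_ac)
  obtain a where a: "a \<in> carrier (mult_of K)" "carrier (mult_of K) = {a [^]\<^bsub>K\<^esub> i | i::nat. i \<in> UNIV}"
    using K.finite_field_mult_group_has_gen finite_F by (auto simp: K)
  show ?thesis
  proof (rule that)
    show "a \<in> F" "a \<noteq> 0" using a(1) by (simp_all add: K)
    show "\<exists>i. x = e * a ^ i" if "x \<in> F" "x \<noteq> 0" for x
    proof -
      have "x \<in> carrier (mult_of K)" using that by (simp add: K)
      then show ?thesis unfolding a(2) pow by blast
    qed
  qed
qed

end

locale kummer_gen = kummer +
  fixes g :: "int poly quotients"
  assumes g: "g \<in> F" "g \<noteq> 0" and gen: "\<And>x. x \<in> F \<Longrightarrow> x \<noteq> 0 \<Longrightarrow> \<exists>i. x = e * g ^ i"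
begin

text \<open>Exponents modulo p^q - 1 replace nonzero field elements; semilinear maps become affine
  maps of exponents, so identities between them become congruences.\<close>

definition P :: "nat \<Rightarrow> int poly quotients" where "P i = e * g ^ i"

lemma P_F: "P i \<in> F"
  unfolding P_def using F_e g(1) F_power[of g i] by (cases "i = 0") (auto intro: F_mult)

lemma P_add: "P (i + j) = P i * P j"
proof -
  have "P i * P j = (e * e) * g ^ (i + j)" by (simp only: P_def power_add mult_ac)
  then show ?thesis by (simp add: e_mult F_e P_def)
qed

lemma P_0: "P 0 = e" by (simp add: P_def)

lemma P_power: "k > 0 \<Longrightarrow> P i ^ k = P (i * k)"
  by (simp add: P_def power_mult_distrib e_power power_mult)

lemma card_gt_1: "p ^ q > 1"
  using one_less_power[OF prime_gt_1_nat[OF p] q_pos] .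

lemma P_card: "P (p ^ q - 1) = e"
  using power_card_minus_1[OF g] by (simp add: P_def e_mult F_e)

lemma P_neq_0: "P i \<noteq> 0"
proof
  assume "P i = 0"
  have "P i * P (i * (p ^ q - 1) - i) = P (i * (p ^ q - 1))"
    using card_gt_1 by (cases "p ^ q - 1") (simp_all flip: P_add)
  also have "\<dots> = P (p ^ q - 1) ^ i" if "i > 0" using that by (simp add: P_power mult.commute)
  finally show False using \<open>P i = 0\<close> P_card e_power[of i] e_neq_0 P_0 by (cases "i = 0") auto
qed

lemma P_mod: "P (i mod (p ^ q - 1)) = P i"
proof -
  let ?N = "p ^ q - 1"
  have "P (?N * k) = e" for k
    by (induction k) (simp_all add: P_0 P_add P_card e_mult F_e del: One_nat_def)
  then have "P (?N * (i div ?N) + i mod ?N) = P (i mod ?N)" unfolding P_add using P_F e_mult by simp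
  then show ?thesis by simp
qed

text \<open>By counting: the p^q - 1 residues map onto the same number of nonzero elements, hence
  injectively.\<close>

lemma P_eq_iff: "P i = P j \<longleftrightarrow> [i = j] (mod (p ^ q - 1))"
proof -
  let ?N = "p ^ q - 1"
  have N: "?N > 0" using card_gt_1 by simp
  have "P ` {..<?N} = F - {0}"
  proof (intro equalityI subsetI)
    fix x assume "x \<in> F - {0}"
    then obtain i where "x = P i" using gen by (auto simp: P_def)
    then have "x = P (i mod ?N)" by (simp only: P_mod)
    then show "x \<in> P ` {..<?N}" using N by simp
  qed (use P_F P_neq_0 in auto)
  moreover have "card (F - {0}) = ?N" using F_0 finite_F by (simp add: card_F)
  ultimately have "inj_on P {..<?N}" by (intro eq_card_imp_inj_on) simp_all
  then have "P (i mod ?N) = P (j mod ?N) \<longleftrightarrow> i mod ?N = j mod ?N"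
    by (rule inj_on_eq_iff) (use N in simp_all)
  then show ?thesis by (simp only: P_mod cong_def)
qed

end

section \<open>The operator group acting on the field\<close>

locale heis_construction = K: kummer_gen p q d g + heis_params p q r M t m Q
  for p q d g r M t m Q
begin

definition twist :: "(nat \<times> nat \<Rightarrow> nat) \<Rightarrow> nat \<times> nat \<Rightarrow> int poly quotients \<Rightarrow> int poly quotients" where
  "twist E h x = K.P (E h) * x ^ (p ^ fst h)"

lemma F_cases:
  assumes "x \<in> K.F" obtains "x = 0" | i where "x = K.P i"
  using assms K.gen K.P_def by metis

lemma P_eq_iff: "K.P i = K.P j \<longleftrightarrow> [i = j] (mod N)"
  by (simp add: K.P_eq_iff N_def)

lemma p_power_pos: "p ^ u > 0" using pos by simp

lemma twist_P: "twist E h (K.P j) = K.P (E h + j * p ^ fst h)"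
  by (simp add: twist_def K.P_power[OF p_power_pos] K.P_add)

lemma twist_0: "twist E h 0 = 0"
  by (simp add: twist_def zero_power[OF p_power_pos])

text \<open>The hypothesis says that \<open>E\<close> is a crossed homomorphism into the exponents
  modulo N, on which \<open>h\<close> acts as multiplication by p to the power
  \<open>fst h\<close>.\<close>

lemma twist_action:
  assumes E: "\<And>h k. h \<in> carrier H \<Longrightarrow> k \<in> carrier H \<Longrightarrow> [E (h \<star> k) = E h + p ^ fst h * E k] (mod N)"
    and E1: "E \<one>\<^sub>H = 0"
  shows "lin_action H K.F (twist E)"
proof (unfold_locales)
  fix h x assume h: "h \<in> carrier H" and x: "x \<in> K.F"
  show "twist E h x \<in> K.F"
    unfolding twist_def by (intro K.F_mult K.P_F K.F_power x p_power_pos)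
next
  fix h x y assume "h \<in> carrier H" and xy: "x \<in> K.F" "y \<in> K.F"
  then show "twist E h (x + y) = twist E h x + twist E h y"
    by (simp add: twist_def K.frob_iter_add distrib_left)
next
  fix h k x assume h: "h \<in> carrier H" and k: "k \<in> carrier H" and x: "x \<in> K.F"
  show "twist E (h \<star> k) x = twist E h (twist E k x)"
    using x
  proof (cases rule: F_cases)
    case 1
    then show ?thesis by (simp add: twist_0)
  next
    case (2 j)
    have "[E (h \<star> k) + j * p ^ fst (h \<star> k) = (E h + p ^ fst h * E k) + j * p ^ (fst h + fst k)] (mod N)"
      by (intro cong_add cong_mult cong_refl E h k p_power_cong fst_mult)
    also have "(E h + p ^ fst h * E k) + j * p ^ (fst h + fst k) = E h + (E k + j * p ^ fst k) * p ^ fst h"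
      by (simp add: algebra_simps power_add)
    finally show ?thesis unfolding 2 twist_P P_eq_iff .
  qed
next
  fix x assume x: "x \<in> K.F"
  then show "twist E \<one>\<^sub>H x = x" using E1 by (simp add: twist_def K.P_0 K.e_mult)
qed (simp_all add: K.F_0 K.F_minus)

text \<open>Multiplying the exponents by \<open>M\<close> kills the Frobenius twist, as \<open>N\<close> divides \<open>M (p - 1)\<close>.\<close>
lemma twist_fixed:
  assumes "x \<in> K.F" "x \<noteq> 0" "twist E h x = x"
  shows "N dvd M * E h" "q dvd fst h \<Longrightarrow> N dvd E h"
proof -
  obtain j where j: "x = K.P j" using assms(1,2) by (auto elim: F_cases)
  define w where "w = p ^ fst h - 1"
  have w: "p ^ fst h = w + 1" using p_power_pos[of "fst h"] by (simp add: w_def)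
  have "[E h + j * p ^ fst h = j] (mod N)" using assms(3) unfolding j twist_P P_eq_iff .
  then have "[(E h + j * w) + j = 0 + j] (mod N)" by (simp add: w algebra_simps)
  then have dvd: "N dvd E h + j * w" by (simp only: cong_add_rcancel_nat cong_0_iff)
  have "[p ^ fst h = 1 ^ fst h] (mod (p - 1))"
    by (intro cong_pow) (use p_gt_1 in \<open>simp add: cong_1_iff_dvd_nat[unfolded One_nat_def]\<close>)
  then have 1: "[p ^ fst h = 1] (mod (p - 1))" by (simp only: power_one)
  have "p - 1 dvd w" unfolding w_def
    by (rule iffD1[OF cong_1_iff_dvd_nat 1]) (use p_power_pos[of "fst h"] in linarith)
  then have "N dvd M * w" using N_dvd unfolding N_def by (meson dvd_trans mult_dvd_mono dvd_refl)
  moreover have "N dvd M * E h + j * (M * w)" using dvd_mult[OF dvd, of M] by (simp add: algebra_simps)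
  ultimately show "N dvd M * E h" by (metis dvd_add_left_iff dvd_mult)
  assume "q dvd fst h"
  then have "[p ^ fst h = p ^ 0] (mod N)" by (intro p_power_cong) (simp add: cong_0_iff)
  then have 2: "[p ^ fst h = 1] (mod N)" by (simp only: power_0)
  have "N dvd w" unfolding w_def
    by (rule iffD1[OF cong_1_iff_dvd_nat 2]) (use p_power_pos[of "fst h"] in linarith)
  then show "N dvd E h" using dvd by (metis dvd_add_left_iff dvd_mult)
qed

text \<open>\<open>E1 a\<close> is the exponent of c s^a. The first coordinate uses a = 1 and the
  second a = r - 1, which stands for -1 since s^r = 1; \<open>E2\<close> is their sum, from which s
  cancels.\<close>

definition "E1 a h = r * t * fst h + t * (M * q) * (a * snd h)" for a h
definition "E2 h = 2 * (r * t * fst h)" for h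

lemma fst_mult_exponent: "[r * t * fst (h \<star> k) = r * t * fst h + p ^ fst h * (r * t * fst k)] (mod N)"
proof -
  have "[fst (h \<star> k) = fst h + p ^ fst h * fst k] (mod (M * q))"
    by (cases h; cases k) (simp add: cong_def)
  then have "[r * t * fst (h \<star> k) = r * t * (fst h + p ^ fst h * fst k)] (mod (r * t * (M * q)))"
    by (simp only: cong_def mult_mod_right[symmetric])
  then show ?thesis by (simp add: N_eq' algebra_simps)
qed

text \<open>As r divides p - 1, the root of unity s lies in the prime field and commutes with the
  Frobenius twist.\<close>

lemma snd_mult_exponent:
  "[t * (M * q) * (a * snd (h \<star> k)) = t * (M * q) * (a * snd h) + p ^ fst h * (t * (M * q) * (a * snd k))] (mod N)"
proof -
  have "[snd (h \<star> k) = snd h + 1 * snd k] (mod r)"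
    by (cases h; cases k) (simp add: cong_def)
  also have "[snd h + 1 * snd k = snd h + p ^ fst h * snd k] (mod r)"
    by (intro cong_add cong_mult cong_refl cong_sym[OF p_cong_r])
  finally have "[a * snd (h \<star> k) = a * (snd h + p ^ fst h * snd k)] (mod r)"
    by (intro cong_mult cong_refl)
  then have "[t * (M * q) * (a * snd (h \<star> k)) = t * (M * q) * (a * (snd h + p ^ fst h * snd k))] (mod (t * (M * q) * r))"
    by (simp only: cong_def mult_mod_right[symmetric])
  then show ?thesis by (simp add: N_eq' algebra_simps)
qed

lemma E1_action: "lin_action H K.F (twist (E1 a))"
proof (rule twist_action)
  fix h k
  show "[E1 a (h \<star> k) = E1 a h + p ^ fst h * E1 a k] (mod N)"
    using cong_add[OF fst_mult_exponent[of h k] snd_mult_exponent[of a h k]]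
    by (simp only: E1_def distrib_left add_ac)
qed (simp add: E1_def)

lemma E2_action: "lin_action H K.F (twist E2)"
proof (rule twist_action)
  fix h k
  show "[E2 (h \<star> k) = E2 h + p ^ fst h * E2 k] (mod N)"
    using cong_mult[OF cong_refl[of 2] fst_mult_exponent[of h k]]
    by (simp only: E2_def distrib_left mult.left_commute)
qed (simp add: E2_def)

lemma q_dvd_of_MN: "N dvd M * (r * t * x) \<Longrightarrow> q dvd x"
  using pos unfolding N_eq' by (simp add: mult_ac)

text \<open>The multiple by M gives q r | r u + M q a v, and since r is coprime to M q and to
  \<open>a\<close>, this splits into q | u and r | v. The Frobenius twist is then absent, so the
  scalar itself must be 1 and u = 0.\<close>

lemma E1_free:
  assumes h: "h \<in> carrier H" and a: "coprime a r" and x: "x \<in> K.F" "twist (E1 a) h x = x" "x \<noteq> 0"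
  shows "h = \<one>\<^sub>H"
proof -
  obtain u v where u: "h = (u, v)" "u < M * q" "v < r" using h by (cases h) simp
  have "N dvd M * E1 a h" by (rule twist_fixed[OF x(1,3,2)])
  moreover have "M * E1 a h = (M * t) * (r * u + (M * q) * (a * v))" by (simp add: E1_def u algebra_simps)
  moreover have "N = (M * t) * (q * r)" by (simp add: N_eq')
  ultimately have dvd: "q * r dvd r * u + (M * q) * (a * v)" using pos by simp
  then have "q dvd r * u + q * (M * (a * v))" by (metis dvd_mult_left mult.assoc mult.commute)
  then have "q dvd r * u" by (metis dvd_add_left_iff dvd_triv_left)
  moreover have "coprime q r" using r_coprime by (simp add: coprime_commute)
  ultimately have qu: "q dvd u" by (simp add: coprime_dvd_mult_right_iff)
  have "r dvd r * u + (M * q) * (a * v)" using dvd by (metis dvd_mult_right)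
  then have "r dvd (M * q) * (a * v)" by (metis dvd_add_right_iff dvd_triv_left)
  then have "r dvd v" using r_coprime a by (simp add: coprime_dvd_mult_right_iff coprime_commute)
  then have v: "v = 0" using u by (auto dest: dvd_imp_le)
  have "N dvd E1 a h" using twist_fixed(2)[OF x(1,3,2)] qu u by simp
  then have "(r * t) * (M * q) dvd (r * t) * u" by (simp add: N_eq' E1_def u v mult_ac)
  then have "M * q dvd u" using pos by (simp only: nat_mult_dvd_cancel_disj) simp
  then have "u = 0" using u by (auto dest: dvd_imp_le)
  then show ?thesis using u v by simp
qed

text \<open>The argument is that of \<open>E1_free\<close> for the first component alone; the factor
  2 is cancelled because q and M are odd.\<close>

lemma E2_free:
  assumes h: "h \<in> carrier H" and x: "x \<in> K.F" "twist E2 h x = x" "x \<noteq> 0"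
  shows "h \<in> R"
proof -
  obtain u v where u: "h = (u, v)" "u < M * q" "v < r" using h by (cases h) simp
  have "N dvd M * E2 h" by (rule twist_fixed[OF x(1,3,2)])
  then have "q dvd 2 * u" by (intro q_dvd_of_MN) (simp add: E2_def u mult_ac)
  then have qu: "q dvd u" using q_odd by (simp add: coprime_dvd_mult_right_iff)
  have "N dvd E2 h" using twist_fixed(2)[OF x(1,3,2)] qu u by simp
  then have "(r * t) * (M * q) dvd (r * t) * (2 * u)" by (simp add: N_eq' E2_def u mult_ac)
  then have "M * q dvd 2 * u" using pos by (simp only: nat_mult_dvd_cancel_disj) simp
  then have "M * q dvd u" using q_odd M_odd by (simp add: coprime_dvd_mult_right_iff)
  then have "u = 0" using u by (auto dest: dvd_imp_le)
  then show ?thesis using u by (simp add: R_def)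
qed

lemma E1_E2: "x \<in> K.F \<Longrightarrow> y \<in> K.F \<Longrightarrow> twist (E1 1) h x * twist (E1 (r - 1)) h y = twist E2 h (x * y)"
proof -
  have "E1 1 h + E1 (r - 1) h = E2 h + N * snd h"
  proof -
    have r: "1 * snd h + (r - 1) * snd h = r * snd h" using pos by (cases r) simp_all
    have "E1 1 h + E1 (r - 1) h = E2 h + t * (M * q) * (1 * snd h + (r - 1) * snd h)"
      by (simp only: E1_def E2_def distrib_left mult_2 add_ac)
    then show ?thesis unfolding r by (simp add: N_eq' mult_ac)
  qed
  then have "[E1 1 h + E1 (r - 1) h = E2 h] (mod N)" by (simp add: cong_def)
  then have "K.P (E2 h) = K.P (E1 1 h) * K.P (E1 (r - 1) h)" by (simp only: P_eq_iff cong_sym flip: K.P_add)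
  then show ?thesis unfolding twist_def power_mult_distrib by (simp only: mult_ac)
qed

lemma E2_R: "h \<in> R \<Longrightarrow> x \<in> K.F \<Longrightarrow> twist E2 h x = x"
  by (auto simp: R_def twist_def E2_def K.P_0 K.e_mult)

lemma exists_group:
  "\<exists>G :: nat monoid. group G \<and> finite (carrier G) \<and> solvable G \<and>
     derived_length G = 4 \<and> fitting_height G = 3 \<and>
     char_degrees G = {1, q, M * q * r, p ^ q * (M * q)}"
proof -
  have "finite (K.F \<times> K.F \<times> K.F \<times> carrier H)" using K.finite_F finite_H by simp
  then obtain \<nu> :: "_ \<Rightarrow> nat" where \<nu>: "inj_on \<nu> (K.F \<times> K.F \<times> K.F \<times> carrier H)"
    using finite_imp_inj_to_nat_seg by blast
  interpret heis_ext_series H K.F K.e "twist (E1 1)" "twist (E1 (r - 1))" "twist E2" \<nu> R B q \<psi> K.\<epsilon> C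
  proof (intro heis_ext_series.intro heis_ext_chars.intro heis_ext.intro heis_ext_axioms.intro
      heis_ext_chars_axioms.intro heis_ext_series_axioms.intro)
    have r1: "coprime (r - 1) r" using pos by (metis coprime_diff_one_left_nat)
    show "h = \<one>\<^sub>H" if "h \<in> carrier H" "x \<in> K.F" "twist (E1 (r - 1)) h x = x" "x \<noteq> 0" for h x
      by (rule E1_free[OF that(1) r1 that(2-4)])
    show "h = \<one>\<^sub>H" if "h \<in> carrier H" "x \<in> K.F" "twist (E1 1) h x = x" "x \<noteq> 0" for h x
      by (rule E1_free[OF that(1) _ that(2-4)]) simp
    show "\<exists>y\<in>K.F. x * y = K.e" if x: "x \<in> K.F" "x \<noteq> 0" for x
    proof -
      obtain i where i: "x = K.P i" using x by (auto elim: F_cases)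
      have "[i + i * (N - 1) = 0] (mod N)" using N_pos by (cases N) (simp_all add: cong_0_iff flip: mult_Suc_right)
      then have "x * K.P (i * (N - 1)) = K.e" by (simp only: i P_eq_iff flip: K.P_add K.P_0)
      then show ?thesis using K.P_F by blast
    qed
    show "\<exists>x\<in>K.F. K.\<epsilon> x \<noteq> 1" using K.\<epsilon>_e K.F_e by blast
    show "lin_action H K.F (twist (E1 1))" "lin_action H K.F (twist (E1 (r - 1)))" "lin_action H K.F (twist E2)"
      by (rule E1_action E2_action)+
    show "\<psi> \<one>\<^sub>H = 1" by (simp add: \<psi>_def)
    show "C \<subseteq> carrier H" by (auto simp: C_def)
    show "twist (E1 1) h x * twist (E1 (r - 1)) h y = twist E2 h (x * y)"
      if "h \<in> carrier H" "x \<in> K.F" "y \<in> K.F" for h x y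
      by (rule E1_E2[OF that(2,3)])
  qed (fact group_H K.finite_F finite_H K.F_0 K.F_minus K.F_add K.F_mult K.F_e K.e_mult K.e_neq_0 E1_E2 \<nu>
      R_subgroup R_comm E2_R E2_free B_normal B_comm card_B B_cyclic \<psi>_mult \<psi>_moved K.\<epsilon>_add K.\<epsilon>_0
      comm_H C_comm C_nontrivial)+
  have "char_degrees G = {1, q, order H, card K.F * (M * q)}"
    by (rule char_degrees_G) (simp add: card_R order_H)
  then show ?thesis
    using group_G finite_G solvable_G derived_length_G fitting_height_G
    by (intro exI[of _ G]) (simp add: order_H K.card_F)
qed

end

section \<open>Arithmetic of the parameters\<close>

lemma geometric_quotient:
  assumes "p > (1::nat)"
  shows "(p ^ q - 1) div (p - 1) = (\<Sum>i<q. p ^ i)" "(p - 1) * (\<Sum>i<q. p ^ i) = p ^ q - 1"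
proof -
  have "(p - 1) * (\<Sum>i<q. p ^ i) + 1 = p ^ q"
  proof (induction q)
    case (Suc q)
    have "(p - 1) * (\<Sum>i<Suc q. p ^ i) + 1 = ((p - 1) * (\<Sum>i<q. p ^ i) + 1) + (p - 1) * p ^ q"
      by (simp add: distrib_left)
    also have "\<dots> = p * p ^ q" unfolding Suc using assms by (cases p) simp_all
    finally show ?case by simp
  qed simp
  then show 2: "(p - 1) * (\<Sum>i<q. p ^ i) = p ^ q - 1" by simp
  show "(p ^ q - 1) div (p - 1) = (\<Sum>i<q. p ^ i)" unfolding 2[symmetric] using assms by simp
qed

text \<open>Modulo \<open>q^2\<close> one has \<open>p^i = 1 + i (p - 1)\<close>, and for odd \<open>q\<close> the sum of the \<open>i < q\<close>
  is divisible by \<open>q\<close>.\<close>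
lemma geometric_sum_mod_square:
  fixes p q :: nat
  assumes q: "odd q" and p: "p = 1 + q * u"
  shows "[(\<Sum>i<q. p ^ i) = q] (mod q ^ 2)"
proof -
  have pow: "[p ^ i = 1 + i * (q * u)] (mod q ^ 2)" for i
  proof (induction i)
    case (Suc i)
    have "[p * p ^ i = p * (1 + i * (q * u))] (mod q ^ 2)" by (intro cong_mult Suc cong_refl)
    also have "p * (1 + i * (q * u)) = (1 + Suc i * (q * u)) + q ^ 2 * (i * u * u)"
      by (simp add: p algebra_simps power2_eq_square)
    also have "[\<dots> = 1 + Suc i * (q * u)] (mod q ^ 2)" by (simp add: cong_def)
    finally show ?case by simp
  qed simp
  obtain l where l: "q = 2 * l + 1" using q by (elim oddE)
  have "(\<Sum>i<q. i) = q * l"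
  proof -
    have "2 * (\<Sum>i<n. i) + n = n * n" for n :: nat by (induction n) simp_all
    from this[of q] have "2 * (\<Sum>i<q. i) = 2 * (q * l)" by (simp add: l algebra_simps)
    then show ?thesis by simp
  qed
  moreover have "(\<Sum>i<q. 1 + i * (q * u)) = q + (\<Sum>i<q. i) * (q * u)"
    unfolding sum.distrib sum_distrib_right[symmetric] by simp
  ultimately have "(\<Sum>i<q. 1 + i * (q * u)) = q + q ^ 2 * (l * u)"
    by (simp only: power2_eq_square mult_ac)
  moreover have "[(\<Sum>i<q. p ^ i) = (\<Sum>i<q. 1 + i * (q * u))] (mod q ^ 2)" by (intro cong_sum pow)
  ultimately show ?thesis by (simp add: cong_def)
qed

text \<open>With S = (p^q - 1)/(p - 1), the congruence S = q modulo q^2 gives S = q m with m prime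
  to q, and S = q modulo p - 1 shows that a common prime divisor of m and p - 1 would have to be q.
  The cofactor t is (p - 1)/(Q r).\<close>

lemma heis_params_exist:
  fixes p q r :: nat
  assumes p: "prime p" and q: "prime q" "odd q" "q dvd p - 1" and r: "r dvd p - 1" "coprime r q"
  defines "m \<equiv> pprime_part q ((p ^ q - 1) div (p - 1))" and "Q \<equiv> ppart q (p - 1)"
  shows "\<exists>t. heis_params p q r (m * Q) t m Q"
proof -
  define S where "S = (\<Sum>i<q. p ^ i)"
  have p1: "p > 1" using p by (rule prime_gt_1_nat)
  have q1: "q > 1" using q(1) by (rule prime_gt_1_nat)
  have S: "(p ^ q - 1) div (p - 1) = S" "(p - 1) * S = p ^ q - 1"
    unfolding S_def by (rule geometric_quotient[OF p1])+
  obtain u where u: "p - 1 = q * u" using q(3) by (elim dvdE)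
  then have pu: "p = 1 + q * u" using p1 by simp
  have sq: "[S = q] (mod q ^ 2)" unfolding S_def by (rule geometric_sum_mod_square[OF q(2) pu])
  then have "[S = q] (mod q)" by (rule cong_dvd_modulus_nat) simp
  then have "q dvd S" by (metis cong_dvd_iff dvd_refl)
  then obtain m' where m': "S = q * m'" by (elim dvdE)
  have qm: "\<not> q dvd m'"
  proof
    assume "q dvd m'"
    then have "q ^ 2 dvd S" by (simp add: m' power2_eq_square)
    then have "q ^ 2 dvd q" using sq by (metis cong_dvd_iff)
    then have "q ^ 2 \<le> q" using q1 by (intro dvd_imp_le) simp_all
    then show False using q1 by (simp add: power2_eq_square)
  qed
  have S0: "S \<noteq> 0" using qm m' q1 by (cases "m' = 0") auto
  have "multiplicity q S = 1"
  proof (rule multiplicity_eqI)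
    show "q ^ 1 dvd S" by (simp add: m')
    show "\<not> q ^ Suc 1 dvd S" using qm q1 by (simp add: m' power2_eq_square)
  qed
  moreover have "m = S div q ^ multiplicity q S" unfolding m_def S(1) pprime_part_def ppart_def ..
  ultimately have mm: "m = m'" using q1 by (simp add: m')
  have Sm: "S = q * m" using mm m' by simp
  have "p - 1 \<noteq> 0" using p1 by simp
  then have "multiplicity q (p - 1) > 0" using q by (simp add: prime_multiplicity_gt_zero_iff)
  then have qQ: "q dvd Q" by (simp add: Q_def ppart_def)
  have Qdvd: "Q dvd p - 1" unfolding Q_def ppart_def by (rule multiplicity_dvd)
  have "[S = q] (mod (p - 1))"
  proof -
    have "[p ^ i = 1] (mod (p - 1))" for i
    proof -
      have "[p = 1] (mod (p - 1))" by (rule iffD2[OF cong_1_iff_dvd_nat]) (use p1 in simp_all)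
      then have "[p ^ i = 1 ^ i] (mod (p - 1))" by (rule cong_pow)
      then show ?thesis by simp
    qed
    then have "[S = (\<Sum>i<q. 1)] (mod (p - 1))" unfolding S_def by (intro cong_sum)
    then show ?thesis by simp
  qed
  then have m_coprime: "coprime m (p - 1)"
  proof -
    assume c: "[S = q] (mod (p - 1))"
    have "\<not> l dvd p - 1" if l: "prime l" "l dvd m" for l
    proof
      assume lp: "l dvd p - 1"
      then have "[S = q] (mod l)" using c cong_dvd_modulus_nat by blast
      moreover have "l dvd S" using l(2) Sm by simp
      ultimately have "l dvd q" by (metis cong_dvd_iff)
      then have "l = q" using l(1) q(1) primes_dvd_imp_eq by blast
      then show False using l(2) qm mm by simp
    qed
    then have no: "\<not> (prime l \<and> l dvd gcd m (p - 1))" for l by auto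
    have "gcd m (p - 1) = 1" using prime_factor_nat[of "gcd m (p - 1)"] no by blast
    then show ?thesis by (simp only: coprime_iff_gcd_eq_1)
  qed
  \<comment> \<open>If m were 1, then S would equal q, but S is at least 1 + p while q is at most p
    - 1.\<close>
  have m1: "m > 1"
  proof -
    have "1 + p = (\<Sum>i<2. p ^ i)" by (simp add: numeral_2_eq_2)
    also have "\<dots> \<le> S" unfolding S_def using q1 by (intro sum_mono2) auto
    finally have "1 + p \<le> q * m" using Sm by simp
    moreover have "q \<le> p - 1" using q(3) p1 by (intro dvd_imp_le) simp_all
    ultimately show ?thesis by (cases "m = 0 \<or> m = 1") auto
  qed
  have rm: "coprime r m" using m_coprime r(1) by (metis coprime_commute coprime_divisors dvd_refl)
  have rQ: "coprime r Q" using r(2) by (simp add: Q_def ppart_def)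
  obtain s where s: "p - 1 = Q * s" using Qdvd by (elim dvdE)
  have "r dvd Q * s" using r(1) unfolding s .
  then have "r dvd s" using rQ by (simp only: coprime_dvd_mult_right_iff)
  then obtain t where t: "s = r * t" by (elim dvdE)
  have N: "p ^ q - 1 = (m * Q) * q * (r * t)"
    unfolding S(2)[symmetric] Sm s t by (simp add: mult_ac)
  have odd_p: "odd p"
  proof
    assume "even p"
    then have "p = 2" using p primes_dvd_imp_eq two_is_prime_nat by blast
    then show False using q(3) q1 by simp
  qed
  have "odd (\<Sum>i<n. p ^ i) = odd n" for n by (induction n) (use odd_p in auto)
  then have "odd S" unfolding S_def using q(2) by simp
  then have "odd m" using Sm by simp
  moreover have "odd Q" using q(2) by (simp add: Q_def ppart_def)
  ultimately have Modd: "odd (m * Q)" by simp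
  have "heis_params p q r (m * Q) t m Q"
  proof
    \<comment> \<open>This is where the q-part of p - 1 is needed: it absorbs the factor q of
      S.\<close>
    show "p ^ q - 1 dvd m * Q * (p - 1)"
    proof -
      have "p ^ q - 1 = (p - 1) * m * q" unfolding S(2)[symmetric] Sm by (simp add: mult_ac)
      also have "\<dots> dvd (p - 1) * m * Q" by (rule mult_dvd_mono[OF dvd_refl qQ])
      finally show ?thesis by (simp only: mult_ac)
    qed
    show "coprime r (m * Q * q)" using rm rQ r(2) by simp
  qed (fact assms N qQ Modd m1 m_coprime refl)+
  then show ?thesis ..
qed

theorem theorem3p2:
  fixes p q r :: nat
  assumes "prime p" and "prime q" and "odd q" and "q dvd p - 1"
    and "r dvd p - 1" and "coprime r q"
  shows "\<exists>G :: nat monoid. group G \<and> finite (carrier G) \<and> solvable G \<and>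
           derived_length G = 4 \<and> fitting_height G = 3 \<and>
           char_degrees G =
             {1, q,
              pprime_part q ((p ^ q - 1) div (p - 1)) * ppart q (p - 1) * q * r,
              p ^ q * pprime_part q ((p ^ q - 1) div (p - 1)) * ppart q (p - 1) * q}"
proof -
  let ?m = "pprime_part q ((p ^ q - 1) div (p - 1))" and ?Q = "ppart q (p - 1)"
  obtain t where t: "heis_params p q r (?m * ?Q) t ?m ?Q"
    using heis_params_exist[OF assms] by (elim exE)
  obtain d where "residue_primroot p d" using prime_primitive_root_exists[OF prime_gt_1_nat[OF assms(1)] assms(1)] by blast
  then have K: "kummer p q d" using assms by (simp add: kummer_def)
  then obtain g where "kummer_gen p q d g"
    using kummer.generator[OF K] by (metis kummer_gen.intro kummer_gen_axioms.intro)
  then interpret heis_construction p q d g r "?m * ?Q" t ?m ?Q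
    using t by (rule heis_construction.intro)
  show ?thesis using exists_group by (simp only: mult.assoc)
qed

end
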